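(* Let $N\ge 1$ and $1\le p<\infty$. Let $u,v\in W^{1,p}(\mathbb{R}^N)\cap C^1(\mathbb{R}^N)$ satisfy $u>0$ and $v>0$ on $\mathbb{R}^N$, $\lim_{|x|\to\infty}u(x)=\lim_{|x|\to\infty}v(x)=0$, and suppose that $u(x_1,x')$ and $v(x_1,x')$ are monotone decreasing with respect to $|x_1|$, i.e. for every $x'\in\mathbb{R}^{N-1}$ one has $u(x_1,x')\ge u(y_1,x')$ and $v(x_1,x')\ge v(y_1,x')$ whenever $|x_1|\le |y_1|$. Let $u\star v$ be the coupled rearrangement of $u$ and $v$. Then $$\int_{\mathbb{R}^N}|\nabla(u\star v)|^p\,dx<\int_{\mathbb{R}^N}|\nabla u|^p\,dx+\int_{\mathbb{R}^N}|\nabla v|^p\,dx .$$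
   Context: Write $x=(x_1,x')\in\mathbb{R}^N$ with $x_1\in\mathbb{R}$, $x'\in\mathbb{R}^{N-1}$, and let $\mathcal{L}^1$ be one-dimensional Lebesgue measure. For measurable $u,v:\mathbb{R}^N\to\mathbb{R}$ with $\lim_{|x|\to\infty}u(x)=\lim_{|x|\to\infty}v(x)=0$, the coupled rearrangement $u\star v:\mathbb{R}^N\to[0,\infty)$ is defined by $$(u\star v)(x_1,x')=\int_0^\infty \chi_{\{|u(\cdot,x')|>t\}\star\{|v(\cdot,x')|>t\}}(x_1)\,dt,$$ where $\chi_A$ is the characteristic function of $A$ and, for measurable $A,B\subset\mathbb{R}$ of finite measure, $A\star B$ is the open interval $\left(-(\mathcal{L}^1(A)+\mathcal{L}^1(B))/2,\ (\mathcal{L}^1(A)+\mathcal{L}^1(B))/2\right)$. Equivalently, for each $x'$ the function $x_1\mapsto(u\star v)(x_1,x')$ is symmetric and non-increasing in $|x_1|$, and for every $t>0$, $\mathcal{L}^1(\{x_1:(u\star v)(x_1,x')>t\})=\mathcal{L}^1(\{x_1:|u(x_1,x')|>t\})+\mathcal{L}^1(\{x_1:|v(x_1,x')|>t\})$. $\nabla(u\star v)$ denotes the weak gradient. *)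

theory Defs
  imports "HOL-Analysis.Analysis"
begin

definition partial :: "'n \<Rightarrow> (real^'n \<Rightarrow> real) \<Rightarrow> real^'n \<Rightarrow> real" where
  "partial i f x = frechet_derivative f (at x) (axis i 1)"

primrec C_k :: "nat \<Rightarrow> (real^'n \<Rightarrow> real) \<Rightarrow> bool" where
  "C_k 0 f \<longleftrightarrow> continuous_on UNIV f"
| "C_k (Suc m) f \<longleftrightarrow> f differentiable_on UNIV \<and> (\<forall>i. C_k m (partial i f))"

definition test_function :: "(real^'n \<Rightarrow> real) \<Rightarrow> bool" where
  "test_function \<phi> \<longleftrightarrow> (\<forall>m. C_k m \<phi>) \<and> compact (closure (support_on UNIV \<phi>))"

definition locally_integrable :: "(real^'n \<Rightarrow> 'b::euclidean_space) \<Rightarrow> bool" where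
  "locally_integrable f \<longleftrightarrow> (\<forall>K. compact K \<longrightarrow> f absolutely_integrable_on K)"

definition has_weak_gradient :: "(real^'n \<Rightarrow> real) \<Rightarrow> (real^'n \<Rightarrow> real^'n) \<Rightarrow> bool" where
  "has_weak_gradient u G \<longleftrightarrow> locally_integrable u \<and> locally_integrable G \<and>
    (\<forall>\<phi> i. test_function \<phi> \<longrightarrow>
      (LINT x|lebesgue. u x * partial i \<phi> x) = - (LINT x|lebesgue. G x $ i * \<phi> x))"

definition weakly_differentiable :: "(real^'n \<Rightarrow> real) \<Rightarrow> bool" where
  "weakly_differentiable u \<longleftrightarrow> (\<exists>G. has_weak_gradient u G)"

text \<open>A weak gradient is determined only up to a null set; one representative is chosen.
  The value is meaningful only for weakly differentiable functions.\<close>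

definition weak_gradient :: "(real^'n \<Rightarrow> real) \<Rightarrow> real^'n \<Rightarrow> real^'n" where
  "weak_gradient u = (SOME G. has_weak_gradient u G)"

definition in_Lp :: "real \<Rightarrow> (real^'n \<Rightarrow> 'b::euclidean_space) \<Rightarrow> bool" where
  "in_Lp p f \<longleftrightarrow> f \<in> borel_measurable lebesgue \<and> integrable lebesgue (\<lambda>x. norm (f x) powr p)"

definition in_W1p :: "real \<Rightarrow> (real^'n \<Rightarrow> real) \<Rightarrow> bool" where
  "in_W1p p u \<longleftrightarrow> in_Lp p u \<and> (\<exists>G. has_weak_gradient u G \<and> in_Lp p G)"

definition star_set :: "real set \<Rightarrow> real set \<Rightarrow> real set" where
  "star_set A B =
    {- ((measure lebesgue A + measure lebesgue B) / 2)
      <..< (measure lebesgue A + measure lebesgue B) / 2}"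

text \<open>The splitting \<open>x = (x\<^sub>1, x')\<close> is encoded by a distinguished index \<open>k\<close>: \<open>x\<^sub>1\<close> is \<open>x $ k\<close> and
  \<open>x'\<close> consists of the remaining coordinates. \<open>slice k u x\<close> is the function \<open>u (\<cdot>, x')\<close>; it does
  not depend on \<open>x $ k\<close>.\<close>

definition slice :: "'n \<Rightarrow> (real^'n \<Rightarrow> real) \<Rightarrow> real^'n \<Rightarrow> real \<Rightarrow> real" where
  "slice k u x s = u (\<chi> i. if i = k then s else x $ i)"

definition coupled_rearrangement ::
    "'n \<Rightarrow> (real^'n \<Rightarrow> real) \<Rightarrow> (real^'n \<Rightarrow> real) \<Rightarrow> real^'n \<Rightarrow> real" where
  "coupled_rearrangement k u v x =
    (LINT t:{0<..}|lebesgue.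
      indicat_real (star_set {s. \<bar>slice k u x s\<bar> > t} {s. \<bar>slice k v x s\<bar> > t}) (x $ k))"

definition decreasing_in_abs :: "'n \<Rightarrow> (real^'n \<Rightarrow> real) \<Rightarrow> bool" where
  "decreasing_in_abs k u \<longleftrightarrow>
    (\<forall>x s t. \<bar>s\<bar> \<le> \<bar>t\<bar> \<longrightarrow> slice k u x s \<ge> slice k u x t)"

end

theory Submission
  imports Defs
begin

text \<open>
  Write \<open>w\<close> for the coupled rearrangement of \<open>u\<close> and \<open>v\<close> in direction \<open>k\<close>. On a line parallel to the
  \<open>k\<close>-axis, \<open>u\<close> and \<open>v\<close> are even profiles \<open>U\<close> and \<open>V\<close>, decreasing away from \<open>0\<close>, so that their
  superlevel sets are centred intervals and \<open>w\<close> is the profile \<open>W\<close> whose superlevel sets have the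
  added lengths. Hence, for \<open>a, b \<ge> 0\<close> with \<open>a + b = s\<close>,
  \<open>min (U a) (V b) \<le> W s \<le> max (U a) (V b)\<close> (\<open>star_profile_lower\<close>, \<open>star_profile_upper\<close>).
  In particular \<open>W s = U a = V b\<close> as soon as the two values agree; such a splitting of \<open>s\<close> exists
  unless one profile at \<open>s\<close> exceeds the maximum of the other, and then \<open>W s\<close> is the value of that
  profile (\<open>split_point_cases\<close>).

  The same sandwich differentiates \<open>w\<close>. Let the splitting vary affinely with the point of the whole
  space, in such a way that the first-order parts of the two bounds agree; then \<open>w\<close> has this first-order
  part too (\<open>coupled_derivative_balanced\<close>). With \<open>P\<close> and \<open>Q\<close> the gradients of \<open>u\<close> and \<open>v\<close> at the split
  points and \<open>l = Q\<^sub>k / (P\<^sub>k + Q\<^sub>k)\<close>, the gradient of \<open>w\<close> agrees with \<open>l P + (1 - l) Q\<close> in all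
  components but the \<open>k\<close>-th, and its \<open>k\<close>-th component is half of that of \<open>l P + (1 - l) Q\<close>.
  By convexity, the \<open>p\<close>-th power of its norm is at most \<open>l |P|\<^sup>p + (1 - l) |Q|\<^sup>p\<close>, strictly less if \<open>P\<^sub>k\<close> and
  \<open>Q\<^sub>k\<close> are both nonzero. Moreover \<open>l\<close> is the derivative of the first part \<open>a\<close> of the splitting
  with respect to \<open>s\<close>, and \<open>1 - l\<close> that of \<open>b\<close>. Substituting \<open>a\<close> and \<open>b\<close> for \<open>s\<close> therefore
  turns the integral of the bound over \<open>s\<close> into the integrals of \<open>|\<nabla>u|\<^sup>p\<close> and \<open>|\<nabla>v|\<^sup>p\<close>.

  Splittings with \<open>P\<^sub>k = Q\<^sub>k = 0\<close> need another argument, as they can occupy a set of positive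
  measure on which the derivatives of \<open>a\<close> and \<open>b\<close> cannot be read off. There \<open>P = Q\<close> outside a negligible
  set of points, by Sard's theorem applied to the graph of an implicit function
  (\<open>negligible_degenerate_pairs\<close>), so \<open>w\<close> has the gradient \<open>P = Q\<close> and every weight serves. The
  weights are then supplied by the Stieltjes measures of \<open>a\<close> and \<open>b\<close>, whose sum is Lebesgue
  measure (\<open>half_line_split_integral\<close>).

  The inequality is strict on every line: otherwise one of the factors \<open>U' a\<close>, \<open>V' b\<close> would vanish at
  all splittings far out, which would make \<open>W\<close> constant there, although \<open>W\<close> is positive and tends to
  \<open>0\<close> (\<open>exists_noncritical_split\<close>).

  Finally, \<open>w\<close> is locally Lipschitz, because it is a maximum of functions that are so uniformly. A
  locally Lipschitz function that is differentiable almost everywhere has its classical gradient as a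
  weak gradient (\<open>locally_lipschitz_has_weak_gradient\<close>), and weak gradients are unique up to null
  sets (\<open>weak_gradient_unique\<close>), so the inequality between classical gradients is the claim.
\<close>

section \<open>Coupling two even profiles on the line\<close>

definition profile :: "(real \<Rightarrow> real) \<Rightarrow> bool" where
  "profile U \<longleftrightarrow> continuous_on UNIV U \<and> (\<forall>s t. \<bar>s\<bar> \<le> \<bar>t\<bar> \<longrightarrow> U t \<le> U s) \<and>
     (\<forall>s. 0 < U s) \<and> (U \<longlongrightarrow> 0) at_infinity"

definition star_profile :: "(real \<Rightarrow> real) \<Rightarrow> (real \<Rightarrow> real) \<Rightarrow> real \<Rightarrow> real" where
  "star_profile U V s =
    (LINT t:{0<..}|lebesgue. indicat_real (star_set {r. \<bar>U r\<bar> > t} {r. \<bar>V r\<bar> > t}) s)"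

lemma profileD:
  assumes "profile U"
  shows "continuous_on A U" "\<bar>s\<bar> \<le> \<bar>t\<bar> \<Longrightarrow> U t \<le> U s" "0 < U s" "U (- s) = U s" "U \<bar>s\<bar> = U s"
    "(U \<longlongrightarrow> 0) at_infinity"
proof -
  note P = assms[unfolded profile_def]
  show "continuous_on A U" using P continuous_on_subset by blast
  show "\<bar>s\<bar> \<le> \<bar>t\<bar> \<Longrightarrow> U t \<le> U s" "0 < U s" "(U \<longlongrightarrow> 0) at_infinity" using P by auto
  show "U (- s) = U s" using P by (metis abs_minus_cancel order_antisym order_refl)
  show "U \<bar>s\<bar> = U s" using P by (metis abs_idempotent order_antisym order_refl)
qed

lemma profile_eventually_small:
  assumes "profile U" "0 < t"
  obtains b where "0 < b" "\<And>s. b \<le> \<bar>s\<bar> \<Longrightarrow> U s < t"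
proof -
  have "eventually (\<lambda>s. dist (U s) 0 < t) at_infinity"
    using profileD(6)[OF assms(1)] assms(2) by (simp add: tendsto_iff)
  then obtain b where b: "\<And>s. b \<le> norm s \<Longrightarrow> dist (U s) 0 < t"
    unfolding eventually_at_infinity by blast
  show ?thesis
  proof (rule that[of "max b 1"])
    show "U s < t" if "max b 1 \<le> \<bar>s\<bar>" for s using b[of s] that by auto
  qed auto
qed

text \<open>
  The half length is the first nonnegative point at which the profile has dropped to the level; it
  exists since the profile is continuous and tends to \<open>0\<close>.
\<close>

lemma superlevel_set_interval:
  assumes U: "profile U" and t: "0 < t"
  obtains A where "0 \<le> A" "\<And>s. t < U s \<longleftrightarrow> \<bar>s\<bar> < A" "measure lebesgue {s. \<bar>U s\<bar> > t} = 2 * A"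
proof -
  obtain b where b: "0 < b" "\<And>s. b \<le> \<bar>s\<bar> \<Longrightarrow> U s < t" using profile_eventually_small[OF U t] by blast
  define S where "S = {0..} \<inter> {s. U s \<le> t}"
  define A where "A = Inf S"
  have "closed S" unfolding S_def
    using profileD(1)[OF U] by (intro closed_Int closed_Collect_le) auto
  moreover have "b \<in> S" using b(1) b(2)[of b] by (auto simp: S_def)
  moreover have bb: "bdd_below S" by (auto simp: S_def bdd_below_def)
  ultimately have "A \<in> S" unfolding A_def by (intro closed_contains_Inf) auto
  have lev: "t < U s \<longleftrightarrow> \<bar>s\<bar> < A" for s
  proof
    assume "t < U s"
    then have "\<not> A \<le> \<bar>s\<bar>" using \<open>A \<in> S\<close> profileD(2)[OF U, of A s] by (auto simp: S_def)
    then show "\<bar>s\<bar> < A" by simp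
  next
    assume "\<bar>s\<bar> < A"
    then have "\<bar>s\<bar> \<notin> S" unfolding A_def using cInf_lower[OF _ bb] by fastforce
    then show "t < U s" using profileD(5)[OF U, of s] by (auto simp: S_def)
  qed
  have "0 \<le> A" using \<open>A \<in> S\<close> by (auto simp: S_def)
  moreover have "{s. \<bar>U s\<bar> > t} = {-A<..<A}"
    by (auto simp: lev abs_of_pos[OF profileD(3)[OF U]])
  ultimately show ?thesis using lev that by simp
qed

text \<open>
  The integrand that defines the coupled profile at \<open>s\<close> is the indicator of the levels whose added half
  lengths exceed \<open>|s|\<close>. These levels form an initial segment of the positive half-line, whose length is
  the value; so each single level gives a lower or an upper bound.
\<close>

lemma
  assumes U: "profile U" and V: "profile V" and t: "0 < t"
  shows star_profile_ge_level:
    "\<bar>s\<bar> < (measure lebesgue {r. \<bar>U r\<bar> > t} + measure lebesgue {r. \<bar>V r\<bar> > t}) / 2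
      \<Longrightarrow> t \<le> star_profile U V s" (is "?a \<Longrightarrow> _")
  and star_profile_le_level:
    "(measure lebesgue {r. \<bar>U r\<bar> > t} + measure lebesgue {r. \<bar>V r\<bar> > t}) / 2 \<le> \<bar>s\<bar>
      \<Longrightarrow> star_profile U V s \<le> t" (is "?b \<Longrightarrow> _")
proof -
  define c where "c t = (measure lebesgue {r. \<bar>U r\<bar> > t} + measure lebesgue {r. \<bar>V r\<bar> > t}) / 2" for t
  have lm: "{r. \<bar>X r\<bar> > t} \<in> lmeasurable" if "profile X" "0 < t" for X :: "real \<Rightarrow> real" and t
  proof -
    from superlevel_set_interval[OF that] obtain A where A: "\<And>s. t < X s \<longleftrightarrow> \<bar>s\<bar> < A" by metis
    have "{r. \<bar>X r\<bar> > t} = {-A<..<A}" by (auto simp: A abs_of_pos[OF profileD(3)[OF that(1)]])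
    then show ?thesis by simp
  qed
  have mono: "measure lebesgue {r. \<bar>X r\<bar> > t'} \<le> measure lebesgue {r. \<bar>X r\<bar> > t}"
    if "profile X" "0 < t" "t \<le> t'" for X :: "real \<Rightarrow> real" and t t'
    by (rule measure_mono_fmeasurable) (use lm[OF that(1), of t] lm[OF that(1), of t'] that in auto)
  have cmono: "c t' \<le> c t" if "0 < t" "t \<le> t'" for t t'
    using mono[OF U that] mono[OF V that] by (simp add: c_def)
  \<comment> \<open>The levels that contribute to the integral at \<open>s\<close>.\<close>
  define J where "J = {t. 0 < t \<and> \<bar>s\<bar> < c t}"
  define m where "m = max (U 0) (V 0)"
  have zero: "measure lebesgue {r. \<bar>X r\<bar> > t} = 0" if "profile X" "X 0 \<le> t" for X t
  proof -
    have "{r. \<bar>X r\<bar> > t} = {}"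
      using that profileD(2)[OF that(1), of 0] profileD(3)[OF that(1)] by (smt (verit) Collect_empty_eq)
    then show ?thesis by simp
  qed
  have "c t = 0" if "m \<le> t" for t using zero[OF U] zero[OF V] that by (auto simp: c_def m_def)
  then have J_sub: "J \<subseteq> {0<..<m}" by (force simp: J_def not_le[symmetric])
  \<comment> \<open>Added half lengths decrease with the level, so \<open>J\<close> is closed downwards.\<close>
  have down: "t \<in> J" if "t' \<in> J" "0 < t" "t \<le> t'" for t t'
    using that cmono[of t t'] by (auto simp: J_def)
  have "is_interval J" unfolding is_interval_1 using down by (metis J_def mem_Collect_eq order_less_le_trans)
  then have Jb: "J \<in> sets borel" by (rule real_interval_borel_measurable)
  have Jm: "J \<in> lmeasurable"
    using bounded_subset[OF _ J_sub] Jb by (intro bounded_set_imp_lmeasurable) auto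
  have "star_profile U V s = (LINT t|lebesgue. indicat_real J t)"
    unfolding star_profile_def set_lebesgue_integral_def
    by (rule Bochner_Integration.integral_cong)
       (auto simp: J_def indicator_def star_set_def c_def[symmetric] abs_less_iff)
  also have "\<dots> = measure lebesgue J" using Jb Jm by simp
  finally have eq: "star_profile U V s = measure lebesgue J" .
  show "t \<le> star_profile U V s" if ?a
  proof -
    have tJ: "t \<in> J" using that t by (simp add: J_def c_def)
    have "{0<..t} \<subseteq> J"
    proof
      fix r assume "r \<in> {0<..t}"
      then show "r \<in> J" using down[OF tJ, of r] by simp
    qed
    then have "measure lebesgue {0<..t} \<le> measure lebesgue J"
      using Jm by (intro measure_mono_fmeasurable) auto
    then show ?thesis using t eq by simp
  qed
  show "star_profile U V s \<le> t" if ?b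
  proof -
    have "J \<subseteq> {0<..<t}"
    proof
      fix r assume r: "r \<in> J"
      have "t \<notin> J" using that by (simp add: J_def c_def)
      then have "\<not> t \<le> r" using down[OF r t] by blast
      moreover have "0 < r" using r by (simp add: J_def)
      ultimately show "r \<in> {0<..<t}" by simp
    qed
    then have "measure lebesgue J \<le> measure lebesgue {0<..<t}"
      using Jb by (intro measure_mono_fmeasurable) auto
    then show ?thesis using t eq by simp
  qed
qed

text \<open>
  Below both values, the level sets reach beyond \<open>a\<close> and \<open>b\<close>, so their added half lengths exceed \<open>|s|\<close>.
\<close>

lemma star_profile_lower:
  assumes U: "profile U" and V: "profile V" and s: "\<bar>s\<bar> \<le> \<bar>a\<bar> + \<bar>b\<bar>"
  shows "min (U a) (V b) \<le> star_profile U V s"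
proof (rule dense_le_bounded[of 0])
  show "0 < min (U a) (V b)" using profileD(3)[OF U] profileD(3)[OF V] by simp
  fix t assume t: "0 < t" "t < min (U a) (V b)"
  obtain A where A: "\<And>s. t < U s \<longleftrightarrow> \<bar>s\<bar> < A" "measure lebesgue {s. \<bar>U s\<bar> > t} = 2 * A"
    using superlevel_set_interval[OF U t(1)] by metis
  obtain B where B: "\<And>s. t < V s \<longleftrightarrow> \<bar>s\<bar> < B" "measure lebesgue {s. \<bar>V s\<bar> > t} = 2 * B"
    using superlevel_set_interval[OF V t(1)] by metis
  have "\<bar>a\<bar> < A" "\<bar>b\<bar> < B" using t A(1) B(1) by auto
  then show "t \<le> star_profile U V s"
    using s by (intro star_profile_ge_level[OF U V t(1)]) (simp add: A B)
qed

lemma star_profile_commute: "star_profile U V = star_profile V U"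
  by (simp add: star_profile_def star_set_def add.commute fun_eq_iff)

lemma star_profile_ge_left:
  assumes U: "profile U" and V: "profile V"
  shows "U s \<le> star_profile U V s"
proof (rule dense_le_bounded[of 0])
  show "0 < U s" using profileD(3)[OF U] .
  fix t assume t: "0 < t" "t < U s"
  obtain A where A: "\<And>s. t < U s \<longleftrightarrow> \<bar>s\<bar> < A" "measure lebesgue {s. \<bar>U s\<bar> > t} = 2 * A"
    using superlevel_set_interval[OF U t(1)] by metis
  obtain B where B: "0 \<le> B" "measure lebesgue {s. \<bar>V s\<bar> > t} = 2 * B"
    using superlevel_set_interval[OF V t(1)] by metis
  have "\<bar>s\<bar> < A" using t A(1) by auto
  then show "t \<le> star_profile U V s"
    using B(1) by (intro star_profile_ge_level[OF U V t(1)]) (simp only: A B(2), simp)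
qed

lemma star_profile_ge_right:
  assumes "profile U" "profile V"
  shows "V s \<le> star_profile U V s"
  using star_profile_ge_left[OF assms(2,1)] star_profile_commute by metis

text \<open>
  At the level \<open>max (U a) (V b)\<close>, the superlevel sets end before \<open>a\<close> and \<open>b\<close>.
\<close>

lemma star_profile_upper:
  assumes U: "profile U" and V: "profile V" and s: "\<bar>a\<bar> + \<bar>b\<bar> \<le> \<bar>s\<bar>"
  shows "star_profile U V s \<le> max (U a) (V b)"
proof -
  define t where "t = max (U a) (V b)"
  have t: "0 < t" using profileD(3)[OF U, of a] by (simp add: t_def less_max_iff_disj)
  obtain A where A: "\<And>s. t < U s \<longleftrightarrow> \<bar>s\<bar> < A" "measure lebesgue {s. \<bar>U s\<bar> > t} = 2 * A"
    using superlevel_set_interval[OF U t(1)] by metis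
  obtain B where B: "\<And>s. t < V s \<longleftrightarrow> \<bar>s\<bar> < B" "measure lebesgue {s. \<bar>V s\<bar> > t} = 2 * B"
    using superlevel_set_interval[OF V t(1)] by metis
  have "A \<le> \<bar>a\<bar>" "B \<le> \<bar>b\<bar>" using A(1)[of a] B(1)[of b] by (auto simp: t_def)
  then show ?thesis
    using s star_profile_le_level[OF U V t, of s] unfolding t_def[symmetric] by (simp add: A B)
qed

lemma star_profile_even: "star_profile U V (- s) = star_profile U V s"
proof -
  have "indicat_real (star_set A B) (- s) = indicat_real (star_set A B) s" for A B
    unfolding star_set_def indicator_def greaterThanLessThan_iff by (rule arg_cong[where f=of_bool]) linarith
  then show ?thesis by (simp add: star_profile_def)
qed

text \<open>
  The part of \<open>s\<close> that is assigned to the first profile. Taking the largest \<open>a\<close> at which \<open>U\<close> has not yet dropped below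
  \<open>V\<close> at the remaining distance singles out one splitting, also where both profiles are flat at the same
  height and many would do; the inserted \<open>0\<close> is the value when \<open>V\<close> at \<open>s\<close> lies above all of \<open>U\<close>.
\<close>

definition split_point :: "(real \<Rightarrow> real) \<Rightarrow> (real \<Rightarrow> real) \<Rightarrow> real \<Rightarrow> real" where
  "split_point U V s = Sup (insert 0 {a. 0 \<le> a \<and> a \<le> s \<and> V (s - a) \<le> U a})"

lemma split_point_bounds:
  assumes "0 \<le> s"
  shows "0 \<le> split_point U V s" "split_point U V s \<le> s"
proof -
  let ?S = "insert 0 {a. 0 \<le> a \<and> a \<le> s \<and> V (s - a) \<le> U a}"
  have b: "bdd_above ?S" using assms by (intro bdd_aboveI[of _ s]) auto
  show "0 \<le> split_point U V s" unfolding split_point_def by (rule cSup_upper[OF _ b]) simp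
  show "split_point U V s \<le> s" unfolding split_point_def by (rule cSup_least) (use assms in auto)
qed

lemma split_point_upper:
  assumes "0 \<le> a" "a \<le> s" "V (s - a) \<le> U a"
  shows "a \<le> split_point U V s"
  unfolding split_point_def
  by (rule cSup_upper) (use assms in \<open>auto intro!: bdd_aboveI[of _ s]\<close>)

text \<open>
  Both parts grow with \<open>s\<close>: a part that is eligible for \<open>s\<close> stays so for larger \<open>s\<close>, and one that is
  eligible for \<open>s'\<close> is so for \<open>s\<close> after subtracting \<open>s' - s\<close>. Hence each part is Lipschitz with
  constant \<open>1\<close>.
\<close>

lemma split_point_mono:
  assumes U: "profile U" and V: "profile V" and s: "0 \<le> s" "s \<le> s'"
  shows "split_point U V s \<le> split_point U V s'"
    "s - split_point U V s \<le> s' - split_point U V s'"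
proof -
  show "split_point U V s \<le> split_point U V s'"
    unfolding split_point_def[of U V s]
  proof (rule cSup_least)
    fix a assume "a \<in> insert 0 {a. 0 \<le> a \<and> a \<le> s \<and> V (s - a) \<le> U a}"
    then consider "a = 0" | "0 \<le> a" "a \<le> s" "V (s - a) \<le> U a" by auto
    then show "a \<le> split_point U V s'"
    proof cases
      case 1 then show ?thesis using split_point_bounds[of s'] s by simp
    next
      case 2
      then have "V (s' - a) \<le> U a" using profileD(2)[OF V, of "s - a" "s' - a"] s by auto
      then show ?thesis using 2 s by (intro split_point_upper) auto
    qed
  qed simp
  have "split_point U V s' \<le> split_point U V s + (s' - s)"
    unfolding split_point_def[of U V s']
  proof (rule cSup_least)
    fix a assume "a \<in> insert 0 {a. 0 \<le> a \<and> a \<le> s' \<and> V (s' - a) \<le> U a}"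
    then consider "a \<le> s' - s" | "s' - s \<le> a" "a \<le> s'" "V (s' - a) \<le> U a" using s by fastforce
    then show "a \<le> split_point U V s + (s' - s)"
    proof cases
      case 1 then show ?thesis using split_point_bounds[of s U V] s by linarith
    next
      case 2
      have "V (s - (a - (s' - s))) \<le> U (a - (s' - s))"
        using 2 profileD(2)[OF U, of "a - (s' - s)" a] s by auto
      then have "a - (s' - s) \<le> split_point U V s" using 2 by (intro split_point_upper) auto
      then show ?thesis by simp
    qed
  qed simp
  then show "s - split_point U V s \<le> s' - split_point U V s'" by simp
qed

lemma split_point_continuous:
  assumes U: "profile U" and V: "profile V"
  shows "continuous_on {0..} (split_point U V)"
proof -
  have "\<bar>split_point U V s - split_point U V s'\<bar> \<le> \<bar>s - s'\<bar>" if "0 \<le> s" "0 \<le> s'" for s s'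
    using split_point_mono[OF U V, of s s'] split_point_mono[OF U V, of s' s] that by (cases "s \<le> s'") auto
  then have "1-lipschitz_on {0..} (split_point U V)"
    by (intro lipschitz_onI) (auto simp: dist_real_def)
  then show ?thesis by (rule lipschitz_on_continuous_on)
qed

text \<open>
  The difference \<open>U a - V (s - a)\<close> decreases in \<open>a\<close>. It is nonpositive beyond the split point and
  nonnegative at it, and so vanishes there by continuity, unless it keeps one sign on all of \<open>[0, s]\<close>.
\<close>

lemma split_point_cases:
  assumes U: "profile U" and V: "profile V" and s: "0 \<le> s"
  obtains (left) "V 0 < U s" "split_point U V s = s"
  | (right) "U 0 < V s" "split_point U V s = 0"
  | (balanced) "U s \<le> V 0" "V s \<le> U 0" "U (split_point U V s) = V (s - split_point U V s)"
proof -
  let ?S = "{a. 0 \<le> a \<and> a \<le> s \<and> V (s - a) \<le> U a}"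
  let ?p = "split_point U V s"
  have bd: "bdd_above ?S" by (intro bdd_aboveI[of _ s]) auto
  have cl: "closed ?S"
  proof -
    have "?S = {0..s} \<inter> {a. V (s - a) \<le> U a}" by auto
    moreover have "closed {a. V (s - a) \<le> U a}"
      by (intro closed_Collect_le continuous_on_compose2[OF profileD(1)[OF V, of UNIV]] profileD(1)[OF U])
        (auto intro!: continuous_intros)
    ultimately show ?thesis by auto
  qed
  show ?thesis
  proof (cases "U 0 < V s")
    case True
    have "a = 0" if "a \<in> ?S" for a
      using that True profileD(2)[OF U, of 0 a] profileD(2)[OF V, of "s - a" s] by auto
    then have "insert 0 ?S = {0}" by auto
    then have "?p = 0" unfolding split_point_def by (simp only: cSup_singleton)
    then show ?thesis using True right by simp
  next
    case F: False
    then have ne: "0 \<in> ?S" using s by auto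
    then have eq: "?p = Sup ?S" unfolding split_point_def by (simp add: insert_absorb)
    have "?p \<in> ?S" unfolding eq by (rule closed_contains_Sup) (use ne bd cl in auto)
    then have p: "0 \<le> ?p" "?p \<le> s" "V (s - ?p) \<le> U ?p" by auto
    show ?thesis
    proof (cases "V 0 < U s")
      case True
      then have "s \<le> ?p" using s by (intro split_point_upper) auto
      then show ?thesis using True p left by auto
    next
      case False
      have "U ?p \<le> V (s - ?p)"
      proof (cases "?p = s")
        case True then show ?thesis using False by simp
      next
        case F2: False
        then have lt: "?p < s" using p by simp
        have ev: "eventually (\<lambda>a. U a \<le> V (s - a)) (at_right ?p)"
          unfolding eventually_at_right[OF lt]
        proof (intro exI[of _ s] conjI allI impI lt)
          fix a assume "?p < a" "a < s"
          then show "U a \<le> V (s - a)" using split_point_upper[of a s V U] p by linarith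
        qed
        have c: "isCont U x" "isCont V x" for x using profileD(1)[OF U, of UNIV] profileD(1)[OF V, of UNIV]
          by (auto simp: continuous_on_eq_continuous_at)
        have "(U \<longlongrightarrow> U ?p) (at_right ?p)"
          using c(1)[of ?p] unfolding isCont_def by (rule tendsto_within_subset) simp
        moreover have "isCont (\<lambda>a. V (s - a)) ?p"
          by (rule isCont_o2[where f="\<lambda>a. s - a" and g=V]) (auto intro: c continuous_intros)
        then have "((\<lambda>a. V (s - a)) \<longlongrightarrow> V (s - ?p)) (at_right ?p)"
          unfolding isCont_def by (rule tendsto_within_subset) simp
        ultimately show ?thesis by (intro tendsto_le[OF _ _ _ ev]) auto
      qed
      then show ?thesis using balanced p F False by auto
    qed
  qed
qed

lemma star_profile_split:
  assumes U: "profile U" and V: "profile V" and s: "0 \<le> s"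
  shows "star_profile U V s = max (U (split_point U V s)) (V (s - split_point U V s))"
    (is "_ = max (U ?p) (V (s - ?p))")
proof (rule antisym)
  show "star_profile U V s \<le> max (U ?p) (V (s - ?p))"
    using split_point_bounds[OF s] by (intro star_profile_upper[OF U V]) auto
  show "max (U ?p) (V (s - ?p)) \<le> star_profile U V s"
  proof (cases rule: split_point_cases[OF U V s, case_names left right balanced])
    case left
    then show ?thesis using star_profile_ge_left[OF U V, of s] by auto
  next
    case right
    then show ?thesis using star_profile_ge_right[OF U V, of s] by auto
  next
    case balanced
    then show ?thesis using star_profile_lower[OF U V, of s ?p "s - ?p"] by auto
  qed
qed

section \<open>Substitution along increasing functions\<close>

lemma borel_measure_eqI_Ioc:
  fixes M N :: "real measure"
  assumes "sets M = sets borel" "sets N = sets borel"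
    and "\<And>a b. a \<le> b \<Longrightarrow> emeasure M {a<..b} = emeasure N {a<..b}"
    and "\<And>a b. a \<le> b \<Longrightarrow> emeasure M {a<..b} < \<infinity>"
  shows "M = N"
proof (rule measure_eqI_generator_eq[where E="range (\<lambda>(a, b). {a<..b::real})" and \<Omega>=UNIV
        and A="\<lambda>n. {- real n<..real n}"])
  show "Int_stable (range (\<lambda>(a, b). {a<..b::real}))"
    by (auto simp: Int_stable_def Int_greaterThanAtMost)
  show "emeasure M X = emeasure N X" if X: "X \<in> range (\<lambda>(a, b). {a<..b})" for X
  proof -
    obtain a b where "X = {a<..b}" using X by auto
    then show ?thesis using assms(3)[of a b] by (cases "a \<le> b") auto
  qed
  show "(\<Union>n. {- real n<..real n}) = UNIV"
  proof (intro equalityI subsetI UNIV_I)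
    fix x :: real
    obtain n where "\<bar>x\<bar> < real n" using reals_Archimedean2 by blast
    then show "x \<in> (\<Union>n. {- real n<..real n})" by (intro UN_I[of n]) auto
  qed
  show "emeasure M {- real n<..real n} \<noteq> \<infinity>" for n
    using assms(4)[of "- real n" "real n"] by simp
  show "range (\<lambda>n. {- real n<..real n}) \<subseteq> range (\<lambda>(a, b). {a<..b})" by auto
qed (auto simp: assms borel_sigma_sets_Ioc sets_measure_of)

text \<open>
  Applied to the two parts of a splitting, this decomposes Lebesgue measure into two Stieltjes measures,
  without any differentiability of the parts.
\<close>

lemma nn_integral_interval_measure_add:
  fixes F G :: "real \<Rightarrow> real" and f :: "real \<Rightarrow> ennreal"
  assumes F: "mono F" "continuous_on UNIV F" and G: "mono G" "continuous_on UNIV G"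
    and f: "f \<in> borel_measurable borel"
  shows "(\<integral>\<^sup>+s. f s \<partial>interval_measure (\<lambda>s. F s + G s)) =
    (\<integral>\<^sup>+s. f s \<partial>interval_measure F) + (\<integral>\<^sup>+s. f s \<partial>interval_measure G)"
proof -
  let ?F = "interval_measure F" and ?G = "interval_measure G"
  define M where "M = measure_of UNIV (sets borel) (\<lambda>X. emeasure ?F X + emeasure ?G X)"
  have sets_M [simp, measurable_cong]: "sets M = sets borel"
    unfolding M_def using sets.sets_measure_of_eq[of "borel :: real measure"] by simp
  have em: "emeasure M X = emeasure ?F X + emeasure ?G X" if "X \<in> sets borel" for X
  proof (rule emeasure_measure_of[OF M_def])
    show "countably_additive (sets M) (\<lambda>X. emeasure ?F X + emeasure ?G X)"
      by (auto simp: countably_additive_def suminf_add[symmetric] suminf_emeasure)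
  qed (use that in \<open>auto simp: positive_def\<close>)
  have rc: "continuous (at_right a) H" if "continuous_on UNIV H" for H :: "real \<Rightarrow> real" and a
    using that continuous_on_eq_continuous_at[of UNIV H] continuous_at_imp_continuous_within by auto
  have "M = interval_measure (\<lambda>s. F s + G s)"
  proof (rule borel_measure_eqI_Ioc)
    fix a b :: real assume ab: "a \<le> b"
    have le: "F a \<le> F b" "G a \<le> G b" using F(1) G(1) ab by (auto dest: monoD)
    have "emeasure M {a<..b} = ennreal (F b - F a) + ennreal (G b - G a)"
      using F G ab by (simp add: em emeasure_interval_measure_Ioc monoD rc)
    also have "\<dots> = ennreal ((F b + G b) - (F a + G a))"
      using le by (simp add: ennreal_plus[symmetric] del: ennreal_plus)
    finally have *: "emeasure M {a<..b} = ennreal ((F b + G b) - (F a + G a))" .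
    also have "\<dots> = emeasure (interval_measure (\<lambda>s. F s + G s)) {a<..b}"
      using F G ab by (subst emeasure_interval_measure_Ioc)
        (auto intro!: add_mono rc continuous_intros dest: monoD)
    finally show "emeasure M {a<..b} = emeasure (interval_measure (\<lambda>s. F s + G s)) {a<..b}" .
    show "emeasure M {a<..b} < \<infinity>" unfolding * by simp
  qed simp_all
  moreover have "(\<integral>\<^sup>+s. f s \<partial>M) = (\<integral>\<^sup>+s. f s \<partial>?F) + (\<integral>\<^sup>+s. f s \<partial>?G)"
    using f
  proof induction
    case (cong f g)
    then show ?case by (simp add: fun_eq_iff cong: nn_integral_cong)
  next
    case (set A)
    then show ?case by (simp add: em)
  next
    case (mult u c)
    then show ?case by (simp add: nn_integral_cmult distrib_left)
  next
    case (add u v)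
    then show ?case by (simp add: nn_integral_add ac_simps)
  next
    case (seq U)
    then have "(\<integral>\<^sup>+s. (SUP i. U i) s \<partial>N) = (SUP i. \<integral>\<^sup>+s. U i s \<partial>N)"
      if "sets N = sets borel" for N :: "real measure"
      unfolding SUP_apply using that
      by (intro nn_integral_monotone_convergence_SUP) (auto cong: measurable_cong_sets)
    moreover have "incseq (\<lambda>i. \<integral>\<^sup>+s. U i s \<partial>N)" for N
      using seq by (auto simp: incseq_def le_fun_def intro!: nn_integral_mono)
    ultimately show ?case using seq by (simp add: ennreal_SUP_add)
  qed
  ultimately show ?thesis by simp
qed

text \<open>
  An increasing continuous surjection pushes its own Stieltjes measure forward to Lebesgue measure: the
  preimage of an interval \<open>(a, b]\<close> is an interval \<open>(p, q]\<close> with \<open>F p = a\<close> and \<open>F q = b\<close>, and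
  flat stretches of \<open>F\<close> carry no mass.
\<close>

lemma nn_integral_interval_measure_comp:
  fixes F :: "real \<Rightarrow> real" and g :: "real \<Rightarrow> ennreal"
  assumes F: "mono F" "continuous_on UNIV F" "surj F" and g [measurable]: "g \<in> borel_measurable borel"
  shows "(\<integral>\<^sup>+s. g (F s) \<partial>interval_measure F) = (\<integral>\<^sup>+s. g s \<partial>lborel)"
proof -
  have last: "\<exists>p. F p = l \<and> (\<forall>s. F s \<le> l \<longleftrightarrow> s \<le> p)" for l
  proof -
    let ?S = "{s. F s \<le> l}"
    obtain s0 where s0: "F s0 = l" using F(3) by (metis surjD)
    obtain b where b: "F b = l + 1" using F(3) by (metis surjD)
    have bdd: "bdd_above ?S"
    proof (rule bdd_aboveI[of _ b])
      fix x assume "x \<in> ?S"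
      then have "\<not> F b \<le> F x" using b by simp
      then show "x \<le> b" using F(1) by (meson linear monoD)
    qed
    have "closed ?S" using F(2) by (intro closed_Collect_le) auto
    then have p: "F (Sup ?S) \<le> l" using closed_contains_Sup[of ?S] bdd s0 by auto
    have "s0 \<le> Sup ?S" using bdd s0 by (intro cSup_upper) auto
    then have "F (Sup ?S) = l" using p s0 F(1) by (auto dest!: monoD[of F s0])
    moreover have "F s \<le> l \<longleftrightarrow> s \<le> Sup ?S" for s
      using cSup_upper[of s ?S] bdd p monoD[OF F(1), of s "Sup ?S"] by force
    ultimately show ?thesis by blast
  qed
  have [measurable]: "F \<in> borel_measurable borel"
    using F(2) by (rule borel_measurable_continuous_onI)
  have rc: "continuous (at_right a) F" for a
    using F(2) continuous_on_eq_continuous_at[of UNIV F] continuous_at_imp_continuous_within by auto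
  have "distr (interval_measure F) borel F = lborel"
  proof (rule borel_measure_eqI_Ioc)
    fix a b :: real assume ab: "a \<le> b"
    obtain p where p: "F p = a" "\<And>s. F s \<le> a \<longleftrightarrow> s \<le> p" using last[of a] by blast
    obtain q where q: "F q = b" "\<And>s. F s \<le> b \<longleftrightarrow> s \<le> q" using last[of b] by blast
    have "p \<le> q" using q(2)[of p] p(1) ab by simp
    have "F -` {a<..b} = {p<..q}" by (auto simp: p(2) q(2) not_le[symmetric])
    then show *: "emeasure (distr (interval_measure F) borel F) {a<..b} = emeasure lborel {a<..b}"
      using \<open>p \<le> q\<close> ab p(1) q(1)
      by (simp add: emeasure_distr emeasure_interval_measure_Ioc[OF _ monoD[OF F(1)] rc])
    show "emeasure (distr (interval_measure F) borel F) {a<..b} < \<infinity>"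
      unfolding * using ab by simp
  qed simp_all
  moreover have "(\<integral>\<^sup>+s. g s \<partial>distr (interval_measure F) borel F) = (\<integral>\<^sup>+s. g (F s) \<partial>interval_measure F)"
    by (intro nn_integral_distr) simp_all
  ultimately show ?thesis by simp
qed

lemma interval_measure_density_Ioc:
  fixes F lam :: "real \<Rightarrow> real" and f :: "real \<Rightarrow> ennreal"
  assumes F: "mono F" "continuous_on UNIV F"
    and der: "\<And>s. s \<in> {a..b} \<Longrightarrow> (F has_real_derivative lam s) (at s)"
    and lam: "continuous_on {a..b} lam" "\<And>s. s \<in> {a..b} \<Longrightarrow> 0 \<le> lam s"
    and f [measurable]: "f \<in> borel_measurable borel"
  shows "(\<integral>\<^sup>+s. indicator {a<..b} s * f s \<partial>interval_measure F) =
    (\<integral>\<^sup>+s. indicator {a<..b} s * (ennreal (lam s) * f s) \<partial>lborel)"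
proof -
  define L where "L s = (if s \<in> {a..b} then lam s else 0)" for s
  have [measurable]: "L \<in> borel_measurable borel"
    unfolding L_def using lam(1) by (intro borel_measurable_continuous_on_if) auto
  have rc: "continuous (at_right a) F" for a
    using F(2) continuous_on_eq_continuous_at[of UNIV F] continuous_at_imp_continuous_within by auto
  have eq: "density (interval_measure F) (indicator {a<..b}) =
      density lborel (\<lambda>s. indicator {a<..b} s * ennreal (L s))" (is "?M = ?N")
  proof (rule borel_measure_eqI_Ioc)
    fix c d :: real assume "c \<le> d"
    let ?l = "max c a" and ?r = "min d b"
    have int: "{c<..d} \<inter> {a<..b} = {?l<..?r}" by auto
    have "emeasure ?M {c<..d} = emeasure (interval_measure F) {?l<..?r}"
      by (simp add: emeasure_density int[symmetric] indicator_inter_arith[symmetric] Int_commute)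
    also have "\<dots> = (if ?l \<le> ?r then ennreal (F ?r - F ?l) else 0)"
      by (simp add: emeasure_interval_measure_Ioc_eq[OF monoD[OF F(1)] rc])
    finally have M: "emeasure ?M {c<..d} = (if ?l \<le> ?r then ennreal (F ?r - F ?l) else 0)" .
    have "emeasure ?N {c<..d} = (\<integral>\<^sup>+s. ennreal (L s) * indicator {?l<..?r} s \<partial>lborel)"
      by (subst emeasure_density) (auto intro!: nn_integral_cong simp: indicator_def)
    also have "\<dots> = (\<integral>\<^sup>+s. ennreal (L s) * indicator {?l..?r} s \<partial>lborel)"
      using AE_lborel_singleton[of ?l] by (intro nn_integral_cong_AE) (auto simp: indicator_def)
    also have "\<dots> = (if ?l \<le> ?r then ennreal (F ?r - F ?l) else 0)"
    proof (cases "?l \<le> ?r")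
      case True
      then have "(\<integral>\<^sup>+s. ennreal (L s) * indicator {?l..?r} s \<partial>lborel) = F ?r - F ?l"
      proof (intro nn_integral_FTC_Icc)
        show "L \<in> borel_measurable borel" by measurable
        show "DERIV F s :> L s" "0 \<le> L s" if "s \<in> {?l..?r}" for s
          using that der lam(2) by (auto simp: L_def)
      qed (use True in auto)
      then show ?thesis using True by simp
    next
      case False
      then have empty: "{?l..?r} = {}" by (intro atLeastatMost_empty) linarith
      show ?thesis unfolding empty by (simp only: False if_False) simp
    qed
    finally show "emeasure ?M {c<..d} = emeasure ?N {c<..d}" using M by simp
    show "emeasure ?M {c<..d} < \<infinity>" using M by simp
  qed simp_all
  have "(\<integral>\<^sup>+s. indicator {a<..b} s * f s \<partial>interval_measure F) = (\<integral>\<^sup>+s. f s \<partial>?M)"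
    by (simp add: nn_integral_density)
  also have "\<dots> = (\<integral>\<^sup>+s. f s \<partial>?N)" by (simp only: eq)
  also have "\<dots> = (\<integral>\<^sup>+s. indicator {a<..b} s * (ennreal (lam s) * f s) \<partial>lborel)"
  proof -
    have "(\<integral>\<^sup>+s. f s \<partial>?N) = (\<integral>\<^sup>+s. indicator {a<..b} s * ennreal (L s) * f s \<partial>lborel)"
      by (intro nn_integral_density) measurable
    also have "\<dots> = (\<integral>\<^sup>+s. indicator {a<..b} s * (ennreal (lam s) * f s) \<partial>lborel)"
      by (intro nn_integral_cong) (auto simp: L_def indicator_def)
    finally show ?thesis .
  qed
  finally show ?thesis .
qed

lemma nn_integral_indicator_UN_disjoint:
  fixes f :: "'a \<Rightarrow> ennreal" and B :: "nat \<Rightarrow> 'a set"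
  assumes [measurable]: "f \<in> borel_measurable M" "\<And>n. B n \<in> sets M" and B: "disjoint_family B"
  shows "(\<integral>\<^sup>+s. indicator (\<Union>n. B n) s * f s \<partial>M) = (\<Sum>n. \<integral>\<^sup>+s. indicator (B n) s * f s \<partial>M)"
proof -
  have "(\<integral>\<^sup>+s. indicator (\<Union>n. B n) s * f s \<partial>M) = (\<integral>\<^sup>+s. (\<Sum>n. indicator (B n) s * f s) \<partial>M)"
    by (simp only: suminf_indicator[OF B, symmetric] ennreal_suminf_multc)
  also have "\<dots> = (\<Sum>n. \<integral>\<^sup>+s. indicator (B n) s * f s \<partial>M)"
    by (intro nn_integral_suminf) measurable
  finally show ?thesis .
qed

text \<open>
  On compact intervals inside \<open>E\<close> this is the fundamental theorem of calculus; \<open>E\<close> is exhausted by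
  countably many such intervals with rational end points.
\<close>

lemma interval_measure_density_open:
  fixes F lam :: "real \<Rightarrow> real" and f :: "real \<Rightarrow> ennreal"
  assumes F: "mono F" "continuous_on UNIV F" and E: "open E"
    and der: "\<And>s. s \<in> E \<Longrightarrow> (F has_real_derivative lam s) (at s)"
    and lam: "continuous_on E lam" "\<And>s. s \<in> E \<Longrightarrow> 0 \<le> lam s"
    and f: "f \<in> borel_measurable borel"
  shows "(\<integral>\<^sup>+s. indicator E s * f s \<partial>interval_measure F) =
    (\<integral>\<^sup>+s. indicator E s * (ennreal (lam s) * f s) \<partial>lborel)"
proof -
  define I where "I = {(a, b). a \<in> \<rat> \<and> b \<in> \<rat> \<and> {a..b} \<subseteq> E}"
  have "countable I"
    by (rule countable_subset[of _ "\<rat> \<times> \<rat>"]) (auto simp: I_def countable_rat)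
  have cover: "\<exists>i\<in>I. s \<in> {fst i<..snd i}" if s: "s \<in> E" for s
  proof -
    obtain e where e: "e > 0" "ball s e \<subseteq> E" using E s openE by blast
    obtain a where a: "a \<in> \<rat>" "s - e < a" "a < s" using Rats_dense_in_real[of "s - e" s] e by auto
    obtain b where b: "b \<in> \<rat>" "s < b" "b < s + e" using Rats_dense_in_real[of s "s + e"] e by auto
    have "{a..b} \<subseteq> ball s e" using a b by (auto simp: dist_real_def)
    then show ?thesis using a b e by (intro bexI[of _ "(a, b)"]) (auto simp: I_def)
  qed
  \<comment> \<open>The empty default covers the case that \<open>E\<close> is empty.\<close>
  define J where "J n = (if I = {} then {} else {fst (from_nat_into I n)<..snd (from_nat_into I n)})" for n
  define B where "B = disjointed J"
  have JE: "(\<Union>n. J n) = E"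
  proof (intro equalityI subsetI)
    fix s assume "s \<in> E"
    then obtain i where i: "i \<in> I" "s \<in> {fst i<..snd i}" using cover by blast
    then obtain n where "from_nat_into I n = i" using from_nat_into_surj[OF \<open>countable I\<close>] by blast
    then show "s \<in> (\<Union>n. J n)" using i by (intro UN_I[of n]) (auto simp: J_def)
  next
    fix s assume "s \<in> (\<Union>n. J n)"
    then obtain n where n: "s \<in> J n" by blast
    then have "I \<noteq> {}" by (auto simp: J_def)
    then have "from_nat_into I n \<in> I" by (rule from_nat_into)
    then show "s \<in> E" using n by (force simp: J_def I_def split: if_splits)
  qed
  have [measurable]: "J n \<in> sets borel" for n by (simp add: J_def)
  have Bm [measurable]: "B n \<in> sets borel" for n
    using sets.range_disjointed_sets[of J borel] \<open>\<And>n. J n \<in> sets borel\<close> unfolding B_def by blast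
  have BE: "(\<Union>n. B n) = E" using JE by (simp add: B_def UN_disjointed_eq)
  have Bd: "disjoint_family B" unfolding B_def by (rule disjoint_family_disjointed)
  have BJ: "B n \<subseteq> J n" for n unfolding B_def by (rule disjointed_subset)
  define L where "L s = indicator E s * lam s" for s
  have Lm [measurable]: "L \<in> borel_measurable borel"
    using borel_measurable_continuous_on_indicator[OF _ lam(1)] E unfolding L_def by auto
  have eq: "(\<integral>\<^sup>+s. indicator (B n) s * f s \<partial>interval_measure F) =
      (\<integral>\<^sup>+s. indicator (B n) s * (ennreal (L s) * f s) \<partial>lborel)" for n
  proof (cases "I = {}")
    case True
    then have "B n = {}" using BJ[of n] by (simp add: J_def)
    then show ?thesis by simp
  next
    case False
    obtain a b where ab: "from_nat_into I n = (a, b)" by fastforce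
    have "(a, b) \<in> I" using from_nat_into[OF False, of n] by (simp only: ab)
    then have sub: "{a..b} \<subseteq> E" by (simp add: I_def)
    have Jn: "J n = {a<..b}" using False by (simp add: J_def ab)
    have "(\<integral>\<^sup>+s. indicator (B n) s * f s \<partial>interval_measure F) =
        (\<integral>\<^sup>+s. indicator {a<..b} s * (indicator (B n) s * f s) \<partial>interval_measure F)"
      using BJ[of n] by (intro nn_integral_cong) (auto simp: Jn indicator_def)
    also have "\<dots> = (\<integral>\<^sup>+s. indicator {a<..b} s * (ennreal (lam s) * (indicator (B n) s * f s)) \<partial>lborel)"
      using sub lam der f by (intro interval_measure_density_Ioc F continuous_on_subset[OF lam(1)]) auto
    also have "\<dots> = (\<integral>\<^sup>+s. indicator (B n) s * (ennreal (L s) * f s) \<partial>lborel)"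
    proof (rule nn_integral_cong)
      fix s
      show "indicator {a<..b} s * (ennreal (lam s) * (indicator (B n) s * f s)) =
          indicator (B n) s * (ennreal (L s) * f s)"
      proof (cases "s \<in> B n")
        case True
        then have "s \<in> {a<..b}" using BJ[of n] by (auto simp: Jn)
        moreover from this have "s \<in> E" using sub by auto
        ultimately show ?thesis using True by (simp add: L_def)
      qed simp
    qed
    finally show ?thesis .
  qed
  have "(\<integral>\<^sup>+s. indicator E s * f s \<partial>interval_measure F) =
      (\<Sum>n. \<integral>\<^sup>+s. indicator (B n) s * f s \<partial>interval_measure F)"
    using f unfolding BE[symmetric] by (intro nn_integral_indicator_UN_disjoint Bd) auto
  also have "\<dots> = (\<Sum>n. \<integral>\<^sup>+s. indicator (B n) s * (ennreal (L s) * f s) \<partial>lborel)"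
    by (simp only: eq)
  also have "\<dots> = (\<integral>\<^sup>+s. indicator E s * (ennreal (L s) * f s) \<partial>lborel)"
    using f unfolding BE[symmetric] by (intro nn_integral_indicator_UN_disjoint[symmetric] Bd) auto
  also have "\<dots> = (\<integral>\<^sup>+s. indicator E s * (ennreal (lam s) * f s) \<partial>lborel)"
    by (intro nn_integral_cong) (auto simp: L_def indicator_def)
  finally show ?thesis .
qed

abbreviation half_integral :: "(real \<Rightarrow> ennreal) \<Rightarrow> ennreal" where
  "half_integral g \<equiv> \<integral>\<^sup>+s\<in>{0<..}. g s \<partial>lborel"

text \<open>
  On \<open>E\<close>, the measure with density \<open>lam\<close> is the Stieltjes measure of \<open>F\<close>, so the left-hand side is at
  most an integral of \<open>g \<circ> F\<close> against that measure, which substitution evaluates.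
\<close>

lemma half_line_substitution_bound:
  fixes F lam :: "real \<Rightarrow> real" and g gw :: "real \<Rightarrow> ennreal"
  assumes F: "mono F" "continuous_on UNIV F" "surj F" and nonneg: "\<And>s. 0 < s \<Longrightarrow> 0 \<le> F s"
    and E: "open E" "E \<subseteq> {0<..}" and lam: "continuous_on E lam" "\<And>s. s \<in> E \<Longrightarrow> 0 \<le> lam s"
    and der: "\<And>s. s \<in> E \<Longrightarrow> (F has_real_derivative lam s) (at s)"
    and g [measurable]: "g \<in> borel_measurable borel" and gw [measurable]: "gw \<in> borel_measurable borel"
    and off_E: "\<And>s. 0 < s \<Longrightarrow> s \<notin> E \<Longrightarrow> gw s \<le> g (F s)"
  shows "(\<integral>\<^sup>+s. indicator E s * (ennreal (lam s) * g (F s)) \<partial>lborel) +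
    (\<integral>\<^sup>+s. indicator ({0<..} - E) s * gw s \<partial>interval_measure F) \<le> half_integral g"
proof -
  have [measurable]: "F \<in> borel_measurable borel" "E \<in> sets borel"
    using F(2) E by (auto intro: borel_measurable_continuous_onI)
  have "(\<integral>\<^sup>+s. indicator E s * (ennreal (lam s) * g (F s)) \<partial>lborel) =
      (\<integral>\<^sup>+s. indicator E s * g (F s) \<partial>interval_measure F)"
    by (rule interval_measure_density_open[OF F(1,2) E(1) der lam, symmetric]) simp_all
  then have "(\<integral>\<^sup>+s. indicator E s * (ennreal (lam s) * g (F s)) \<partial>lborel) +
      (\<integral>\<^sup>+s. indicator ({0<..} - E) s * gw s \<partial>interval_measure F) =
      (\<integral>\<^sup>+s. indicator E s * g (F s) + indicator ({0<..} - E) s * gw s \<partial>interval_measure F)"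
    by (simp add: nn_integral_add)
  also have "\<dots> \<le> (\<integral>\<^sup>+s. indicator {0..} (F s) * g (F s) \<partial>interval_measure F)"
    using nonneg E(2) off_E by (intro nn_integral_mono) (auto simp: indicator_def)
  also have "\<dots> = (\<integral>\<^sup>+s. indicator {0..} s * g s \<partial>lborel)"
    by (rule nn_integral_interval_measure_comp[OF F, of "\<lambda>s. indicator {0..} s * g s"]) simp
  also have "\<dots> = half_integral g"
    using AE_lborel_singleton[of "0::real"] by (intro nn_integral_cong_AE) (auto simp: indicator_def)
  finally show ?thesis .
qed

text \<open>
  The integral of \<open>gw\<close> is distributed over \<open>F\<close> and \<open>G\<close>: on \<open>E\<close> according to the derivatives \<open>lam\<close> and
  \<open>1 - lam\<close>, and off \<open>E\<close>, where no derivative is at hand, according to the Stieltjes measures of \<open>F\<close>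
  and \<open>G\<close>. Off \<open>E\<close> it is enough that \<open>gw\<close> is bounded by both composed functions, since then every
  distribution gives an upper bound.
\<close>

lemma half_line_split_integral:
  fixes F G lam :: "real \<Rightarrow> real" and gu gv gw :: "real \<Rightarrow> ennreal"
  assumes F: "mono F" "continuous_on UNIV F" "surj F" and G: "mono G" "continuous_on UNIV G" "surj G"
    and FG: "\<And>s. 0 < s \<Longrightarrow> F s + G s = s" "\<And>s. 0 < s \<Longrightarrow> 0 \<le> F s" "\<And>s. 0 < s \<Longrightarrow> 0 \<le> G s"
    and E: "open E" "E \<subseteq> {0<..}" and lam: "continuous_on E lam"
    and lam01: "\<And>s. s \<in> E \<Longrightarrow> 0 \<le> lam s" "\<And>s. s \<in> E \<Longrightarrow> lam s \<le> 1"
    and der: "\<And>s. s \<in> E \<Longrightarrow> (F has_real_derivative lam s) (at s)"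
    and gu: "gu \<in> borel_measurable borel" and gv: "gv \<in> borel_measurable borel"
    and gw: "gw \<in> borel_measurable borel"
    and on_E: "\<And>s. s \<in> E \<Longrightarrow> gw s \<le> ennreal (lam s) * gu (F s) + ennreal (1 - lam s) * gv (G s)"
    and off_E: "\<And>s. 0 < s \<Longrightarrow> s \<notin> E \<Longrightarrow> gw s \<le> gu (F s)"
       "\<And>s. 0 < s \<Longrightarrow> s \<notin> E \<Longrightarrow> gw s \<le> gv (G s)"
    and S: "open S" "S \<noteq> {}" "S \<subseteq> E"
    and strict: "\<And>s. s \<in> S \<Longrightarrow> gw s < ennreal (lam s) * gu (F s) + ennreal (1 - lam s) * gv (G s)"
    and fin: "half_integral gu < \<infinity>" "half_integral gv < \<infinity>"
  shows "half_integral gw <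
      half_integral gu + half_integral gv"
proof -
  note [measurable] = gu gv gw
  have [measurable]: "F \<in> borel_measurable borel" "G \<in> borel_measurable borel"
    using F(2) G(2) by (auto intro: borel_measurable_continuous_onI)
  have [measurable]: "E \<in> sets borel" "S \<in> sets borel" using E S by auto
  define L where "L s = indicator E s * lam s" for s
  have [measurable]: "L \<in> borel_measurable borel"
    using borel_measurable_continuous_on_indicator[OF _ lam] E unfolding L_def by auto
  define D where "D = {0<..} - E"
  have [measurable]: "D \<in> sets borel" by (simp add: D_def)
  define hu where "hu s = indicator E s * (ennreal (L s) * gu (F s))" for s
  define hv where "hv s = indicator E s * (ennreal (1 - L s) * gv (G s))" for s
  define hd where "hd s = indicator D s * gw s" for s
  have [measurable]: "hu \<in> borel_measurable borel" "hv \<in> borel_measurable borel" "hd \<in> borel_measurable borel"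
    unfolding hu_def hv_def hd_def by measurable
  have LE: "L s = lam s" if "s \<in> E" for s using that by (simp add: L_def)
  have der_G: "(G has_real_derivative 1 - lam s) (at s)" if s: "s \<in> E" for s
  proof (rule has_field_derivative_transform_within_open[where f="\<lambda>s. s - F s" and S=E])
    show "((\<lambda>s. s - F s) has_real_derivative 1 - lam s) (at s)"
      using der[OF s] by (auto intro!: derivative_eq_intros)
    show "r - F r = G r" if "r \<in> E" for r using FG(1)[of r] E(2) that by force
  qed (use s E in auto)
  have part_D: "(\<integral>\<^sup>+s. hd s \<partial>lborel) =
      (\<integral>\<^sup>+s. hd s \<partial>interval_measure F) + (\<integral>\<^sup>+s. hd s \<partial>interval_measure G)"
  proof -
    have "(\<integral>\<^sup>+s. hd s \<partial>lborel) = (\<integral>\<^sup>+s. indicator {0<..} s * (ennreal 1 * hd s) \<partial>lborel)"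
      by (intro nn_integral_cong) (auto simp: hd_def D_def indicator_def)
    also have "\<dots> = (\<integral>\<^sup>+s. indicator {0<..} s * hd s \<partial>interval_measure (\<lambda>s. F s + G s))"
    proof (rule interval_measure_density_open[symmetric])
      show "mono (\<lambda>s. F s + G s)" using F(1) G(1) by (auto simp: mono_def add_mono)
      show "((\<lambda>s. F s + G s) has_real_derivative 1) (at s)" if "s \<in> {0<..}" for s
        by (rule has_field_derivative_transform_within_open[where f="\<lambda>s. s" and S="{0<..}"])
          (use that FG(1) in \<open>auto intro!: derivative_eq_intros\<close>)
    qed (use F G in \<open>auto intro!: continuous_intros\<close>)
    also have "\<dots> = (\<integral>\<^sup>+s. hd s \<partial>interval_measure (\<lambda>s. F s + G s))"
      by (intro nn_integral_cong) (auto simp: hd_def D_def indicator_def)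
    finally show ?thesis using F G by (simp add: nn_integral_interval_measure_add)
  qed
  have hu: "hu s = indicator E s * (ennreal (lam s) * gu (F s))"
    and hv: "hv s = indicator E s * (ennreal (1 - lam s) * gv (G s))" for s
    by (auto simp: hu_def hv_def LE indicator_def)
  have bound_u: "(\<integral>\<^sup>+s. hu s \<partial>lborel) + (\<integral>\<^sup>+s. hd s \<partial>interval_measure F) \<le> half_integral gu"
    unfolding hu hd_def D_def
    by (intro half_line_substitution_bound F FG(2) E lam lam01(1) der gu gw off_E(1))
  have bound_v: "(\<integral>\<^sup>+s. hv s \<partial>lborel) + (\<integral>\<^sup>+s. hd s \<partial>interval_measure G) \<le> half_integral gv"
    unfolding hv hd_def D_def
    by (intro half_line_substitution_bound G FG(3) E continuous_intros lam der_G gv gw off_E(2))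
      (use lam01(2) in simp_all)
  have "(\<integral>\<^sup>+s. hu s + hv s + hd s \<partial>lborel) =
      (\<integral>\<^sup>+s. hu s \<partial>lborel) + (\<integral>\<^sup>+s. hv s \<partial>lborel) + (\<integral>\<^sup>+s. hd s \<partial>lborel)"
    by (simp add: nn_integral_add)
  also have "\<dots> \<le> half_integral gu + half_integral gv"
    unfolding part_D using add_mono[OF bound_u bound_v] by (simp add: ac_simps)
  finally have le: "(\<integral>\<^sup>+s. hu s + hv s + hd s \<partial>lborel) \<le>
      half_integral gu + half_integral gv" .
  have ptw: "gw s * indicator {0<..} s \<le> hu s + hv s + hd s" for s
    using on_E[of s] E(2) by (auto simp: hu_def hv_def hd_def D_def LE indicator_def)
  have "half_integral gw < (\<integral>\<^sup>+s. hu s + hv s + hd s \<partial>lborel)"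
  proof (rule nn_integral_less)
    have "half_integral gw \<le> (\<integral>\<^sup>+s. hu s + hv s + hd s \<partial>lborel)"
      by (intro nn_integral_mono ptw)
    also note le
    also have "half_integral gu + half_integral gv < \<infinity>" using fin by simp
    finally show "half_integral gw \<noteq> \<infinity>" by simp
    show "\<not> (AE s in lborel. hu s + hv s + hd s \<le> gw s * indicator {0<..} s)"
    proof
      assume "AE s in lborel. hu s + hv s + hd s \<le> gw s * indicator {0<..} s"
      moreover have "\<not> hu s + hv s + hd s \<le> gw s * indicator {0<..} s" if "s \<in> S" for s
      proof -
        have "s \<in> E" "0 < s" using that S E by auto
        then show ?thesis using strict[OF that] by (simp add: hu_def hv_def hd_def D_def LE not_le)
      qed
      ultimately have "AE s in lborel. s \<notin> S" by (auto elim: eventually_mono)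
      then have "S \<in> null_sets lborel" by (simp add: AE_iff_null_sets)
      then have "negligible S" by (simp add: negligible_iff_null_sets null_sets_completionI)
      then show False using open_not_negligible S by blast
    qed
  qed (use ptw in simp_all)
  then show ?thesis using le by simp
qed

section \<open>The strict inequality on one line\<close>

text \<open>
  The first part of the splitting, continued by the identity to the negative half-line so that it is onto.
\<close>

definition left_length :: "(real \<Rightarrow> real) \<Rightarrow> (real \<Rightarrow> real) \<Rightarrow> real \<Rightarrow> real" where
  "left_length U V s = (if s < 0 then s else split_point U V s)"

definition right_length :: "(real \<Rightarrow> real) \<Rightarrow> (real \<Rightarrow> real) \<Rightarrow> real \<Rightarrow> real" where
  "right_length U V s = (if s < 0 then s else s - split_point U V s)"

lemma split_point_unbounded:
  assumes U: "profile U" and V: "profile V" and A: "0 \<le> A"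
  shows "\<exists>s\<ge>0. A \<le> split_point U V s" "\<exists>s\<ge>0. A \<le> s - split_point U V s"
proof -
  obtain b where b: "0 < b" "\<And>s. b \<le> \<bar>s\<bar> \<Longrightarrow> V s < U A"
    using profile_eventually_small[OF V profileD(3)[OF U, of A]] by blast
  have "A \<le> split_point U V (A + b)"
    using b(2)[of b] b(1) A by (intro split_point_upper) auto
  then show "\<exists>s\<ge>0. A \<le> split_point U V s" using A b(1) by (intro exI[of _ "A + b"]) auto
  obtain c where c: "0 < c" "\<And>s. c \<le> \<bar>s\<bar> \<Longrightarrow> U s < V A"
    using profile_eventually_small[OF U profileD(3)[OF V, of A]] by blast
  have "split_point U V (A + c) \<le> c"
    unfolding split_point_def
  proof (rule cSup_least)
    fix a assume "a \<in> insert 0 {a. 0 \<le> a \<and> a \<le> A + c \<and> V (A + c - a) \<le> U a}"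
    then consider "a = 0" | "0 \<le> a" "a \<le> A + c" "V (A + c - a) \<le> U a" by auto
    then show "a \<le> c"
    proof cases
      case 2
      show ?thesis
      proof (rule ccontr)
        assume "\<not> a \<le> c"
        then show False using 2 c(2)[of a] profileD(2)[OF V, of "A + c - a" A] by auto
      qed
    qed (use c in simp)
  qed simp
  then show "\<exists>s\<ge>0. A \<le> s - split_point U V s" using A c(1) by (intro exI[of _ "A + c"]) auto
qed

lemma surj_extend_by_id:
  fixes H :: "real \<Rightarrow> real"
  assumes c: "continuous_on UNIV H" and neg: "\<And>s. s < 0 \<Longrightarrow> H s = s" and "H 0 = 0"
    and ub: "\<And>A. 0 \<le> A \<Longrightarrow> \<exists>s\<ge>0. A \<le> H s"
  shows "surj H"
proof -
  have "\<exists>x. H x = y" for y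
  proof (cases "y < 0")
    case False
    then obtain s where "0 \<le> s" "y \<le> H s" using ub[of y] by auto
    moreover have "continuous_on {0..s} H" using continuous_on_subset[OF c] by blast
    ultimately show ?thesis using IVT'[of H 0 y s] \<open>H 0 = 0\<close> False by force
  qed (use neg in auto)
  then show ?thesis by (metis surjI)
qed

lemma
  assumes U: "profile U" and V: "profile V"
  shows left_length_mono: "mono (left_length U V)" and right_length_mono: "mono (right_length U V)"
    and left_length_continuous: "continuous_on UNIV (left_length U V)"
    and right_length_continuous: "continuous_on UNIV (right_length U V)"
    and left_length_surj: "surj (left_length U V)" and right_length_surj: "surj (right_length U V)"
proof -
  show "mono (left_length U V)" "mono (right_length U V)"
  proof -
    have "left_length U V s \<le> left_length U V r \<and> right_length U V s \<le> right_length U V r"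
      if "s \<le> r" for s r
      using split_point_mono[OF U V, of s r] split_point_bounds[of r U V] that
      by (auto simp: left_length_def right_length_def)
    then show "mono (left_length U V)" "mono (right_length U V)" by (auto simp: mono_def)
  qed
  have zero: "split_point U V 0 = 0" using split_point_bounds[of 0 U V] by (intro antisym) auto
  have ext: "continuous_on UNIV (\<lambda>s. if s < 0 then s else f s)"
    if "continuous_on {0..} f" "f 0 = 0" for f :: "real \<Rightarrow> real"
  proof -
    have "continuous_on ({..0} \<union> {0..}) (\<lambda>s. if s < 0 then s else f s)"
    proof (intro continuous_on_closed_Un)
      show "continuous_on {..0} (\<lambda>s. if s < 0 then s else f s)"
        by (rule continuous_on_eq[where f="\<lambda>s. s"]) (use that(2) in auto)
      show "continuous_on {0..} (\<lambda>s. if s < 0 then s else f s)"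
        by (rule continuous_on_eq[OF that(1)]) auto
    qed auto
    moreover have "{..0} \<union> {0..} = (UNIV :: real set)" by auto
    ultimately show ?thesis by simp
  qed
  show cl: "continuous_on UNIV (left_length U V)"
    unfolding left_length_def[abs_def] by (intro ext split_point_continuous U V zero)
  show cr: "continuous_on UNIV (right_length U V)"
    unfolding right_length_def[abs_def] using zero
    by (intro ext continuous_intros split_point_continuous U V) auto
  show "surj (left_length U V)"
  proof (rule surj_extend_by_id[OF cl])
    fix A :: real assume "0 \<le> A"
    then obtain s where "0 \<le> s" "A \<le> split_point U V s" using split_point_unbounded(1)[OF U V] by blast
    then show "\<exists>s\<ge>0. A \<le> left_length U V s" by (intro exI[of _ s]) (simp add: left_length_def)
  qed (simp_all add: left_length_def zero)
  show "surj (right_length U V)"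
  proof (rule surj_extend_by_id[OF cr])
    fix A :: real assume "0 \<le> A"
    then obtain s where "0 \<le> s" "A \<le> s - split_point U V s" using split_point_unbounded(2)[OF U V] by blast
    then show "\<exists>s\<ge>0. A \<le> right_length U V s" by (intro exI[of _ s]) (simp add: right_length_def)
  qed (simp_all add: right_length_def zero)
qed

lemma left_length_lipschitz:
  assumes U: "profile U" and V: "profile V"
  shows "left_length U V s + right_length U V s = (if s < 0 then 2 * s else s)"
    "0 \<le> s \<Longrightarrow> 0 \<le> r \<Longrightarrow> \<bar>left_length U V r - left_length U V s\<bar> \<le> \<bar>r - s\<bar>"
    "0 \<le> s \<Longrightarrow> 0 \<le> r \<Longrightarrow> \<bar>right_length U V r - right_length U V s\<bar> \<le> \<bar>r - s\<bar>"
proof -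
  have "\<bar>split_point U V r - split_point U V s\<bar> \<le> \<bar>r - s\<bar>"
      "\<bar>(r - split_point U V r) - (s - split_point U V s)\<bar> \<le> \<bar>r - s\<bar>" if "0 \<le> s" "0 \<le> r"
    using split_point_mono[OF U V, of s r] split_point_mono[OF U V, of r s] that
    by (cases "s \<le> r"; simp)+
  then show "0 \<le> s \<Longrightarrow> 0 \<le> r \<Longrightarrow> \<bar>left_length U V r - left_length U V s\<bar> \<le> \<bar>r - s\<bar>"
      "0 \<le> s \<Longrightarrow> 0 \<le> r \<Longrightarrow> \<bar>right_length U V r - right_length U V s\<bar> \<le> \<bar>r - s\<bar>"
    by (auto simp: left_length_def right_length_def)
qed (simp add: left_length_def right_length_def)

lemma balanced_of_interior:
  assumes U: "profile U" and V: "profile V" and s: "0 < s"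
    and "0 < left_length U V s" "0 < right_length U V s"
  shows "U (left_length U V s) = V (right_length U V s)" "U s \<le> V 0" "V s \<le> U 0"
proof -
  have s0: "0 \<le> s" using s by simp
  show "U (left_length U V s) = V (right_length U V s)" "U s \<le> V 0" "V s \<le> U 0"
    using assms by (cases rule: split_point_cases[OF U V s0, case_names left right balanced];
      simp add: left_length_def right_length_def)+
qed

lemma mvt_between:
  fixes U U' :: "real \<Rightarrow> real"
  assumes "\<And>s. (U has_real_derivative U' s) (at s)"
  shows "\<exists>x. \<bar>x - p\<bar> \<le> \<bar>p' - p\<bar> \<and> U p' - U p = (p' - p) * U' x"
proof -
  consider "p = p'" | "p < p'" | "p' < p" by linarith
  then show ?thesis
  proof cases
    case 2
    obtain z where "p < z" "z < p'" "U p' - U p = (p' - p) * U' z" using MVT2[OF 2 assms] by blast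
    then show ?thesis by (intro exI[of _ z]) auto
  next
    case 3
    obtain z where z: "p' < z" "z < p" "U p - U p' = (p - p') * U' z" using MVT2[OF 3 assms] by blast
    then have "U p' - U p = (p' - p) * U' z" by (simp add: algebra_simps)
    then show ?thesis using z by (intro exI[of _ z]) auto
  qed auto
qed

text \<open>
  By the mean value theorem, the increments \<open>\<Delta>p\<close> and \<open>\<Delta>q\<close> of the two parts satisfy
  \<open>\<Delta>p * U' x = \<Delta>q * V' y\<close> at nearby points \<open>x\<close> and \<open>y\<close>, because \<open>U p = V q\<close> throughout. Together with
  \<open>\<Delta>p + \<Delta>q = \<Delta>s\<close> this determines \<open>\<Delta>p / \<Delta>s\<close>.
\<close>

lemma left_length_deriv:
  assumes U: "profile U" and V: "profile V"
    and dU: "\<And>s. (U has_real_derivative U' s) (at s)" and cU: "continuous_on UNIV U'"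
    and dV: "\<And>s. (V has_real_derivative V' s) (at s)" and cV: "continuous_on UNIV V'"
    and s: "0 < s" "0 < left_length U V s" "0 < right_length U V s"
    and ne: "U' (left_length U V s) + V' (right_length U V s) \<noteq> 0"
  shows "(left_length U V has_real_derivative
     V' (right_length U V s) / (U' (left_length U V s) + V' (right_length U V s))) (at s)"
proof -
  let ?F = "left_length U V" and ?G = "right_length U V"
  have cF: "isCont ?F s" and cG: "isCont ?G s"
    using left_length_continuous[OF U V] right_length_continuous[OF U V]
    by (auto simp: continuous_on_eq_continuous_at)
  have "\<forall>r. \<exists>x. \<bar>x - ?F s\<bar> \<le> \<bar>?F r - ?F s\<bar> \<and> U (?F r) - U (?F s) = (?F r - ?F s) * U' x"
    using mvt_between[OF dU] by blast
  then obtain x where x: "\<And>r. \<bar>x r - ?F s\<bar> \<le> \<bar>?F r - ?F s\<bar>"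
      "\<And>r. U (?F r) - U (?F s) = (?F r - ?F s) * U' (x r)" by metis
  have "\<forall>r. \<exists>x. \<bar>x - ?G s\<bar> \<le> \<bar>?G r - ?G s\<bar> \<and> V (?G r) - V (?G s) = (?G r - ?G s) * V' x"
    using mvt_between[OF dV] by blast
  then obtain y where y: "\<And>r. \<bar>y r - ?G s\<bar> \<le> \<bar>?G r - ?G s\<bar>"
      "\<And>r. V (?G r) - V (?G s) = (?G r - ?G s) * V' (y r)" by metis
  have lim: "(f \<longlongrightarrow> H s) (at s)" if "isCont H s" "\<And>r. \<bar>f r - H s\<bar> \<le> \<bar>H r - H s\<bar>"
    for f H :: "real \<Rightarrow> real"
  proof -
    have "((\<lambda>r. H r - H s) \<longlongrightarrow> 0) (at s)" using that(1) by (simp add: isCont_def LIM_zero_iff)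
    then have "((\<lambda>r. f r - H s) \<longlongrightarrow> 0) (at s)"
      by (rule Lim_null_comparison[rotated, OF tendsto_rabs_zero]) (use that(2) in simp)
    then show ?thesis by (simp add: LIM_zero_iff)
  qed
  have "((\<lambda>r. U' (x r)) \<longlongrightarrow> U' (?F s)) (at s)" "((\<lambda>r. V' (y r)) \<longlongrightarrow> V' (?G s)) (at s)"
    using cU cV lim[OF cF x(1)] lim[OF cG y(1)]
    by (auto simp: continuous_on_eq_continuous_at intro: isCont_tendsto_compose)
  note lims = this
  have sum: "((\<lambda>r. U' (x r) + V' (y r)) \<longlongrightarrow> U' (?F s) + V' (?G s)) (at s)"
    by (intro tendsto_add lims)
  have ev: "eventually (\<lambda>r. 0 < r \<and> 0 < ?F r \<and> 0 < ?G r) (at s)"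
    using order_tendstoD(1)[OF cF[unfolded isCont_def] s(2)]
      order_tendstoD(1)[OF cG[unfolded isCont_def] s(3)]
      order_tendstoD(1)[OF tendsto_ident_at s(1)] by eventually_elim auto
  have ev2: "eventually (\<lambda>r. r \<noteq> s) (at s)" by (simp add: eventually_at_filter)
  have "eventually (\<lambda>r. V' (y r) / (U' (x r) + V' (y r)) = (?F r - ?F s) / (r - s)) (at s)"
    using ev ev2 tendsto_imp_eventually_ne[OF sum ne]
  proof eventually_elim
    case (elim r)
    have "U (?F r) = V (?G r)" "U (?F s) = V (?G s)"
      using balanced_of_interior[OF U V] elim s by auto
    then have "(?F r - ?F s) * U' (x r) = (?G r - ?G s) * V' (y r)" using x(2)[of r] y(2)[of r] by simp
    moreover have "?G r = r - ?F r" "?G s = s - ?F s"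
      using elim s by (auto simp: left_length_def right_length_def)
    ultimately have "(?F r - ?F s) * (U' (x r) + V' (y r)) = V' (y r) * (r - s)" by (simp add: algebra_simps)
    then show ?case using elim by (simp add: field_simps)
  qed
  then have "((\<lambda>r. (?F r - ?F s) / (r - s)) \<longlongrightarrow> V' (?G s) / (U' (?F s) + V' (?G s))) (at s)"
    by (rule Lim_transform_eventually[rotated]) (intro tendsto_divide lims sum ne)
  then show ?thesis by (simp add: has_field_derivative_iff)
qed

lemma profile_deriv_nonpos:
  assumes U: "profile U" and dU: "(U has_real_derivative d) (at s)" and s: "0 \<le> s"
  shows "d \<le> 0"
proof (rule ccontr)
  assume "\<not> d \<le> 0"
  then obtain e where e: "e > 0" "\<And>h. 0 < h \<Longrightarrow> h < e \<Longrightarrow> U s < U (s + h)"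
    using DERIV_pos_inc_right[OF dU] by auto
  show False using e(2)[of "e / 2"] e(1) profileD(2)[OF U, of s "s + e / 2"] s by auto
qed

text \<open>
  The chain rule at a critical point needs only a Lipschitz bound on the inner function.
\<close>

lemma critical_comp_lipschitz:
  fixes U F :: "real \<Rightarrow> real"
  assumes U: "(U has_real_derivative 0) (at (F s))" and F: "\<And>r. r \<in> S \<Longrightarrow> \<bar>F r - F s\<bar> \<le> \<bar>r - s\<bar>"
    and S: "open S" "s \<in> S"
  shows "((\<lambda>r. U (F r)) has_real_derivative 0) (at s)"
proof -
  obtain d0 where d0: "d0 > 0" "ball s d0 \<subseteq> S" using S openE by blast
  have "((\<lambda>r. U (F r)) has_derivative (\<lambda>h. 0)) (at s)"
    unfolding has_derivative_at_alt
  proof (intro conjI allI impI)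
    fix e :: real assume "e > 0"
    then obtain d where d: "d > 0" "\<And>y. \<bar>y - F s\<bar> < d \<Longrightarrow> \<bar>U y - U (F s)\<bar> \<le> e * \<bar>y - F s\<bar>"
      using U unfolding has_field_derivative_def has_derivative_at_alt by auto
    show "\<exists>d>0. \<forall>y. norm (y - s) < d \<longrightarrow> norm (U (F y) - U (F s) - 0) \<le> e * norm (y - s)"
    proof (intro exI[of _ "min d d0"] conjI allI impI)
      fix y assume y: "norm (y - s) < min d d0"
      then have "y \<in> S" using d0 by (auto simp: dist_real_def)
      then have F': "\<bar>F y - F s\<bar> \<le> \<bar>y - s\<bar>" by (rule F)
      then have "\<bar>U (F y) - U (F s)\<bar> \<le> e * \<bar>F y - F s\<bar>" using d(2)[of "F y"] y by simp
      also have "\<dots> \<le> e * \<bar>y - s\<bar>" using F' \<open>e > 0\<close> by simp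
      finally show "norm (U (F y) - U (F s) - 0) \<le> e * norm (y - s)" by simp
    qed (use d d0 in auto)
  qed simp
  then show ?thesis by (simp add: has_field_derivative_def lambda_zero)
qed

text \<open>
  Far out the splitting is balanced, so that \<open>s \<mapsto> U p = V q\<close> is the coupled profile. If \<open>U' p\<close> or
  \<open>V' q\<close> vanished at every such point, its derivative would vanish, since \<open>p\<close> and \<open>q\<close> are Lipschitz. It
  would be a positive constant, contradicting that \<open>U\<close> tends to \<open>0\<close> while \<open>p\<close> is unbounded.
\<close>

lemma exists_noncritical_split:
  assumes U: "profile U" and V: "profile V"
    and dU: "\<And>s. (U has_real_derivative U' s) (at s)"
    and dV: "\<And>s. (V has_real_derivative V' s) (at s)"
  obtains s where "0 < s" "0 < left_length U V s" "0 < right_length U V s"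
    "U' (left_length U V s) < 0" "V' (right_length U V s) < 0"
proof (rule ccontr)
  note witness = that
  assume contra: "\<not> thesis"
  let ?F = "left_length U V" and ?G = "right_length U V"
  obtain b where b: "0 < b" "\<And>s. b \<le> \<bar>s\<bar> \<Longrightarrow> V s < U 0"
    using profile_eventually_small[OF V profileD(3)[OF U, of 0]] by blast
  obtain c where c: "0 < c" "\<And>s. c \<le> \<bar>s\<bar> \<Longrightarrow> U s < V 0"
    using profile_eventually_small[OF U profileD(3)[OF V, of 0]] by blast
  define m where "m = max b c"
  have bal: "0 < ?F s \<and> 0 < ?G s \<and> U (?F s) = V (?G s)" if s: "m < s" for s
  proof -
    have s0: "0 \<le> s" "0 < s" using s b(1) by (auto simp: m_def)
    have lt: "V s < U 0" "U s < V 0" using b(2)[of s] c(2)[of s] s s0 by (auto simp: m_def)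
    have "U (split_point U V s) = V (s - split_point U V s)"
      using lt by (cases rule: split_point_cases[OF U V s0(1), case_names left right balanced]) auto
    then have eq: "U (?F s) = V (?G s)" using s0 by (simp add: left_length_def right_length_def)
    have "0 \<le> ?F s" "?F s \<le> s" "?G s = s - ?F s"
      using split_point_bounds[of s U V] s0 by (auto simp: left_length_def right_length_def)
    moreover have "?F s \<noteq> 0" "?F s \<noteq> s" using eq lt \<open>?G s = s - ?F s\<close> by auto
    ultimately show ?thesis using eq by auto
  qed
  have crit: "U' (?F s) = 0 \<or> V' (?G s) = 0" if s: "m < s" for s
  proof -
    have "0 < s" using s b(1) by (auto simp: m_def)
    moreover have "U' (?F s) \<le> 0" "V' (?G s) \<le> 0"
      using bal[OF s] profile_deriv_nonpos[OF U dU, of "?F s"] profile_deriv_nonpos[OF V dV, of "?G s"] by auto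
    ultimately show ?thesis using contra bal[OF s] witness[of s] by fastforce
  qed
  have d0: "((\<lambda>r. U (?F r)) has_real_derivative 0) (at s within {m<..})" if s: "s \<in> {m<..}" for s
  proof -
    have pos: "0 \<le> r" if "r \<in> {m<..}" for r using that b(1) by (auto simp: m_def)
    have "((\<lambda>r. U (?F r)) has_real_derivative 0) (at s)"
    proof (cases "U' (?F s) = 0")
      case True
      show ?thesis
        by (rule critical_comp_lipschitz[where S="{m<..}"])
          (use True dU[of "?F s"] s pos left_length_lipschitz(2)[OF U V] in auto)
    next
      case False
      then have V0: "V' (?G s) = 0" using crit[of s] s by auto
      have "((\<lambda>r. V (?G r)) has_real_derivative 0) (at s)"
        by (rule critical_comp_lipschitz[where S="{m<..}"])
          (use V0 dV[of "?G s"] s pos left_length_lipschitz(3)[OF U V] in auto)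
      then show ?thesis
        by (rule has_field_derivative_transform_within_open[where S="{m<..}"]) (use s bal in auto)
    qed
    then show ?thesis by (rule has_field_derivative_at_within)
  qed
  obtain k where k: "\<And>s. s \<in> {m<..} \<Longrightarrow> U (?F s) = k"
    using has_field_derivative_zero_constant[OF _ d0] by auto
  have "0 < k" using k[of "m + 1"] profileD(3)[OF U] by force
  then obtain A where A: "0 < A" "\<And>s. A \<le> \<bar>s\<bar> \<Longrightarrow> U s < k"
    using profile_eventually_small[OF U] by blast
  \<comment> \<open>Beyond \<open>A\<close> the profile is below \<open>k\<close>, and beyond \<open>m\<close> it equals \<open>k\<close> at the split point.\<close>
  define B where "B = max A m + 1"
  obtain s where s: "?F s = B" using left_length_surj[OF U V] by (metis surjD)
  have "m < s"
  proof (cases "s < 0")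
    case True
    then show ?thesis using s A(1) by (simp add: left_length_def B_def)
  next
    case False
    then show ?thesis using s split_point_bounds[of s U V] by (simp add: left_length_def B_def)
  qed
  moreover have "A \<le> \<bar>B\<bar>" using A(1) by (simp add: B_def)
  ultimately show False using k[of s] A(2)[of B] s by simp
qed

text \<open>
  The half line falls into the open sets where one profile dominates (\<open>EA\<close>, \<open>EB\<close>) or the splitting is
  interior and noncritical (\<open>EC\<close>), on which the parts are continuously differentiable, and a remainder
  on which both parts yield a bound.
\<close>

lemma coupled_profile_integral:
  fixes U V U' V' :: "real \<Rightarrow> real" and gu gv gw :: "real \<Rightarrow> ennreal"
  assumes U: "profile U" and V: "profile V"
    and dU: "\<And>s. (U has_real_derivative U' s) (at s)" and cU: "continuous_on UNIV U'"
    and dV: "\<And>s. (V has_real_derivative V' s) (at s)" and cV: "continuous_on UNIV V'"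
    and meas: "gu \<in> borel_measurable borel" "gv \<in> borel_measurable borel" "gw \<in> borel_measurable borel"
    and fin: "half_integral gu < \<infinity>" "half_integral gv < \<infinity>"
    and left: "\<And>s. 0 < s \<Longrightarrow> V 0 < U s \<Longrightarrow> gw s \<le> gu s"
    and right: "\<And>s. 0 < s \<Longrightarrow> U 0 < V s \<Longrightarrow> gw s \<le> gv s"
    and regular: "\<And>p q. 0 < p \<Longrightarrow> 0 < q \<Longrightarrow> U p = V q \<Longrightarrow> U' p + V' q < 0 \<Longrightarrow>
      gw (p + q) \<le> ennreal (V' q / (U' p + V' q)) * gu p + ennreal (1 - V' q / (U' p + V' q)) * gv q"
    and strict: "\<And>p q. 0 < p \<Longrightarrow> 0 < q \<Longrightarrow> U p = V q \<Longrightarrow> U' p < 0 \<Longrightarrow> V' q < 0 \<Longrightarrow>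
      gw (p + q) < ennreal (V' q / (U' p + V' q)) * gu p + ennreal (1 - V' q / (U' p + V' q)) * gv q"
    and singular: "\<And>p q. 0 \<le> p \<Longrightarrow> 0 \<le> q \<Longrightarrow> 0 < p + q \<Longrightarrow> U p = V q \<Longrightarrow>
      \<not> (0 < p \<and> 0 < q \<and> U' p + V' q < 0) \<Longrightarrow> gw (p + q) \<le> min (gu p) (gv q)"
  shows "half_integral gw <
      half_integral gu + half_integral gv"
proof -
  let ?F = "left_length U V" and ?G = "right_length U V"
  note Fc = left_length_continuous[OF U V] and Gc = right_length_continuous[OF U V]
  have UF: "continuous_on A (\<lambda>s. U' (?F s))" and VG: "continuous_on A (\<lambda>s. V' (?G s))" for A
    by (auto intro!: continuous_on_compose2[OF cU] continuous_on_compose2[OF cV]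
        continuous_on_subset[OF Fc] continuous_on_subset[OF Gc])
  have sum: "?F s + ?G s = s" if "0 \<le> s" for s using that by (simp add: left_length_def right_length_def)
  have nonneg: "0 \<le> ?F s" "0 \<le> ?G s" if "0 \<le> s" for s
    using split_point_bounds[of s U V] that by (auto simp: left_length_def right_length_def)
  define EA where "EA = {s. 0 < s \<and> V 0 < U s}"
  define EB where "EB = {s. 0 < s \<and> U 0 < V s}"
  define EC where "EC = {s. 0 < s \<and> 0 < ?F s \<and> 0 < ?G s \<and> U' (?F s) + V' (?G s) < 0}"
  define S where "S = {s. 0 < s \<and> 0 < ?F s \<and> 0 < ?G s \<and> U' (?F s) < 0 \<and> V' (?G s) < 0}"
  have open_E: "open EA" "open EB" "open EC" "open S"
    unfolding EA_def EB_def EC_def S_def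
    by (intro open_Collect_conj open_Collect_less continuous_intros UF VG Fc Gc
        profileD(1)[OF U] profileD(1)[OF V])+
  define lam where "lam s = (if V 0 < U s then 1 else if U 0 < V s then 0
      else V' (?G s) / (U' (?F s) + V' (?G s)))" for s
  have F_EA: "?F s = s" "?G s = 0" if "s \<in> EA" for s
  proof -
    have "0 \<le> s" using that by (simp add: EA_def)
    then have "split_point U V s = s"
      using that profileD(2)[OF U, of 0 s] profileD(2)[OF V, of 0 s]
      by (cases rule: split_point_cases[OF U V \<open>0 \<le> s\<close>, case_names left right balanced]) (auto simp: EA_def)
    then show "?F s = s" "?G s = 0" using \<open>0 \<le> s\<close> by (auto simp: left_length_def right_length_def)
  qed
  have F_EB: "?F s = 0" "?G s = s" "\<not> V 0 < U s" if "s \<in> EB" for s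
  proof -
    have "0 \<le> s" using that by (simp add: EB_def)
    then have "split_point U V s = 0"
      using that profileD(2)[OF U, of 0 s] profileD(2)[OF V, of 0 s]
      by (cases rule: split_point_cases[OF U V \<open>0 \<le> s\<close>, case_names left right balanced]) (auto simp: EB_def)
    then show "?F s = 0" "?G s = s" using \<open>0 \<le> s\<close> by (auto simp: left_length_def right_length_def)
    show "\<not> V 0 < U s"
      using that profileD(2)[OF U, of 0 s] profileD(2)[OF V, of 0 s] by (auto simp: EB_def)
  qed
  have bal: "U (?F s) = V (?G s)" "\<not> V 0 < U s" "\<not> U 0 < V s" if "s \<in> EC" for s
    using balanced_of_interior[OF U V, of s] that by (auto simp: EC_def)
  have lamA: "lam s = 1" if "s \<in> EA" for s using that by (simp add: lam_def EA_def)
  have lamB: "lam s = 0" if "s \<in> EB" for s using that F_EB(3)[of s] by (simp add: lam_def EB_def)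
  have lamC: "lam s = V' (?G s) / (U' (?F s) + V' (?G s))" if "s \<in> EC" for s
    using bal[OF that] by (simp add: lam_def)
  have np: "U' (?F s) \<le> 0" "V' (?G s) \<le> 0" if "0 \<le> s" for s
    using nonneg[OF that] profile_deriv_nonpos[OF U dU] profile_deriv_nonpos[OF V dV] by auto
  show ?thesis
  proof (rule half_line_split_integral[where F="?F" and G="?G" and E="EA \<union> EB \<union> EC" and lam=lam and S=S])
    show "mono ?F" "mono ?G" "surj ?F" "surj ?G" "continuous_on UNIV ?F" "continuous_on UNIV ?G"
      by (intro left_length_mono right_length_mono left_length_surj right_length_surj Fc Gc U V)+
    show "?F s + ?G s = s" "0 \<le> ?F s" "0 \<le> ?G s" if "0 < s" for s
      using sum[of s] nonneg[of s] that by auto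
    show "open (EA \<union> EB \<union> EC)" "open S" using open_E by auto
    show "EA \<union> EB \<union> EC \<subseteq> {0<..}" by (auto simp: EA_def EB_def EC_def)
    show "S \<subseteq> EA \<union> EB \<union> EC" by (auto simp: S_def EC_def)
    show "S \<noteq> {}" using exists_noncritical_split[OF U V dU dV] by (metis (mono_tags, lifting) S_def empty_iff mem_Collect_eq)
    have "continuous_on EA lam" using lamA by (simp cong: continuous_on_cong)
    moreover have "continuous_on EB lam" using lamB by (simp cong: continuous_on_cong)
    moreover have "continuous_on EC (\<lambda>s. V' (?G s) / (U' (?F s) + V' (?G s)))"
      by (intro continuous_intros UF VG) (auto simp: EC_def)
    then have "continuous_on EC lam" using lamC by (simp cong: continuous_on_cong)
    ultimately show "continuous_on (EA \<union> EB \<union> EC) lam" by (intro continuous_on_open_Un open_Un open_E)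
    fix s assume s: "s \<in> EA \<union> EB \<union> EC"
    then consider (A) "s \<in> EA" | (B) "s \<in> EB" | (C) "s \<in> EC" by blast
    note cases = this
    have s0: "0 \<le> s" using s by (auto simp: EA_def EB_def EC_def)
    show "0 \<le> lam s" "lam s \<le> 1"
      using cases lamA lamB lamC np[OF s0]
      by (cases; simp add: EC_def divide_nonpos_nonpos divide_le_eq)+
    show "(?F has_real_derivative lam s) (at s)"
    proof (cases rule: cases)
      case A
      show ?thesis unfolding lamA[OF A]
        by (rule has_field_derivative_transform_within_open[where f="\<lambda>s. s" and S=EA])
          (use A open_E F_EA in \<open>auto intro!: derivative_eq_intros\<close>)
    next
      case B
      show ?thesis unfolding lamB[OF B]
        by (rule has_field_derivative_transform_within_open[where f="\<lambda>s. 0" and S=EB])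
          (use B open_E F_EB in \<open>auto intro!: derivative_eq_intros\<close>)
    next
      case C
      then show ?thesis unfolding lamC[OF C]
        by (intro left_length_deriv[OF U V dU cU dV cV]) (auto simp: EC_def)
    qed
    show "gw s \<le> ennreal (lam s) * gu (?F s) + ennreal (1 - lam s) * gv (?G s)"
    proof (cases rule: cases)
      case A
      then show ?thesis using left[of s] by (simp add: lamA F_EA) (simp add: EA_def)
    next
      case B
      then show ?thesis using right[of s] by (simp add: lamB F_EB) (simp add: EB_def)
    next
      case C
      then show ?thesis using regular[of "?F s" "?G s"] bal[OF C] sum[OF s0]
        by (simp add: lamC) (simp add: EC_def)
    qed
  next
    fix s assume s: "s \<in> S"
    then have C: "s \<in> EC" "0 \<le> s" by (auto simp: S_def EC_def)
    then show "gw s < ennreal (lam s) * gu (?F s) + ennreal (1 - lam s) * gv (?G s)"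
      using strict[of "?F s" "?G s"] bal[OF C(1)] sum[OF C(2)] s by (simp add: lamC) (simp add: S_def)
  next
    fix s assume s: "0 < s" "s \<notin> EA \<union> EB \<union> EC"
    then have s0: "0 \<le> s" by simp
    have eq: "U (split_point U V s) = V (s - split_point U V s)"
      using s by (cases rule: split_point_cases[OF U V s0, case_names left right balanced]) (auto simp: EA_def EB_def)
    have "gw (?F s + ?G s) \<le> min (gu (?F s)) (gv (?G s))"
    proof (rule singular)
      show "U (?F s) = V (?G s)" using eq s by (simp add: left_length_def right_length_def)
      show "\<not> (0 < ?F s \<and> 0 < ?G s \<and> U' (?F s) + V' (?G s) < 0)" using s by (auto simp: EC_def)
    qed (use nonneg[OF s0] sum[OF s0] s in auto)
    then show "gw s \<le> gu (?F s)" "gw s \<le> gv (?G s)" using sum[OF s0] by auto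
  qed (use meas fin in auto)
qed

section \<open>Weak gradients of locally Lipschitz functions\<close>

definition grad :: "(real^'n \<Rightarrow> real) \<Rightarrow> real^'n \<Rightarrow> real^'n" where
  "grad f x = (\<chi> i. partial i f x)"

lemma has_derivative_imp_grad:
  fixes f :: "real^'n \<Rightarrow> real"
  assumes "(f has_derivative (\<lambda>h. g \<bullet> h)) (at x)"
  shows "grad f x = g"
proof -
  have "frechet_derivative f (at x) = (\<lambda>h. g \<bullet> h)" using frechet_derivative_at[OF assms] by simp
  then show ?thesis by (simp add: grad_def partial_def vec_eq_iff inner_axis)
qed

lemma has_derivative_grad:
  fixes f :: "real^'n \<Rightarrow> real"
  assumes "f differentiable (at x)"
  shows "(f has_derivative (\<lambda>h. grad f x \<bullet> h)) (at x)"
proof -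
  let ?D = "frechet_derivative f (at x)"
  have D: "(f has_derivative ?D) (at x)" using assms frechet_derivative_works by blast
  then interpret linear ?D by (rule has_derivative_linear)
  have "?D h = grad f x \<bullet> h" for h
  proof -
    have "?D h = ?D (\<Sum>i\<in>UNIV. h $ i *\<^sub>R axis i 1)" by (simp add: basis_expansion scalar_mult_eq_scaleR[symmetric])
    also have "\<dots> = (\<Sum>i\<in>UNIV. h $ i * ?D (axis i 1))" by (simp add: sum scale)
    also have "\<dots> = grad f x \<bullet> h" by (simp add: grad_def partial_def inner_vec_def mult.commute)
    finally show ?thesis .
  qed
  then have "?D = (\<lambda>h. grad f x \<bullet> h)" by auto
  then show ?thesis using D by simp
qed

lemma C1_grad:
  fixes f :: "real^'n \<Rightarrow> real"
  assumes "C_k 1 f"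
  shows "(f has_derivative (\<lambda>h. grad f x \<bullet> h)) (at x)" and "continuous_on UNIV (grad f)"
proof -
  show "(f has_derivative (\<lambda>h. grad f x \<bullet> h)) (at x)"
    using assms by (intro has_derivative_grad) (simp add: differentiable_on_def)
  show "continuous_on UNIV (grad f)"
    unfolding grad_def[abs_def] using assms by (intro continuous_on_vec_lambda) simp
qed

definition locally_lipschitz :: "('a::real_normed_vector \<Rightarrow> real) \<Rightarrow> bool" where
  "locally_lipschitz f \<longleftrightarrow> (\<forall>R. \<exists>L\<ge>0. \<forall>x y. norm x \<le> R \<longrightarrow> norm y \<le> R \<longrightarrow> \<bar>f x - f y\<bar> \<le> L * norm (x - y))"

lemma C1_locally_lipschitz:
  fixes f :: "real^'n \<Rightarrow> real"
  assumes "C_k 1 f"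
  shows "locally_lipschitz f"
  unfolding locally_lipschitz_def
proof
  fix R
  have "compact (grad f ` cball 0 R)"
    by (intro compact_continuous_image continuous_on_subset[OF C1_grad(2)[OF assms]]) auto
  then obtain B where B: "0 < B" "\<And>x. x \<in> cball 0 R \<Longrightarrow> norm (grad f x) \<le> B"
    using compact_imp_bounded bounded_pos by (metis imageI)
  have "\<bar>f x - f y\<bar> \<le> B * norm (x - y)" if "norm x \<le> R" "norm y \<le> R" for x y
  proof -
    have "norm (f x - f y) \<le> B * norm (x - y)"
    proof (rule differentiable_bound[where S="cball 0 R" and f'="\<lambda>x h. grad f x \<bullet> h"])
      show "(f has_derivative (\<lambda>h. grad f z \<bullet> h)) (at z within cball 0 R)" for z
        using C1_grad(1)[OF assms] has_derivative_at_withinI by blast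
      show "onorm (\<lambda>h. grad f z \<bullet> h) \<le> B" if "z \<in> cball 0 R" for z
      proof (rule onorm_bound)
        show "norm (grad f z \<bullet> h) \<le> B * norm h" for h
          using Cauchy_Schwarz_ineq2[of "grad f z" h] B(2)[OF that]
          by (simp add: order_trans[OF _ mult_right_mono])
      qed (use B in simp)
    qed (use that in auto)
    then show ?thesis by simp
  qed
  then show "\<exists>L\<ge>0. \<forall>x y. norm x \<le> R \<longrightarrow> norm y \<le> R \<longrightarrow> \<bar>f x - f y\<bar> \<le> L * norm (x - y)"
    using B(1) by (intro exI[of _ B]) auto
qed

lemma locally_lipschitz_continuous:
  fixes f :: "'a::real_normed_vector \<Rightarrow> real"
  assumes "locally_lipschitz f"
  shows "continuous_on UNIV f"
proof -
  have "isCont f x" for x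
  proof -
    obtain L where L: "\<And>z y. norm z \<le> norm x + 1 \<Longrightarrow> norm y \<le> norm x + 1 \<Longrightarrow> \<bar>f z - f y\<bar> \<le> L * norm (z - y)" "L \<ge> 0"
      using assms unfolding locally_lipschitz_def by metis
    have "L-lipschitz_on (ball x 1) f"
    proof (rule lipschitz_onI)
      fix z y assume "z \<in> ball x 1" "y \<in> ball x 1"
      then have "norm z \<le> norm x + 1" "norm y \<le> norm x + 1"
        using norm_triangle_sub[of z x] norm_triangle_sub[of y x] by (auto simp: dist_norm norm_minus_commute)
      then show "dist (f z) (f y) \<le> L * dist z y" using L(1) by (simp add: dist_norm)
    qed (fact L(2))
    then have "continuous_on (ball x 1) f" by (rule lipschitz_on_continuous_on)
    then show ?thesis by (simp add: continuous_on_eq_continuous_at)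
  qed
  then show ?thesis by (simp add: continuous_on_eq_continuous_at)
qed

lemma locally_integrable_bounded:
  fixes f :: "real^'n \<Rightarrow> 'b::euclidean_space"
  assumes f: "f \<in> borel_measurable lebesgue"
    and bd: "\<And>R. \<exists>B. AE x in lebesgue. norm x \<le> R \<longrightarrow> norm (f x) \<le> B"
  shows "locally_integrable f"
  unfolding locally_integrable_def
proof (intro allI impI)
  fix K :: "(real^'n) set" assume K: "compact K"
  then obtain R where R: "\<And>x. x \<in> K \<Longrightarrow> norm x \<le> R" using compact_imp_bounded bounded_iff by metis
  obtain B where B: "AE x in lebesgue. norm x \<le> R \<longrightarrow> norm (f x) \<le> B" using bd by blast
  have Km: "K \<in> lmeasurable" using K by (rule lmeasurable_compact)
  show "f absolutely_integrable_on K"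
    unfolding set_integrable_def
  proof (rule Bochner_Integration.integrable_bound)
    show "integrable lebesgue (\<lambda>x. \<bar>B\<bar> * indicat_real K x)"
      using Km by (intro integrable_mult_right integrable_real_indicator) (auto simp: fmeasurable_def)
    show "(\<lambda>x. indicat_real K x *\<^sub>R f x) \<in> borel_measurable lebesgue"
      using Km f by (intro borel_measurable_scaleR borel_measurable_indicator) auto
    show "AE x in lebesgue. norm (indicat_real K x *\<^sub>R f x) \<le> norm (\<bar>B\<bar> * indicat_real K x)"
      using B R by (auto simp: indicator_def elim!: eventually_mono)
  qed
qed

text \<open>
  The difference quotient in the direction of the gradient itself tends to the norm of the gradient.
\<close>

lemma derivative_norm_le_lipschitz:
  fixes f :: "real^'n \<Rightarrow> real"
  assumes d: "(f has_derivative (\<lambda>h. g \<bullet> h)) (at x)" and S: "open S" "x \<in> S"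
    and L: "0 \<le> L" "\<And>y. y \<in> S \<Longrightarrow> \<bar>f y - f x\<bar> \<le> L * norm (y - x)"
  shows "norm g \<le> L"
proof (rule field_le_epsilon)
  fix e :: real assume "0 < e"
  then obtain d1 where d1: "d1 > 0" "\<And>y. norm (y - x) < d1 \<Longrightarrow>
      norm (f y - f x - g \<bullet> (y - x)) \<le> e * norm (y - x)"
    using d unfolding has_derivative_at_alt by blast
  obtain d2 where d2: "d2 > 0" "ball x d2 \<subseteq> S" using S openE by blast
  show "norm g \<le> L + e"
  proof (cases "g = 0")
    case False
    define t where "t = min d1 d2 / (2 * norm g)"
    have t: "0 < t" "t * norm g = min d1 d2 / 2" using False d1 d2 by (auto simp: t_def)
    let ?y = "x + t *\<^sub>R g"
    have n: "norm (?y - x) = t * norm g" using t by simp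
    then have lt: "norm (?y - x) < d1" "norm (?y - x) < d2" using t d1 d2 by auto
    then have "?y \<in> S" using d2 by (auto simp: dist_norm)
    have in_g: "g \<bullet> (?y - x) = t * norm g * norm g" by (simp add: power2_norm_eq_inner[symmetric] power2_eq_square)
    have "\<bar>f ?y - f x - g \<bullet> (?y - x)\<bar> \<le> e * (t * norm g)" "\<bar>f ?y - f x\<bar> \<le> L * (t * norm g)"
      using d1(2)[OF lt(1)] L(2)[OF \<open>?y \<in> S\<close>] unfolding n by simp_all
    then have "t * norm g * norm g \<le> L * (t * norm g) + e * (t * norm g)"
      unfolding in_g by linarith
    then have "(t * norm g) * norm g \<le> (t * norm g) * (L + e)" by (simp add: algebra_simps)
    moreover have "0 < t * norm g" using t False by simp
    ultimately show ?thesis by (simp only: mult_le_cancel_left_pos)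
  qed (use L \<open>0 < e\<close> in simp)
qed

lemma test_function_support:
  assumes "test_function \<phi>"
  obtains R where "0 < R" "\<And>x. R < norm x \<Longrightarrow> \<phi> x = 0"
proof -
  have "bounded (support_on UNIV \<phi>)"
    using assms bounded_subset[OF compact_imp_bounded closure_subset] by (auto simp: test_function_def)
  then obtain R where "0 < R" "\<forall>x\<in>support_on UNIV \<phi>. norm x \<le> R" by (auto simp: bounded_pos)
  then show ?thesis using that[of R] by (force simp: support_on_def)
qed

lemma difference_quotient_tendsto:
  fixes f :: "real^'n \<Rightarrow> real"
  assumes f: "(f has_derivative (\<lambda>h. g \<bullet> h)) (at x)" and h0: "h \<longlonglongrightarrow> 0" and h: "\<And>m. 0 < h m"
  shows "(\<lambda>m. (f (x + (c * h m) *\<^sub>R axis i 1) - f x) / h m) \<longlonglongrightarrow> c * (g $ i)"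
proof -
  let ?e = "axis i (1::real) :: real^'n"
  have "((\<lambda>t. f (x + (c * t) *\<^sub>R ?e)) has_derivative (\<lambda>t. g \<bullet> ((c * t) *\<^sub>R ?e))) (at 0)"
  proof (rule has_derivative_compose[where g=f and f="\<lambda>t. x + (c * t) *\<^sub>R ?e"])
    show "((\<lambda>t. x + (c * t) *\<^sub>R ?e) has_derivative (\<lambda>t. (c * t) *\<^sub>R ?e)) (at 0)"
      by (auto intro!: derivative_eq_intros)
    show "(f has_derivative (\<lambda>h. g \<bullet> h)) (at (x + (c * 0) *\<^sub>R ?e))" using f by simp
  qed
  moreover have "(\<lambda>t. g \<bullet> ((c * t) *\<^sub>R ?e)) = (*) (c * (g $ i))"
    by (auto simp: fun_eq_iff inner_axis)
  ultimately have "((\<lambda>t. f (x + (c * t) *\<^sub>R ?e)) has_real_derivative c * (g $ i)) (at 0)"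
    by (simp only: has_field_derivative_def)
  then have "((\<lambda>t. (f (x + (c * t) *\<^sub>R ?e) - f x) / t) \<longlongrightarrow> c * (g $ i)) (at 0)"
    by (simp add: has_field_derivative_iff)
  moreover have "filterlim h (at 0) sequentially"
    using h0 h by (auto simp: filterlim_at less_imp_neq[symmetric] intro!: always_eventually)
  ultimately show ?thesis by (rule filterlim_compose)
qed

lemma continuous_bounded_cball:
  fixes f :: "real^'n \<Rightarrow> real"
  assumes "continuous_on UNIV f"
  obtains B where "0 \<le> B" "\<And>x. norm x \<le> R \<Longrightarrow> \<bar>f x\<bar> \<le> B"
proof -
  have "compact (f ` cball 0 R)" by (intro compact_continuous_image continuous_on_subset[OF assms]) auto
  then obtain B where B: "\<forall>y\<in>f ` cball 0 R. norm y \<le> B" using compact_imp_bounded bounded_iff by metis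
  show ?thesis
  proof (rule that[of "max 0 B"])
    fix x :: "real^'n" assume "norm x \<le> R"
    then have "\<bar>f x\<bar> \<le> B" using B by auto
    then show "\<bar>f x\<bar> \<le> max 0 B" by simp
  qed simp
qed

lemma continuous_measurable_lebesgue:
  fixes f :: "real^'n \<Rightarrow> 'b::euclidean_space"
  assumes "continuous_on UNIV f"
  shows "f \<in> borel_measurable lebesgue"
  using borel_measurable_continuous_onI[OF assms] by (intro measurable_completion) simp

text \<open>
  The Lipschitz bound dominates the difference quotients, so pointwise convergence almost everywhere
  passes to the integrals.
\<close>

lemma difference_quotient_integral_tendsto:
  fixes f g :: "real^'n \<Rightarrow> real"
  assumes f: "continuous_on UNIV f" and g: "locally_lipschitz g" and G: "G \<in> borel_measurable lebesgue"
    and der: "AE x in lebesgue. (g has_derivative (\<lambda>h. G x \<bullet> h)) (at x)"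
    and c: "\<bar>c\<bar> = 1" and h: "h \<longlonglongrightarrow> 0" "\<And>m. 0 < h m" "\<And>m. h m \<le> 1"
    and supp: "\<And>x t. R < norm x \<Longrightarrow> \<bar>t\<bar> \<le> 1 \<Longrightarrow> f x * (g (x + t *\<^sub>R axis i 1) - g x) = 0"
  shows "(\<lambda>m. LINT x|lebesgue. f x * ((g (x + (c * h m) *\<^sub>R axis i 1) - g x) / h m))
    \<longlonglongrightarrow> (LINT x|lebesgue. f x * (c * G x $ i))"
proof -
  let ?e = "axis i (1::real) :: real^'n"
  obtain B where B: "0 \<le> B" "\<And>x. norm x \<le> R \<Longrightarrow> \<bar>f x\<bar> \<le> B" using continuous_bounded_cball[OF f, of R] by blast
  obtain L where L: "0 \<le> L" "\<And>x y. norm x \<le> R + 1 \<Longrightarrow> norm y \<le> R + 1 \<Longrightarrow> \<bar>g x - g y\<bar> \<le> L * norm (x - y)"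
    using g unfolding locally_lipschitz_def by metis
  have gc: "continuous_on UNIV g" using g by (rule locally_lipschitz_continuous)
  show ?thesis
  proof (rule integral_dominated_convergence[where w="\<lambda>x. (B * L) * indicat_real (cball 0 R) x"])
    have "(\<lambda>x. G x \<bullet> ?e) \<in> borel_measurable lebesgue" using G by (intro borel_measurable_inner) auto
    then have "(\<lambda>x. G x $ i) \<in> borel_measurable lebesgue" by (simp add: inner_axis)
    then show "(\<lambda>x. f x * (c * G x $ i)) \<in> borel_measurable lebesgue"
      using continuous_measurable_lebesgue[OF f] by (intro borel_measurable_times) auto
    show "(\<lambda>x. f x * ((g (x + (c * h m) *\<^sub>R ?e) - g x) / h m)) \<in> borel_measurable lebesgue" for m
      using h(2)[of m]
      by (intro continuous_measurable_lebesgue continuous_intros f gc continuous_on_compose2[OF gc]) auto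
    show "AE x in lebesgue. (\<lambda>m. f x * ((g (x + (c * h m) *\<^sub>R ?e) - g x) / h m)) \<longlonglongrightarrow> f x * (c * G x $ i)"
      using der by eventually_elim (intro tendsto_mult_left difference_quotient_tendsto h)
    show "integrable lebesgue (\<lambda>x. (B * L) * indicat_real (cball 0 R) (x :: real^'n))"
      using lmeasurable_cball[of "0 :: real^'n" R]
      by (intro integrable_mult_right integrable_real_indicator) (auto simp: fmeasurable_def)
    show "AE x in lebesgue. norm (f x * ((g (x + (c * h m) *\<^sub>R ?e) - g x) / h m)) \<le>
        B * L * indicat_real (cball 0 R) x" for m
    proof (intro AE_I2)
      fix x :: "real^'n"
      let ?y = "x + (c * h m) *\<^sub>R ?e"
      have ch: "\<bar>c * h m\<bar> = h m" using c h(2)[of m] by (simp add: abs_mult)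
      show "norm (f x * ((g ?y - g x) / h m)) \<le> B * L * indicat_real (cball 0 R) x"
      proof (cases "norm x \<le> R")
        case True
        have y: "norm (?y - x) = h m" using ch by simp
        then have "norm ?y \<le> R + 1" "norm x \<le> R + 1"
          using norm_triangle_sub[of ?y x] h(3)[of m] True by auto
        then have "\<bar>g ?y - g x\<bar> \<le> L * h m" using L(2)[of ?y x] by (simp only: y)
        then have "\<bar>(g ?y - g x) / h m\<bar> \<le> L" using h(2)[of m] by (simp add: divide_le_eq abs_divide)
        then have "\<bar>f x\<bar> * \<bar>(g ?y - g x) / h m\<bar> \<le> B * L" using B True by (intro mult_mono) auto
        then show ?thesis using True by (simp add: abs_mult)
      next
        case False
        then have "f x * (g ?y - g x) = 0" using supp[of x "c * h m"] ch h(3)[of m] by simp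
        then have "f x * ((g ?y - g x) / h m) = 0" by simp
        then show ?thesis using False by (simp only: norm_zero) simp
      qed
    qed
  qed
qed

text \<open>
  Integration by parts holds exactly for difference quotients, by translation invariance of Lebesgue
  measure; both sides converge as the step tends to \<open>0\<close>.
\<close>

lemma locally_lipschitz_has_weak_gradient:
  fixes w :: "real^'n \<Rightarrow> real"
  assumes w: "locally_lipschitz w" and G: "G \<in> borel_measurable lebesgue"
    and der: "AE x in lebesgue. (w has_derivative (\<lambda>h. G x \<bullet> h)) (at x)"
  shows "has_weak_gradient w G"
  unfolding has_weak_gradient_def
proof (intro conjI allI impI)
  have lip: "\<exists>L\<ge>0. \<forall>x y. norm x \<le> R \<longrightarrow> norm y \<le> R \<longrightarrow> \<bar>w x - w y\<bar> \<le> L * norm (x - y)" for R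
    using w by (simp add: locally_lipschitz_def)
  have wc: "continuous_on UNIV w" using w by (rule locally_lipschitz_continuous)
  show "locally_integrable w"
  proof (intro locally_integrable_bounded continuous_measurable_lebesgue wc)
    fix R
    obtain B where "\<And>x. norm x \<le> R \<Longrightarrow> \<bar>w x\<bar> \<le> B" using continuous_bounded_cball[OF wc, of R] by blast
    then show "\<exists>B. AE x in lebesgue. norm x \<le> R \<longrightarrow> norm (w x) \<le> B" by (intro exI[of _ B] AE_I2) simp
  qed
  have Gbd: "\<exists>B. AE x in lebesgue. norm x \<le> R \<longrightarrow> norm (G x) \<le> B" for R
  proof -
    obtain L where L: "0 \<le> L" "\<And>x y. norm x \<le> R + 1 \<Longrightarrow> norm y \<le> R + 1 \<Longrightarrow> \<bar>w x - w y\<bar> \<le> L * norm (x - y)"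
      using lip by metis
    have "AE x in lebesgue. norm x \<le> R \<longrightarrow> norm (G x) \<le> L"
      using der
    proof eventually_elim
      case (elim x)
      show ?case
      proof
        assume x: "norm x \<le> R"
        show "norm (G x) \<le> L"
        proof (rule derivative_norm_le_lipschitz[OF elim])
          show "\<bar>w y - w x\<bar> \<le> L * norm (y - x)" if "y \<in> ball x 1" for y
            using that x norm_triangle_sub[of y x] by (intro L(2)) (auto simp: dist_norm norm_minus_commute)
        qed (use L in auto)
      qed
    qed
    then show ?thesis by blast
  qed
  show "locally_integrable G" by (intro locally_integrable_bounded G Gbd)
  fix \<phi> :: "real^'n \<Rightarrow> real" and i :: 'n
  assume phi: "test_function \<phi>"
  obtain R where R: "0 < R" "\<And>x. R < norm x \<Longrightarrow> \<phi> x = 0" using test_function_support[OF phi] by blast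
  have phi1: "C_k 1 \<phi>" using phi unfolding test_function_def by blast
  have pl: "locally_lipschitz \<phi>" using C1_locally_lipschitz[OF phi1] .
  have pc: "continuous_on UNIV \<phi>" using pl by (rule locally_lipschitz_continuous)
  let ?e = "axis i (1::real) :: real^'n"
  define h where "h m = 1 / real (Suc m)" for m
  have h: "0 < h m" "h m \<le> 1" for m by (auto simp: h_def)
  have h0: "h \<longlonglongrightarrow> 0" unfolding h_def using LIMSEQ_inverse_real_of_nat by (simp add: inverse_eq_divide)
  have shift_out: "R < norm (x + t *\<^sub>R ?e)" if "R + 1 < norm x" "\<bar>t\<bar> \<le> 1" for x t
  proof -
    have "norm x \<le> norm (x + t *\<^sub>R ?e) + norm (t *\<^sub>R ?e)"
      using norm_triangle_ineq4[of "x + t *\<^sub>R ?e" "t *\<^sub>R ?e"] by simp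
    then show ?thesis using that by simp
  qed
  have "(\<lambda>m. LINT x|lebesgue. w x * ((\<phi> (x + (1 * h m) *\<^sub>R ?e) - \<phi> x) / h m))
      \<longlonglongrightarrow> (LINT x|lebesgue. w x * (1 * grad \<phi> x $ i))"
  proof (rule difference_quotient_integral_tendsto[OF wc pl _ _ _ h0 h, where R="R + 1"])
    show "grad \<phi> \<in> borel_measurable lebesgue" by (rule continuous_measurable_lebesgue[OF C1_grad(2)[OF phi1]])
    show "w x * (\<phi> (x + t *\<^sub>R ?e) - \<phi> x) = 0" if "R + 1 < norm x" "\<bar>t\<bar> \<le> 1" for x t
      using shift_out[OF that] R(2) that(1) by simp
  qed (use C1_grad(1)[OF phi1] in simp_all)
  then have A: "(\<lambda>m. LINT x|lebesgue. w x * ((\<phi> (x + (1 * h m) *\<^sub>R ?e) - \<phi> x) / h m))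
      \<longlonglongrightarrow> (LINT x|lebesgue. w x * partial i \<phi> x)"
    by (simp add: grad_def)
  have Bc: "(\<lambda>m. LINT x|lebesgue. \<phi> x * ((w (x + (- 1 * h m) *\<^sub>R ?e) - w x) / h m))
      \<longlonglongrightarrow> (LINT x|lebesgue. \<phi> x * (- 1 * G x $ i))"
    by (rule difference_quotient_integral_tendsto[OF pc w G der _ h0 h, where R="R + 1"]) (use R in simp_all)
  have supp_int: "integrable lborel f" if "continuous_on UNIV f" "\<And>x. R + 1 < norm x \<Longrightarrow> f x = 0"
    for f :: "real^'n \<Rightarrow> real"
  proof -
    have "integrable lborel (\<lambda>x. indicator (cball 0 (R + 1)) x *\<^sub>R f x)"
      by (intro borel_integrable_compact continuous_on_subset[OF that(1)]) auto
    moreover have "(\<lambda>x. indicator (cball 0 (R + 1)) x *\<^sub>R f x) = f"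
      using that(2) by (auto simp: fun_eq_iff indicator_def)
    ultimately show ?thesis by simp
  qed
  have parts: "(LINT x|lebesgue. w x * ((\<phi> (x + (1 * h m) *\<^sub>R ?e) - \<phi> x) / h m)) =
      (LINT x|lebesgue. \<phi> x * ((w (x + (- 1 * h m) *\<^sub>R ?e) - w x) / h m))" for m
  proof -
    let ?c = "h m *\<^sub>R ?e"
    have c1: "continuous_on UNIV (\<lambda>x. w x * \<phi> (x + ?c))" "continuous_on UNIV (\<lambda>x. w (x - ?c) * \<phi> x)"
      "continuous_on UNIV (\<lambda>x. w x * \<phi> x)"
      by (intro continuous_intros wc pc continuous_on_compose2[OF wc] continuous_on_compose2[OF pc]; simp)+
    have i1: "integrable lborel (\<lambda>x. w x * \<phi> (x + ?c))"
      using shift_out[of _ "h m"] R(2) h[of m] by (intro supp_int[OF c1(1)]) simp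
    have i2: "integrable lborel (\<lambda>x. w (x - ?c) * \<phi> x)" "integrable lborel (\<lambda>x. w x * \<phi> x)"
      using R by (auto intro!: supp_int c1)
    have "(LINT x|lborel. w x * \<phi> (x + ?c)) = (LINT x|distr lborel borel ((+) (- ?c)). w x * \<phi> (x + ?c))"
      by (simp add: lborel_distr_plus)
    also have "\<dots> = (LINT x|lborel. w (x - ?c) * \<phi> x)"
      by (subst integral_distr) (use borel_measurable_continuous_onI[OF c1(1)] in \<open>auto simp: algebra_simps\<close>)
    finally have shift: "(LINT x|lborel. w x * \<phi> (x + ?c)) = (LINT x|lborel. w (x - ?c) * \<phi> x)" .
    have "(LINT x|lebesgue. w x * ((\<phi> (x + (1 * h m) *\<^sub>R ?e) - \<phi> x) / h m)) =
        (LINT x|lborel. (w x * \<phi> (x + ?c) - w x * \<phi> x) / h m)"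
      by (subst integral_completion) (auto intro!: borel_measurable_continuous_onI continuous_intros wc pc
        continuous_on_compose2[OF wc] continuous_on_compose2[OF pc] Bochner_Integration.integral_cong
        simp: algebra_simps h(1) less_imp_neq[OF h(1), symmetric])
    also have "\<dots> = (LINT x|lborel. (w (x - ?c) * \<phi> x - w x * \<phi> x) / h m)"
      using i1 i2 shift by (simp add: Bochner_Integration.integral_diff)
    also have "\<dots> = (LINT x|lebesgue. \<phi> x * ((w (x + (- 1 * h m) *\<^sub>R ?e) - w x) / h m))"
      by (subst integral_completion) (auto intro!: borel_measurable_continuous_onI continuous_intros wc pc
        continuous_on_compose2[OF wc] continuous_on_compose2[OF pc] Bochner_Integration.integral_cong
        simp: algebra_simps h(1) less_imp_neq[OF h(1), symmetric])
    finally show ?thesis .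
  qed
  have "(LINT x|lebesgue. w x * partial i \<phi> x) = (LINT x|lebesgue. \<phi> x * (- 1 * G x $ i))"
    by (rule LIMSEQ_unique[OF A[unfolded parts] Bc])
  then show "(LINT x|lebesgue. w x * partial i \<phi> x) = - (LINT x|lebesgue. G x $ i * \<phi> x)"
    by (simp add: mult.commute)
qed

section \<open>Smooth bumps and uniqueness of weak gradients\<close>

text \<open>
  The functions \<open>exp (- c / t) / t ^ m\<close>, continued by \<open>0\<close>; the powers in the denominator arise from
  differentiating the case \<open>m = 0\<close>.
\<close>

definition smooth_kernel :: "real \<Rightarrow> nat \<Rightarrow> real \<Rightarrow> real" where
  "smooth_kernel c m t = (if t \<le> 0 then 0 else exp (- c / t) / t ^ m)"

lemma smooth_kernel_tendsto_0:
  assumes "0 < c"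
  shows "(smooth_kernel c m \<longlongrightarrow> 0) (at 0)"
proof -
  have "((\<lambda>y. (1 / c) ^ m * ((c * y) ^ m / exp (c * y))) \<longlongrightarrow> (1 / c) ^ m * 0) at_top"
    by (intro tendsto_mult_left filterlim_compose[OF tendsto_power_div_exp_0]
        filterlim_tendsto_pos_mult_at_top[OF tendsto_const assms] filterlim_ident)
  then have "((\<lambda>t. (1 / c) ^ m * ((c * inverse t) ^ m / exp (c * inverse t))) \<longlongrightarrow> 0) (at_right 0)"
    using filterlim_compose[OF _ filterlim_inverse_at_top_right] by fastforce
  moreover have "eventually (\<lambda>t. (1 / c) ^ m * ((c * inverse t) ^ m / exp (c * inverse t)) = smooth_kernel c m t)
      (at_right 0)"
    using assms by (auto simp: eventually_at_filter smooth_kernel_def exp_minus field_simps power_mult_distrib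
        intro!: always_eventually)
  ultimately have r: "(smooth_kernel c m \<longlongrightarrow> 0) (at_right 0)" by (rule Lim_transform_eventually)
  have "eventually (\<lambda>t. 0 = smooth_kernel c m t) (at_left 0)"
    by (auto simp: eventually_at_filter smooth_kernel_def intro!: always_eventually)
  then have "(smooth_kernel c m \<longlongrightarrow> 0) (at_left 0)" by (rule Lim_transform_eventually[OF tendsto_const])
  then show ?thesis using r by (simp add: filterlim_at_split)
qed

lemma smooth_kernel_deriv:
  assumes c: "0 < c"
  shows "(smooth_kernel c m has_real_derivative
     c * smooth_kernel c (m + 2) t - real m * smooth_kernel c (m + 1) t) (at t)"
proof -
  consider "t < 0" | "t = 0" | "0 < t" by linarith
  then show ?thesis
  proof cases
    case 1
    have "(smooth_kernel c m has_real_derivative 0) (at t)"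
      by (rule has_field_derivative_transform_within_open[OF DERIV_const[of 0], of "{..<0}"])
        (use 1 in \<open>auto simp: smooth_kernel_def\<close>)
    then show ?thesis using 1 by (simp add: smooth_kernel_def)
  next
    case 2
    have "((\<lambda>y. (smooth_kernel c m y - smooth_kernel c m 0) / (y - 0)) \<longlongrightarrow> 0) (at 0)"
      by (rule Lim_transform_eventually[OF smooth_kernel_tendsto_0[OF c, of "m + 1"]])
        (auto simp: eventually_at_filter smooth_kernel_def intro!: always_eventually)
    then show ?thesis using 2 by (simp add: has_field_derivative_iff) (simp add: smooth_kernel_def)
  next
    case 3
    have "((\<lambda>t. exp (- c / t) * inverse (t ^ m)) has_real_derivative
        (exp (- c / t) * (c / t\<^sup>2)) * inverse (t ^ m) + exp (- c / t) * (- (real m * t ^ (m - 1)) / (t ^ m)\<^sup>2)) (at t)"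
      using 3 by (auto intro!: derivative_eq_intros simp: power2_eq_square divide_inverse)
    moreover have "(exp (- c / t) * (c / t\<^sup>2)) * inverse (t ^ m) + exp (- c / t) * (- (real m * t ^ (m - 1)) / (t ^ m)\<^sup>2)
        = c * smooth_kernel c (m + 2) t - real m * smooth_kernel c (m + 1) t"
      using 3 by (cases m) (auto simp: smooth_kernel_def field_simps power2_eq_square power_add)
    ultimately have "((\<lambda>t. exp (- c / t) * inverse (t ^ m)) has_real_derivative
        c * smooth_kernel c (m + 2) t - real m * smooth_kernel c (m + 1) t) (at t)" by simp
    then show ?thesis
      by (rule has_field_derivative_transform_within_open[where S="{0<..}"])
        (use 3 in \<open>auto simp: smooth_kernel_def divide_inverse\<close>)
  qed
qed

text \<open>
  A set of functions that contains the bumps and is closed under differentiation; this closure is all that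
  smoothness of every order amounts to.
\<close>

inductive_set bump_algebra :: "(real \<Rightarrow> real) set" where
  base: "0 < c \<Longrightarrow> (\<lambda>t. poly P t * smooth_kernel c m (poly Q t)) \<in> bump_algebra"
| add: "f \<in> bump_algebra \<Longrightarrow> g \<in> bump_algebra \<Longrightarrow> (\<lambda>t. f t + g t) \<in> bump_algebra"

lemma bump_algebra_deriv:
  "f \<in> bump_algebra \<Longrightarrow> \<exists>f'\<in>bump_algebra. \<forall>t. (f has_real_derivative f' t) (at t)"
proof (induction rule: bump_algebra.induct)
  case (base c P m Q)
  let ?f' = "\<lambda>t. poly (pderiv P) t * smooth_kernel c m (poly Q t) +
    (poly (smult c (P * pderiv Q)) t * smooth_kernel c (m + 2) (poly Q t) +
     poly (smult (- real m) (P * pderiv Q)) t * smooth_kernel c (m + 1) (poly Q t))"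
  have "?f' \<in> bump_algebra" by (intro bump_algebra.intros base)
  moreover have "((\<lambda>t. poly P t * smooth_kernel c m (poly Q t)) has_real_derivative ?f' t) (at t)" for t
    by (rule derivative_eq_intros poly_DERIV DERIV_chain2[OF smooth_kernel_deriv[OF base]] refl)+
      (simp add: algebra_simps)
  ultimately show ?case by (intro bexI[of _ ?f'] allI)
next
  case (add f g)
  then obtain f' g' where "f' \<in> bump_algebra" "g' \<in> bump_algebra"
    "\<And>t. (f has_real_derivative f' t) (at t)" "\<And>t. (g has_real_derivative g' t) (at t)" by blast
  then show ?case by (intro bexI[of _ "\<lambda>t. f' t + g' t"]) (auto intro: bump_algebra.add DERIV_add)
qed

text \<open>
  A partial derivative of a product of one-variable functions replaces a single factor by its derivative,
  which leads to a product of the same kind.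
\<close>

lemma bump_product_smooth:
  fixes g :: "'n::finite \<Rightarrow> real \<Rightarrow> real"
  assumes "\<And>i. g i \<in> bump_algebra"
  shows "C_k m (\<lambda>x::real^'n. \<Prod>i\<in>UNIV. g i (x $ i))"
  using assms
proof (induction m arbitrary: g)
  case (0 g)
  have "continuous_on UNIV (g i)" for i
    using bump_algebra_deriv[OF 0[of i]] DERIV_isCont continuous_at_imp_continuous_on by blast
  then have "continuous_on UNIV (\<lambda>x::real^'n. g i (x $ i))" for i
    by (rule continuous_on_compose2) (auto intro: continuous_intros)
  then show ?case by (simp add: continuous_on_prod)
next
  case (Suc m g)
  obtain g' where g': "\<And>i. g' i \<in> bump_algebra" "\<And>i t. (g i has_real_derivative g' i t) (at t)"
    using bump_algebra_deriv[OF Suc.prems] by metis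
  have der: "((\<lambda>x::real^'n. \<Prod>i\<in>UNIV. g i (x $ i)) has_derivative
      (\<lambda>h. \<Sum>i\<in>UNIV. (h $ i * g' i (x $ i)) * (\<Prod>j\<in>UNIV - {i}. g j (x $ j)))) (at x)" for x
  proof (rule has_derivative_prod)
    fix i
    have "((\<lambda>x::real^'n. x $ i) has_derivative (\<lambda>h. h $ i)) (at x)"
      by (intro bounded_linear_imp_has_derivative bounded_linear_vec_nth)
    from has_derivative_compose[OF this g'(2)[of i "x $ i", unfolded has_field_derivative_def]]
    show "((\<lambda>x::real^'n. g i (x $ i)) has_derivative (\<lambda>h. h $ i * g' i (x $ i))) (at x)"
      by (simp add: mult.commute)
  qed
  have partial_eq: "partial j (\<lambda>x::real^'n. \<Prod>i\<in>UNIV. g i (x $ i)) = (\<lambda>x. \<Prod>i\<in>UNIV. (g(j := g' j)) i (x $ i))" for j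
  proof
    fix x :: "real^'n"
    have "partial j (\<lambda>x::real^'n. \<Prod>i\<in>UNIV. g i (x $ i)) x =
        (\<Sum>i\<in>UNIV. (axis j 1 $ i * g' i (x $ i)) * (\<Prod>j\<in>UNIV - {i}. g j (x $ j)))"
      unfolding partial_def frechet_derivative_at[OF der, symmetric] ..
    also have "\<dots> = g' j (x $ j) * (\<Prod>i\<in>UNIV - {j}. g i (x $ i))"
      by (subst sum.remove[of _ j]) (auto simp: axis_def intro!: sum.neutral)
    also have "\<dots> = (\<Prod>i\<in>UNIV. (g(j := g' j)) i (x $ i))"
      by (subst (2) prod.remove[of _ j]) (auto intro!: prod.cong)
    finally show "partial j (\<lambda>x::real^'n. \<Prod>i\<in>UNIV. g i (x $ i)) x = (\<Prod>i\<in>UNIV. (g(j := g' j)) i (x $ i))" .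
  qed
  have "C_k m (\<lambda>x::real^'n. \<Prod>i\<in>UNIV. (g(j := g' j)) i (x $ i))" for j
    by (rule Suc.IH) (use Suc.prems g' in auto)
  moreover have "(\<lambda>x::real^'n. \<Prod>i\<in>UNIV. g i (x $ i)) differentiable_on UNIV"
    using der by (auto simp: differentiable_on_def differentiable_def)
  ultimately show ?case by (simp add: partial_eq)
qed

text \<open>
  For \<open>c\<close> tending to \<open>0\<close> these functions increase to the indicator of the box.
\<close>

definition box_bump :: "real \<Rightarrow> real^'n \<Rightarrow> real^'n \<Rightarrow> real^'n \<Rightarrow> real" where
  "box_bump c a b x = (\<Prod>i\<in>UNIV. smooth_kernel c 0 ((x $ i - a $ i) * (b $ i - x $ i)))"

lemma box_bump_outside:
  assumes "\<And>i. a $ i < b $ i" "x \<notin> box a b"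
  shows "box_bump c a b x = 0"
proof -
  obtain i where "x $ i \<le> a $ i \<or> b $ i \<le> x $ i" using assms(2) by (auto simp: mem_box_cart not_less)
  then have "(x $ i - a $ i) * (b $ i - x $ i) \<le> 0"
    using assms(1)[of i] by (auto simp: mult_le_0_iff)
  then show ?thesis unfolding box_bump_def smooth_kernel_def by (intro prod_zero) auto
qed

lemma box_bump_test_function:
  assumes "0 < c" "\<And>i. a $ i < b $ i"
  shows "test_function (box_bump c a b :: real^'n \<Rightarrow> real)"
  unfolding test_function_def
proof (intro conjI allI)
  fix m
  have "(\<lambda>t. smooth_kernel c 0 ((t - a $ i) * (b $ i - t))) \<in> bump_algebra" for i
    using bump_algebra.base[OF assms(1), of 1 0 "[:- a $ i, 1:] * [:b $ i, - 1:]"] by (simp add: algebra_simps)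
  then show "C_k m (box_bump c a b :: real^'n \<Rightarrow> real)"
    unfolding box_bump_def[abs_def] by (rule bump_product_smooth)
  have "support_on UNIV (box_bump c a b) \<subseteq> cbox a b"
    using box_bump_outside[OF assms(2)] box_subset_cbox[of a b] by (force simp: support_on_def)
  then have "bounded (support_on UNIV (box_bump c a b))" using bounded_cbox bounded_subset by blast
  then show "compact (closure (support_on UNIV (box_bump c a b)))" by simp
qed

lemma box_bump_bounds:
  assumes "0 < c"
  shows "0 \<le> box_bump c a b x" "box_bump c a b x \<le> 1"
  using assms unfolding box_bump_def smooth_kernel_def
  by (auto intro!: prod_nonneg prod_le_1)

lemma box_bump_tendsto:
  assumes "\<And>i. a $ i < b $ i"
  shows "(\<lambda>n. box_bump (1 / real (Suc n)) a b x) \<longlonglongrightarrow> indicat_real (box a b) x"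
proof (cases "x \<in> box a b")
  case True
  have "(\<lambda>n. smooth_kernel (1 / real (Suc n)) 0 ((x $ i - a $ i) * (b $ i - x $ i))) \<longlonglongrightarrow> 1" for i
  proof -
    have pos: "0 < (x $ i - a $ i) * (b $ i - x $ i)" using True by (auto simp: mem_box_cart)
    have "(\<lambda>n. exp (- (inverse (real (Suc n))) / ((x $ i - a $ i) * (b $ i - x $ i)))) \<longlonglongrightarrow>
        exp (- 0 / ((x $ i - a $ i) * (b $ i - x $ i)))"
      using less_imp_neq[OF pos] by (intro tendsto_intros LIMSEQ_inverse_real_of_nat) (rule not_sym)
    then show ?thesis using pos by (simp add: smooth_kernel_def inverse_eq_divide)
  qed
  then have "(\<lambda>n. box_bump (1 / real (Suc n)) a b x) \<longlonglongrightarrow> (\<Prod>i\<in>(UNIV :: 'a set). 1)"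
    unfolding box_bump_def by (intro tendsto_prod)
  then show ?thesis using True by simp
next
  case False
  then show ?thesis using box_bump_outside[OF assms False] by simp
qed

text \<open>
  The positive and the negative part define measures that agree on boxes, hence everywhere.
\<close>

lemma AE_eq_0_of_box_integrals:
  fixes f :: "real^'n \<Rightarrow> real"
  assumes f: "f \<in> borel_measurable lebesgue"
    and int: "\<And>a b. integrable lebesgue (\<lambda>x. indicat_real (box a b) x * f x)"
    and zero: "\<And>a b. (LINT x|lebesgue. indicat_real (box a b) x * f x) = 0"
  shows "AE x in lebesgue. f x = 0"
proof -
  obtain g where g [measurable]: "g \<in> borel_measurable lborel" and fg: "AE x in lborel. f x = g x"
    using completion_ex_borel_measurable_real[OF f] by blast
  have fgL: "AE x in lebesgue. f x = g x" using fg by (rule AE_completion)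
  have int_g: "integrable lborel (\<lambda>x. indicat_real (box a b) x * g x)" for a b
  proof -
    have "integrable lebesgue (\<lambda>x. indicat_real (box a b) x * g x)"
      by (rule integrable_cong_AE_imp[OF int[of a b]]) (use fgL in \<open>auto intro: measurable_completion\<close>)
    then show ?thesis by (simp add: integrable_completion)
  qed
  have zero_g: "(LINT x|lborel. indicat_real (box a b) x * g x) = 0" for a b
  proof -
    have "(LINT x|lborel. indicat_real (box a b) x * g x) = (LINT x|lebesgue. indicat_real (box a b) x * g x)"
      by (rule integral_completion[symmetric]) measurable
    also have "\<dots> = (LINT x|lebesgue. indicat_real (box a b) x * f x)"
    proof (rule integral_cong_AE)
      show "(\<lambda>x. indicat_real (box a b) x * g x) \<in> borel_measurable lebesgue"
        by (intro measurable_completion) measurable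
      show "(\<lambda>x. indicat_real (box a b) x * f x) \<in> borel_measurable lebesgue"
        using int[of a b] by (rule borel_measurable_integrable)
    qed (use fgL in auto)
    finally show ?thesis using zero by simp
  qed
  let ?M = "density lborel (\<lambda>x. ennreal (g x))" and ?N = "density lborel (\<lambda>x. ennreal (- g x))"
  have box: "emeasure ?M (box a b) = emeasure ?N (box a b) \<and> emeasure ?M (box a b) < \<infinity>" for a b
  proof -
    let ?h = "\<lambda>x. indicat_real (box a b) x * g x"
    have M: "emeasure ?M (box a b) = (\<integral>\<^sup>+x. ennreal (?h x) \<partial>lborel)"
      by (subst emeasure_density) (auto intro!: nn_integral_cong simp: indicator_def)
    have N: "emeasure ?N (box a b) = (\<integral>\<^sup>+x. ennreal (- ?h x) \<partial>lborel)"
      by (subst emeasure_density) (auto intro!: nn_integral_cong simp: indicator_def)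
    have fin: "(\<integral>\<^sup>+x. ennreal (?h x) \<partial>lborel) \<noteq> \<infinity>" "(\<integral>\<^sup>+x. ennreal (- ?h x) \<partial>lborel) \<noteq> \<infinity>"
      using int_g[of a b] by (auto simp: real_integrable_def)
    have enn_eq: "enn2real (\<integral>\<^sup>+x. ennreal (?h x) \<partial>lborel) = enn2real (\<integral>\<^sup>+x. ennreal (- ?h x) \<partial>lborel)"
      using real_lebesgue_integral_def[OF int_g[of a b]] zero_g[of a b] by simp
    have recover: "ennreal (enn2real r) = r" if "r \<noteq> \<infinity>" for r
      using that by (intro ennreal_enn2real) (simp add: less_top)
    have "(\<integral>\<^sup>+x. ennreal (?h x) \<partial>lborel) = (\<integral>\<^sup>+x. ennreal (- ?h x) \<partial>lborel)"
      using arg_cong[OF enn_eq, of ennreal] unfolding recover[OF fin(1)] recover[OF fin(2)] .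
    then show ?thesis unfolding M N using fin(1) by (simp add: less_top)
  qed
  have "?M = ?N"
  proof (rule measure_eqI_generator_eq)
    let ?E = "range (\<lambda>(a, b). box a b :: (real^'n) set)"
    show "Int_stable ?E" by (auto simp: Int_stable_def box_Int_box)
    show "?E \<subseteq> Pow UNIV" "sets ?M = sigma_sets UNIV ?E" "sets ?N = sigma_sets UNIV ?E"
      by (simp_all add: borel_eq_box)
    let ?A = "\<lambda>n::nat. box (- (real n *\<^sub>R One)) (real n *\<^sub>R One) :: (real^'n) set"
    show "range ?A \<subseteq> ?E" "(\<Union>i. ?A i) = UNIV" unfolding UN_box_eq_UNIV by auto
    show "emeasure ?M (?A i) \<noteq> \<infinity>" for i using conjunct2[OF box[of "- (real i *\<^sub>R One)" "real i *\<^sub>R One"]] by simp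
    show "emeasure ?M X = emeasure ?N X" if "X \<in> ?E" for X using that box by auto
  qed
  then have "AE x in lborel. ennreal (g x) = ennreal (- g x)"
    by (intro sigma_finite_measure.density_unique[OF sigma_finite_lborel]) auto
  then have "AE x in lborel. g x = 0"
  proof eventually_elim
    case (elim x)
    then show ?case by (cases "0 \<le> g x") (auto simp: ennreal_neg ennreal_eq_0_iff)
  qed
  then have "AE x in lebesgue. g x = 0" by (rule AE_completion)
  with fgL show ?thesis by eventually_elim simp
qed

lemma locally_integrable_imp_measurable:
  fixes f :: "real^'n \<Rightarrow> 'b::euclidean_space"
  assumes "locally_integrable f"
  shows "f \<in> borel_measurable lebesgue"
proof (rule borel_measurable_LIMSEQ_metric)
  show "(\<lambda>x. indicat_real (cball 0 (real n)) x *\<^sub>R f x) \<in> borel_measurable lebesgue" for n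
    using assms compact_cball[of 0 "real n"] unfolding locally_integrable_def set_integrable_def
    by (intro borel_measurable_integrable) blast
  fix x :: "real^'n"
  obtain n0 where n0: "norm x \<le> real n0" using real_arch_simple by blast
  have "eventually (\<lambda>n. f x = indicat_real (cball 0 (real n)) x *\<^sub>R f x) sequentially"
    using eventually_ge_at_top[of n0] by eventually_elim (use n0 in auto)
  then show "(\<lambda>n. indicat_real (cball 0 (real n)) x *\<^sub>R f x) \<longlonglongrightarrow> f x"
    by (rule Lim_transform_eventually[OF tendsto_const])
qed

lemma locally_integrable_component:
  fixes f :: "real^'n \<Rightarrow> real^'n"
  assumes "locally_integrable f"
  shows "locally_integrable (\<lambda>x. f x $ i)"
  unfolding locally_integrable_def set_integrable_def
proof (intro allI impI)
  fix K :: "(real^'n) set" assume "compact K"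
  then have "integrable lebesgue (\<lambda>x. (indicat_real K x *\<^sub>R f x) \<bullet> axis i 1)"
    using assms unfolding locally_integrable_def set_integrable_def by (intro integrable_inner_left) blast
  then show "integrable lebesgue (\<lambda>x. indicat_real K x *\<^sub>R (f x $ i))" by (simp add: inner_axis)
qed

text \<open>
  Testing with bumps that converge to the indicator of a box shows that the difference of two weak
  gradients has integral \<open>0\<close> over every box.
\<close>

lemma weak_gradient_unique:
  fixes w :: "real^'n \<Rightarrow> real"
  assumes G: "has_weak_gradient w G" and H: "has_weak_gradient w H"
  shows "AE x in lebesgue. G x = H x"
proof -
  have comp: "AE x in lebesgue. G x $ i - H x $ i = 0" for i
  proof (rule AE_eq_0_of_box_integrals)
    have li: "locally_integrable (\<lambda>x. G x $ i)" "locally_integrable (\<lambda>x. H x $ i)"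
      using G H locally_integrable_component by (auto simp: has_weak_gradient_def)
    note [measurable] = li[THEN locally_integrable_imp_measurable]
    show "(\<lambda>x. G x $ i - H x $ i) \<in> borel_measurable lebesgue" by measurable
    have int_test: "integrable lebesgue (\<lambda>x. F x * \<psi> x)"
      if F: "locally_integrable F" and psi: "\<psi> \<in> borel_measurable lebesgue" "\<And>x. \<bar>\<psi> x\<bar> \<le> 1" "\<And>x. x \<notin> cbox a b \<Longrightarrow> \<psi> x = 0"
      for F :: "real^'n \<Rightarrow> real" and \<psi> :: "real^'n \<Rightarrow> real" and a b :: "real^'n"
    proof (rule Bochner_Integration.integrable_bound)
      show "integrable lebesgue (\<lambda>x. indicat_real (cbox a b) x *\<^sub>R F x)"
        using F compact_cbox[of a b] unfolding locally_integrable_def set_integrable_def by blast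
      show "(\<lambda>x. F x * \<psi> x) \<in> borel_measurable lebesgue"
        using psi(1) locally_integrable_imp_measurable[OF F] by (rule borel_measurable_times[rotated])
      show "AE x in lebesgue. norm (F x * \<psi> x) \<le> norm (indicat_real (cbox a b) x *\<^sub>R F x)"
      proof (rule AE_I2)
        fix x
        show "norm (F x * \<psi> x) \<le> norm (indicat_real (cbox a b) x *\<^sub>R F x)"
          using psi(2)[of x] psi(3)[of x] by (cases "x \<in> cbox a b") (auto simp: abs_mult mult_left_le)
      qed
    qed
    have int_box: "integrable lebesgue (\<lambda>x. F x * indicat_real (box a b) x)" if "locally_integrable F"
      for F :: "real^'n \<Rightarrow> real" and a b :: "real^'n"
    proof (rule int_test[OF that, of _ a b])
      show "indicat_real (box a b) \<in> borel_measurable lebesgue"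
        by (intro borel_measurable_indicator fmeasurableD lmeasurable_box)
    qed (use box_subset_cbox[of a b] in \<open>auto simp: indicator_def\<close>)
    show "integrable lebesgue (\<lambda>x. indicat_real (box a b) x * (G x $ i - H x $ i))" for a b
      using int_box[OF li(1), of a b] int_box[OF li(2), of a b]
      by (simp add: right_diff_distrib mult.commute)
    show "(LINT x|lebesgue. indicat_real (box a b) x * (G x $ i - H x $ i)) = 0" for a b
    proof (cases "\<forall>j. a $ j < b $ j")
      case False
      then have "x \<notin> box a b" for x by (metis less_trans mem_box_cart(1))
      then have "box a b = {}" by blast
      then show ?thesis by simp
    next
      case True
      define \<psi> where "\<psi> n = box_bump (1 / real (Suc n)) a b" for n
      have test: "test_function (\<psi> n)" for n
        unfolding \<psi>_def using True by (intro box_bump_test_function) auto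
      have m: "\<psi> n \<in> borel_measurable lebesgue" for n
      proof -
        have "C_k 0 (\<psi> n)" using test[of n] unfolding test_function_def by blast
        then have "continuous_on UNIV (\<psi> n)" by simp
        from borel_measurable_continuous_onI[OF this] show ?thesis by (intro measurable_completion) simp
      qed
      have b: "\<bar>\<psi> n x\<bar> \<le> 1" for n x
        using box_bump_bounds[of "1 / real (Suc n)" a b x] by (simp add: \<psi>_def)
      have out: "\<psi> n x = 0" if "x \<notin> cbox a b" for n x
        using that box_bump_outside[of a b x] True box_subset_cbox[of a b] by (auto simp: \<psi>_def)
      have i: "integrable lebesgue (\<lambda>x. G x $ i * \<psi> n x)" "integrable lebesgue (\<lambda>x. H x $ i * \<psi> n x)" for n
        by (intro int_test[OF _ m b out] li; assumption)+
      have "(LINT x|lebesgue. G x $ i * \<psi> n x) = (LINT x|lebesgue. H x $ i * \<psi> n x)" for n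
      proof -
        have "(LINT x|lebesgue. w x * partial i (\<psi> n) x) = - (LINT x|lebesgue. G x $ i * \<psi> n x)"
          using G test[of n] unfolding has_weak_gradient_def by blast
        moreover have "(LINT x|lebesgue. w x * partial i (\<psi> n) x) = - (LINT x|lebesgue. H x $ i * \<psi> n x)"
          using H test[of n] unfolding has_weak_gradient_def by blast
        ultimately show ?thesis by linarith
      qed
      then have z: "(LINT x|lebesgue. \<psi> n x * (G x $ i - H x $ i)) = 0" for n
        using i[of n] by (simp add: right_diff_distrib mult.commute)
      have "(\<lambda>n. LINT x|lebesgue. \<psi> n x * (G x $ i - H x $ i)) \<longlonglongrightarrow>
          (LINT x|lebesgue. indicat_real (box a b) x * (G x $ i - H x $ i))"
      proof (rule integral_dominated_convergence[where w="\<lambda>x. \<bar>indicat_real (cbox a b) x *\<^sub>R (G x $ i)\<bar> +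
            \<bar>indicat_real (cbox a b) x *\<^sub>R (H x $ i)\<bar>"])
        show "integrable lebesgue (\<lambda>x. \<bar>indicat_real (cbox a b) x *\<^sub>R (G x $ i)\<bar> +
            \<bar>indicat_real (cbox a b) x *\<^sub>R (H x $ i)\<bar>)"
          using li compact_cbox[of a b] unfolding locally_integrable_def set_integrable_def
          by (intro Bochner_Integration.integrable_add integrable_abs) blast+
        show "AE x in lebesgue. (\<lambda>n. \<psi> n x * (G x $ i - H x $ i)) \<longlonglongrightarrow> indicat_real (box a b) x * (G x $ i - H x $ i)"
          unfolding \<psi>_def using True by (intro AE_I2 tendsto_mult_right box_bump_tendsto) auto
        show "AE x in lebesgue. norm (\<psi> n x * (G x $ i - H x $ i)) \<le>
            \<bar>indicat_real (cbox a b) x *\<^sub>R (G x $ i)\<bar> + \<bar>indicat_real (cbox a b) x *\<^sub>R (H x $ i)\<bar>" for n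
        proof (rule AE_I2)
          fix x
          show "norm (\<psi> n x * (G x $ i - H x $ i)) \<le>
            \<bar>indicat_real (cbox a b) x *\<^sub>R (G x $ i)\<bar> + \<bar>indicat_real (cbox a b) x *\<^sub>R (H x $ i)\<bar>"
          proof (cases "x \<in> cbox a b")
            case True
            have "\<bar>\<psi> n x\<bar> * \<bar>G x $ i - H x $ i\<bar> \<le> 1 * (\<bar>G x $ i\<bar> + \<bar>H x $ i\<bar>)"
              using b by (intro mult_mono) auto
            then show ?thesis using True by (simp add: abs_mult)
          qed (simp add: out)
        qed
        show "(\<lambda>x. \<psi> n x * (G x $ i - H x $ i)) \<in> borel_measurable lebesgue" for n
          using m[of n] li[THEN locally_integrable_imp_measurable] by (intro borel_measurable_times borel_measurable_diff)
        show "(\<lambda>x. indicat_real (box a b) x * (G x $ i - H x $ i)) \<in> borel_measurable lebesgue"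
          using li[THEN locally_integrable_imp_measurable]
          by (intro borel_measurable_times borel_measurable_diff borel_measurable_indicator fmeasurableD lmeasurable_box)
      qed
      then show ?thesis unfolding z by (rule LIMSEQ_unique[OF _ tendsto_const])
    qed
  qed
  have "AE x in lebesgue. \<forall>i. G x $ i - H x $ i = 0" using comp by (simp add: AE_all_countable)
  then show ?thesis by eventually_elim (simp add: vec_eq_iff)
qed

section \<open>Degenerate pairs are negligible\<close>

text \<open>
  A copy of a finite type that carries a well-order, obtained from some enumeration. It serves to apply
  Sard's theorem, which is formulated for ordered index types, to arbitrary finite ones.
\<close>

typedef 'a enumerated = "UNIV :: 'a set" morphisms index_of Enumerated ..

instance enumerated :: (finite) finite
proof
  have "(UNIV :: 'a enumerated set) = range Enumerated" by (metis index_of_inverse surjI)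
  then show "finite (UNIV :: 'a enumerated set)" by (metis finite finite_imageI)
qed

instantiation enumerated :: (finite) wellorder
begin

definition less_eq_enumerated :: "'a enumerated \<Rightarrow> 'a enumerated \<Rightarrow> bool" where
  "less_eq_enumerated x y \<longleftrightarrow> to_nat (index_of x) \<le> to_nat (index_of y)"

definition less_enumerated :: "'a enumerated \<Rightarrow> 'a enumerated \<Rightarrow> bool" where
  "less_enumerated x y \<longleftrightarrow> to_nat (index_of x) < to_nat (index_of y)"

instance
proof
  fix P :: "'a enumerated \<Rightarrow> bool" and a
  assume step: "\<And>x. (\<And>y. y < x \<Longrightarrow> P y) \<Longrightarrow> P x"
  show "P a"
    by (induction "to_nat (index_of a)" arbitrary: a rule: less_induct)
      (rule step, simp add: less_enumerated_def)
qed (auto simp: less_eq_enumerated_def less_enumerated_def index_of_inject)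

end

lemma Sard_finite_index:
  fixes f :: "real^'n \<Rightarrow> real^'n"
  assumes der: "\<And>x. x \<in> S \<Longrightarrow> (f has_derivative f' x) (at x within S)"
    and crit: "\<And>x. x \<in> S \<Longrightarrow> \<exists>h. h \<noteq> 0 \<and> f' x h = 0"
  shows "negligible (f ` S)"
proof -
  define J :: "real^'n \<Rightarrow> real^('n enumerated)" where "J x = (\<chi> i. x $ index_of i)" for x
  define K :: "real^('n enumerated) \<Rightarrow> real^'n" where "K y = (\<chi> i. y $ Enumerated i)" for y
  have KJ: "K (J x) = x" for x by (simp add: K_def J_def Enumerated_inverse)
  have JK: "J (K y) = y" for y by (simp add: K_def J_def index_of_inverse)
  have linJ: "linear J" by (intro linearI) (simp_all add: J_def vec_eq_iff)
  have linK: "linear K" by (intro linearI) (simp_all add: K_def vec_eq_iff)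
  note bl = linJ[THEN linear_conv_bounded_linear[THEN iffD1]] linK[THEN linear_conv_bounded_linear[THEN iffD1]]
  have card: "CARD('n enumerated) = CARD('n)"
    by (rule bij_betw_same_card[of index_of]) (metis bij_betw_def index_of_inject inj_onI Enumerated_inverse surjI UNIV_I)
  have "negligible ((\<lambda>y. J (f (K y))) ` (J ` S))"
  proof (rule baby_Sard)
    fix y assume "y \<in> J ` S"
    then have Ky: "K y \<in> S" by (auto simp: KJ)
    have "(f has_derivative f' (K y)) (at (K y) within K ` J ` S)" using der[OF Ky] by (simp add: image_image KJ)
    from has_derivative_in_compose[OF bounded_linear_imp_has_derivative[OF bl(2)] this]
    have "((\<lambda>y. f (K y)) has_derivative (\<lambda>h. f' (K y) (K h))) (at y within J ` S)" .
    from bounded_linear.has_derivative[OF bl(1) this]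
    show d: "((\<lambda>y. J (f (K y))) has_derivative (\<lambda>h. J (f' (K y) (K h)))) (at y within J ` S)" .
    obtain h where h: "h \<noteq> 0" "f' (K y) h = 0" using crit[OF Ky] by blast
    have "J h \<noteq> 0" using h(1) KJ[of h] linear_0[OF linK] by metis
    moreover have "matrix (\<lambda>h. J (f' (K y) (K h))) *v J h = 0"
    proof -
      have "Vector_Spaces.linear (*s) (*s) (\<lambda>h. J (f' (K y) (K h)))"
        using has_derivative_linear[OF d] by (simp only: linear_matrix_vector_mul_eq)
      from matrix_works[OF this, of "J h"] show ?thesis using h(2) KJ[of h] linear_0[OF linJ] by simp
    qed
    ultimately have "\<not> inj ((*v) (matrix (\<lambda>h. J (f' (K y) (K h)))))"
      using injD[of "(*v) (matrix (\<lambda>h. J (f' (K y) (K h))))" "J h" 0] by fastforce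
    then show "rank (matrix (\<lambda>h. J (f' (K y) (K h)))) < CARD('n enumerated)"
      by (rule less_rank_noninjective[THEN iffD2])
  qed simp
  then have "negligible (K ` (\<lambda>y. J (f (K y))) ` (J ` S))"
    by (rule negligible_differentiable_image_negligible[rotated])
      (use card bl in \<open>auto intro!: bounded_linear_imp_differentiable_on\<close>)
  moreover have "K ` (\<lambda>y. J (f (K y))) ` (J ` S) = f ` S" by (simp add: image_image KJ)
  ultimately show ?thesis by simp
qed

text \<open>
  Implicit differentiation relative to a set \<open>S\<close> on which the implicit function is given, rather than on a
  neighbourhood; the last hypothesis stands in for strict monotonicity of \<open>f\<close> in its second argument.
\<close>

lemma implicit_has_derivative:
  fixes f :: "'a::real_normed_vector \<times> real \<Rightarrow> real"
  assumes der: "(f has_derivative F) (at (z0, g z0))" and nz: "F (0, 1) \<noteq> 0"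
    and zero: "\<And>z. z \<in> S \<Longrightarrow> f (z, g z) = 0" and z0: "z0 \<in> S"
    and c: "0 < c" "\<And>z. z \<in> S \<Longrightarrow> c * \<bar>g z - g z0\<bar> \<le> \<bar>f (z, g z0)\<bar>"
  shows "(g has_derivative (\<lambda>h. - F (h, 0) / F (0, 1))) (at z0 within S)"
proof -
  interpret F: bounded_linear F using der by (rule has_derivative_bounded_linear)
  have split: "F (h, t) = F (h, 0) + t * F (0, 1)" for h t
    using F.add[of "(h, 0)" "(0, t)"] F.scaleR[of t "(0, 1)"] by simp
  obtain B where B: "0 < B" "\<And>q. norm (F q) \<le> norm q * B" using F.pos_bounded by blast
  obtain d1 where d1: "0 < d1" "\<And>q. norm (q - (z0, g z0)) < d1 \<Longrightarrow>
      norm (f q - f (z0, g z0) - F (q - (z0, g z0))) \<le> 1 * norm (q - (z0, g z0))"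
    using der unfolding has_derivative_at_alt by (metis zero_less_one)
  define C where "C = (B + 1) / c"
  have C: "0 < C" using B c by (simp add: C_def)
  have lip: "\<bar>g z - g z0\<bar> \<le> C * norm (z - z0)" if z: "z \<in> S" "norm (z - z0) < d1" for z
  proof -
    have n: "norm ((z, g z0) - (z0, g z0)) = norm (z - z0)" by (simp add: norm_Pair)
    have "\<bar>f (z, g z0) - F (z - z0, 0)\<bar> \<le> norm (z - z0)"
      using d1(2)[of "(z, g z0)"] z(2) zero[OF z0] unfolding n by simp
    moreover have "\<bar>F (z - z0, 0)\<bar> \<le> norm (z - z0) * B" using B(2)[of "(z - z0, 0)"] by (simp add: norm_Pair)
    ultimately have "\<bar>f (z, g z0)\<bar> \<le> (B + 1) * norm (z - z0)" by (simp add: algebra_simps)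
    then have "c * \<bar>g z - g z0\<bar> \<le> (B + 1) * norm (z - z0)" using c(2)[OF z(1)] by linarith
    then show ?thesis using c(1) by (simp add: C_def field_simps)
  qed
  show ?thesis
    unfolding has_derivative_within_alt
  proof (intro conjI allI impI)
    show "bounded_linear (\<lambda>h. - F (h, 0) / F (0, 1))"
    proof -
      have "bounded_linear (\<lambda>h. F (h, 0))"
        by (rule bounded_linear_compose[OF F.bounded_linear_axioms]) (intro bounded_linear_Pair bounded_linear_ident bounded_linear_zero)
      then have "bounded_linear (\<lambda>h. F (h, 0) * (- 1 / F (0, 1)))" by (rule bounded_linear_mult_const)
      then show ?thesis by simp
    qed
    fix e :: real assume e: "0 < e"
    define e' where "e' = e * \<bar>F (0, 1)\<bar> / (1 + C)"
    have e': "0 < e'" using e nz C by (simp add: e'_def)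
    obtain d2 where d2: "0 < d2" "\<And>q. norm (q - (z0, g z0)) < d2 \<Longrightarrow>
      norm (f q - f (z0, g z0) - F (q - (z0, g z0))) \<le> e' * norm (q - (z0, g z0))"
      using der e' unfolding has_derivative_at_alt by metis
    show "\<exists>d>0. \<forall>z\<in>S. norm (z - z0) < d \<longrightarrow>
        norm (g z - g z0 - - F (z - z0, 0) / F (0, 1)) \<le> e * norm (z - z0)"
    proof (intro exI[of _ "min d1 (d2 / (1 + C))"] conjI ballI impI)
      fix z assume z: "z \<in> S" "norm (z - z0) < min d1 (d2 / (1 + C))"
      let ?q = "(z, g z) - (z0, g z0)"
      have "norm ?q \<le> norm (z - z0) + \<bar>g z - g z0\<bar>" using norm_Pair_le[of "z - z0" "g z - g z0"] by simp
      also have "\<dots> \<le> (1 + C) * norm (z - z0)" using lip[of z] z by (simp add: algebra_simps)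
      finally have q: "norm ?q \<le> (1 + C) * norm (z - z0)" .
      also have "\<dots> < d2" using z(2) C by (simp add: field_simps)
      finally have "\<bar>F (z - z0, g z - g z0)\<bar> \<le> e' * norm ?q"
        using d2(2)[of "(z, g z)"] zero[OF z0] zero[OF z(1)] by simp
      also have "\<dots> \<le> e' * ((1 + C) * norm (z - z0))" using q e' by (intro mult_left_mono) auto
      also have "\<dots> = e * \<bar>F (0, 1)\<bar> * norm (z - z0)" using C by (simp add: e'_def)
      finally have *: "\<bar>F (z - z0, g z - g z0)\<bar> \<le> e * \<bar>F (0, 1)\<bar> * norm (z - z0)" .
      have "g z - g z0 - - F (z - z0, 0) / F (0, 1) = F (z - z0, g z - g z0) / F (0, 1)"
        using nz unfolding split[of "z - z0" "g z - g z0"] by (simp add: field_simps)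
      then show "norm (g z - g z0 - - F (z - z0, 0) / F (0, 1)) \<le> e * norm (z - z0)"
        using * nz by (simp add: abs_divide divide_le_eq mult_ac)
    qed (use d1 d2 C in simp)
  qed
qed

text \<open>
  Near \<open>p\<close> the zeros of \<open>f\<close> form the graph of a function \<open>g\<close>, and \<open>z \<mapsto> T (z, g z)\<close> has a singular
  derivative, so Sard's theorem applies to it.
\<close>

lemma negligible_critical_graph_local:
  fixes f :: "(real^'n) \<times> real \<Rightarrow> real" and T :: "(real^'n) \<times> real \<Rightarrow> real^'n"
  assumes der: "\<And>p. (f has_derivative F p) (at p)"
    and cont: "continuous_on UNIV (\<lambda>p. F p (0, 1))" and T: "linear T"
    and zero: "\<And>p. p \<in> M \<Longrightarrow> f p = 0" and nz: "\<And>p. p \<in> M \<Longrightarrow> F p (0, 1) \<noteq> 0"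
    and crit: "\<And>p. p \<in> M \<Longrightarrow> \<exists>h. h \<noteq> 0 \<and> T (h, - F p (h, 0) / F p (0, 1)) = 0"
    and p: "p \<in> M"
  shows "\<exists>W. open W \<and> p \<in> W \<and> negligible (T ` (M \<inter> W))"
proof -
  have blT: "bounded_linear T" using T by (simp add: linear_conv_bounded_linear)
  define c where "c = \<bar>F p (0, 1)\<bar> / 2"
  have c: "0 < c" using nz[OF p] by (simp add: c_def)
  define W where "W = {q. \<bar>F q (0, 1) - F p (0, 1)\<bar> < c}"
  have "open W" unfolding W_def using cont by (intro open_Collect_less continuous_intros) auto
  moreover have "p \<in> W" using c by (simp add: W_def)
  ultimately obtain A0 B0 where AB: "open A0" "open B0" "p \<in> A0 \<times> B0" "A0 \<times> B0 \<subseteq> W"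
    by (rule open_prod_elim)
  then obtain r1 r2 where r: "0 < r1" "ball (fst p) r1 \<subseteq> A0" "0 < r2" "ball (snd p) r2 \<subseteq> B0"
    by (metis mem_Times_iff openE)
  let ?A = "ball (fst p) r1" and ?B = "ball (snd p) r2"
  have inv: "c \<le> \<bar>F (z, t) (0, 1)\<bar>" if "z \<in> ?A" "t \<in> ?B" for z t
  proof -
    have "(z, t) \<in> W" using that r AB by blast
    then show ?thesis unfolding W_def c_def mem_Collect_eq by linarith
  qed
  have low: "c * \<bar>t - t'\<bar> \<le> \<bar>f (z, t) - f (z, t')\<bar>" if z: "z \<in> ?A" and t: "t \<in> ?B" "t' \<in> ?B" "t' < t" for z t t'
  proof -
    have d: "((\<lambda>t. f (z, t)) has_real_derivative F (z, s) (0, 1)) (at s)" for s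
    proof -
      interpret bounded_linear "F (z, s)" using der by (rule has_derivative_bounded_linear)
      have "((\<lambda>t. (z, t)) has_derivative (\<lambda>h. (0, h))) (at s)"
        by (intro has_derivative_Pair has_derivative_const has_derivative_ident)
      from has_derivative_compose[OF this der[of "(z, s)"]]
      have "((\<lambda>t. f (z, t)) has_derivative (\<lambda>h. F (z, s) (0, h))) (at s)" .
      moreover have "(\<lambda>h. F (z, s) (0, h)) = (*) (F (z, s) (0, 1))"
      proof (rule ext)
        fix h
        show "F (z, s) (0, h) = F (z, s) (0, 1) * h" using scaleR[of h "(0, 1)"] by simp
      qed
      ultimately show ?thesis by (simp only: has_field_derivative_def)
    qed
    obtain s where s: "t' < s" "s < t" "f (z, t) - f (z, t') = (t - t') * F (z, s) (0, 1)"
      using MVT2[OF t(3) d] by blast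
    have "s \<in> ?B" using s(1,2) t by (auto simp: dist_real_def)
    then have "\<bar>t - t'\<bar> * c \<le> \<bar>t - t'\<bar> * \<bar>F (z, s) (0, 1)\<bar>" using inv[OF z] by (intro mult_left_mono) auto
    then show ?thesis unfolding s(3) by (simp add: abs_mult mult.commute)
  qed
  have low': "c * \<bar>t - t'\<bar> \<le> \<bar>f (z, t) - f (z, t')\<bar>" if "z \<in> ?A" "t \<in> ?B" "t' \<in> ?B" for z t t'
    using low[of z t t'] low[of z t' t] that by (cases t t' rule: linorder_cases) (auto simp: abs_minus_commute)
  define MW where "MW = M \<inter> (?A \<times> ?B)"
  define g where "g z = (SOME t. (z, t) \<in> MW)" for z
  have g: "(z, g z) \<in> MW" if "z \<in> fst ` MW" for z
    unfolding g_def using that by (intro someI_ex[of "\<lambda>t. (z, t) \<in> MW"]) force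
  have uniq: "t = g z" if "(z, t) \<in> MW" for z t
  proof -
    have gz: "(z, g z) \<in> MW" using g that by force
    have "c * \<bar>t - g z\<bar> \<le> \<bar>f (z, t) - f (z, g z)\<bar>" using low'[of z t "g z"] that gz by (auto simp: MW_def)
    then have "c * \<bar>t - g z\<bar> \<le> 0" using zero that gz by (simp add: MW_def)
    then show ?thesis using c by (simp add: mult_le_0_iff)
  qed
  have MW_eq: "MW = (\<lambda>z. (z, g z)) ` fst ` MW" using g uniq by force
  have "negligible ((\<lambda>z. T (z, g z)) ` fst ` MW)"
  proof (rule Sard_finite_index)
    fix z assume z: "z \<in> fst ` MW"
    have m: "(z, g z) \<in> M" "z \<in> ?A" "g z \<in> ?B" using g[OF z] by (auto simp: MW_def)
    have "(g has_derivative (\<lambda>h. - F (z, g z) (h, 0) / F (z, g z) (0, 1))) (at z within fst ` MW)"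
    proof (rule implicit_has_derivative[where f=f and g=g and ?z0.0=z and F="F (z, g z)", OF der nz[OF m(1)] _ z c(1)])
      show "f (y, g y) = 0" if "y \<in> fst ` MW" for y using zero g[OF that] by (simp add: MW_def)
      show "c * \<bar>g y - g z\<bar> \<le> \<bar>f (y, g z)\<bar>" if y: "y \<in> fst ` MW" for y
        using low'[of y "g y" "g z"] g[OF y] m zero[of "(y, g y)"] by (auto simp: MW_def)
    qed
    then show "((\<lambda>z. T (z, g z)) has_derivative
        (\<lambda>h. T (h, - F (z, g z) (h, 0) / F (z, g z) (0, 1)))) (at z within fst ` MW)"
      by (intro bounded_linear.has_derivative[OF blT] has_derivative_Pair has_derivative_ident)
    show "\<exists>h. h \<noteq> 0 \<and> T (h, - F (z, g z) (h, 0) / F (z, g z) (0, 1)) = 0" by (rule crit[OF m(1)])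
  qed
  also have "(\<lambda>z. T (z, g z)) ` fst ` MW = T ` MW" by (subst (2) MW_eq) (simp add: image_image)
  finally have "negligible (T ` (M \<inter> (?A \<times> ?B)))" by (simp only: MW_def)
  moreover have "open (?A \<times> ?B)" by (intro open_Times) auto
  moreover have "p \<in> ?A \<times> ?B" using r by (simp add: mem_Times_iff)
  ultimately show ?thesis by blast
qed

lemma negligible_critical_graph:
  fixes f :: "(real^'n) \<times> real \<Rightarrow> real" and T :: "(real^'n) \<times> real \<Rightarrow> real^'n"
  assumes der: "\<And>p. (f has_derivative F p) (at p)"
    and cont: "continuous_on UNIV (\<lambda>p. F p (0, 1))" and T: "linear T"
    and zero: "\<And>p. p \<in> M \<Longrightarrow> f p = 0" and nz: "\<And>p. p \<in> M \<Longrightarrow> F p (0, 1) \<noteq> 0"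
    and crit: "\<And>p. p \<in> M \<Longrightarrow> \<exists>h. h \<noteq> 0 \<and> T (h, - F p (h, 0) / F p (0, 1)) = 0"
  shows "negligible (T ` M)"
proof -
  define \<W> where "\<W> = {W. open W \<and> negligible (T ` (M \<inter> W))}"
  obtain \<C> where \<C>: "\<C> \<subseteq> \<W>" "countable \<C>" "\<Union>\<C> = \<Union>\<W>"
    using Lindelof[of \<W>] by (auto simp: \<W>_def)
  have "M \<subseteq> \<Union>\<C>" unfolding \<C>(3) \<W>_def using negligible_critical_graph_local[OF assms] by blast
  then have "T ` M = (\<Union>W\<in>\<C>. T ` (M \<inter> W))" by blast
  moreover have "negligible (\<Union>W\<in>\<C>. T ` (M \<inter> W))"
    using \<C> by (intro negligible_countable_Union) (auto simp: \<W>_def)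
  ultimately show ?thesis by simp
qed

definition set_coord :: "'n \<Rightarrow> real^'n \<Rightarrow> real \<Rightarrow> real^'n" where
  "set_coord k x s = (\<chi> i. if i = k then s else x $ i)"

text \<open>
  The points in question are parametrised by the two split positions and the coordinates other than \<open>k\<close> and
  \<open>j\<close>: the equation \<open>u = v\<close> determines the \<open>j\<close>-th coordinate implicitly, as the \<open>j\<close>-th derivatives
  differ. Moving the two split positions in opposite directions changes neither their sum, nor, to first
  order, the implicit coordinate, since both \<open>k\<close>-th derivatives vanish. The parametrisation is thus
  singular, and its image is negligible by Sard's theorem.
\<close>

lemma negligible_degenerate_pairs:
  fixes u v :: "real^'n \<Rightarrow> real"
  assumes u: "C_k 1 u" and v: "C_k 1 v" and jk: "j \<noteq> k"
  shows "negligible {x. \<exists>a. u (set_coord k x a) = v (set_coord k x (x $ k - a)) \<and>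
      grad u (set_coord k x a) $ k = 0 \<and> grad v (set_coord k x (x $ k - a)) $ k = 0 \<and>
      grad u (set_coord k x a) $ j \<noteq> grad v (set_coord k x (x $ k - a)) $ j}" (is "negligible ?Z")
proof -
  define A1 :: "(real^'n) \<times> real \<Rightarrow> real^'n" where "A1 p = (\<chi> i. if i = j then snd p else fst p $ i)" for p
  define A2 :: "(real^'n) \<times> real \<Rightarrow> real^'n" where
    "A2 p = (\<chi> i. if i = j then snd p else if i = k then fst p $ j else fst p $ i)" for p
  define T :: "(real^'n) \<times> real \<Rightarrow> real^'n" where
    "T p = (\<chi> i. if i = k then fst p $ k + fst p $ j else if i = j then snd p else fst p $ i)" for p
  have lin: "linear A1" "linear A2" "linear T"
    by (auto intro!: linearI simp: A1_def A2_def T_def vec_eq_iff algebra_simps)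
  note bl = lin[THEN linear_conv_bounded_linear[THEN iffD1]]
  define F where "F p q = grad u (A1 p) \<bullet> A1 q - grad v (A2 p) \<bullet> A2 q" for p q
  define M where "M = {p. u (A1 p) = v (A2 p) \<and> grad u (A1 p) $ k = 0 \<and> grad v (A2 p) $ k = 0 \<and>
      grad u (A1 p) $ j \<noteq> grad v (A2 p) $ j}"
  have A01: "A1 (0, 1) = axis j 1" "A2 (0, 1) = axis j 1" by (auto simp: A1_def A2_def axis_def vec_eq_iff)
  have D: "F p (0, 1) = grad u (A1 p) $ j - grad v (A2 p) $ j" for p
    by (simp add: F_def A01 inner_axis)
  have "negligible (T ` M)"
  proof (rule negligible_critical_graph[where f="\<lambda>p. u (A1 p) - v (A2 p)" and F=F])
    show "((\<lambda>p. u (A1 p) - v (A2 p)) has_derivative F p) (at p)" for p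
      unfolding F_def[abs_def]
      by (intro has_derivative_diff has_derivative_compose[OF bounded_linear_imp_has_derivative[OF bl(1)] C1_grad(1)[OF u]]
          has_derivative_compose[OF bounded_linear_imp_has_derivative[OF bl(2)] C1_grad(1)[OF v]])
    show "continuous_on UNIV (\<lambda>p. F p (0, 1))"
      unfolding D
      by (intro continuous_intros continuous_on_compose2[OF C1_grad(2)[OF u]] continuous_on_compose2[OF C1_grad(2)[OF v]]
          linear_continuous_on bl) auto
    show "linear T" by fact
    fix p assume p: "p \<in> M"
    show "u (A1 p) - v (A2 p) = 0" "F p (0, 1) \<noteq> 0" using p by (auto simp: M_def D)
    \<comment> \<open>The two split positions sit in the coordinates \<open>k\<close> and \<open>j\<close>; this direction keeps their sum.\<close>
    let ?h = "axis k 1 - axis j 1 :: real^'n"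
    have "A1 (?h, 0) = axis k 1" "A2 (?h, 0) = - axis k 1"
      using jk by (auto simp: A1_def A2_def axis_def vec_eq_iff)
    then have "F p (?h, 0) = 0" using p by (simp add: F_def inner_axis M_def)
    moreover have "T (?h, 0) = 0" using jk by (auto simp: T_def axis_def vec_eq_iff)
    moreover have "?h $ k \<noteq> 0" using jk by (simp add: axis_def)
    then have "?h \<noteq> 0" by (metis zero_index)
    ultimately show "\<exists>h. h \<noteq> 0 \<and> T (h, - F p (h, 0) / F p (0, 1)) = 0"
      by (intro exI[of _ ?h]) auto
  qed
  moreover have "?Z \<subseteq> T ` M"
  proof
    fix x assume "x \<in> ?Z"
    then obtain a where a: "u (set_coord k x a) = v (set_coord k x (x $ k - a))"
      "grad u (set_coord k x a) $ k = 0" "grad v (set_coord k x (x $ k - a)) $ k = 0"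
      "grad u (set_coord k x a) $ j \<noteq> grad v (set_coord k x (x $ k - a)) $ j" by blast
    let ?p = "(\<chi> i. if i = k then a else if i = j then x $ k - a else x $ i, x $ j)"
    have "A1 ?p = set_coord k x a" "A2 ?p = set_coord k x (x $ k - a)" "T ?p = x"
      using jk by (auto simp: A1_def A2_def T_def set_coord_def vec_eq_iff)
    then show "x \<in> T ` M" using a by (intro image_eqI[of _ _ ?p]) (auto simp: M_def)
  qed
  ultimately show ?thesis using negligible_subset by blast
qed

section \<open>Derivative of the coupled rearrangement\<close>

lemma set_coord_component [simp]: "set_coord k x s $ i = (if i = k then s else x $ i)"
  by (simp add: set_coord_def)

lemma set_coord_same [simp]: "set_coord k x (x $ k) = x"
  by (simp add: vec_eq_iff)

lemma set_coord_twice [simp]: "set_coord k (set_coord k x s) t = set_coord k x t"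
  by (simp add: vec_eq_iff)

lemma set_coord_eq: "set_coord k x s = x + (s - x $ k) *\<^sub>R axis k 1"
  by (simp add: vec_eq_iff axis_def)

lemma slice_eq_set_coord: "slice k u x s = u (set_coord k x s)"
  by (simp add: slice_def set_coord_def)

lemma continuous_set_coord [continuous_intros]:
  assumes "continuous_on S f" "continuous_on S g"
  shows "continuous_on S (\<lambda>x. set_coord k (f x) (g x))"
  unfolding set_coord_eq by (intro continuous_intros assms)

lemma inner_set_coord: "g \<bullet> set_coord k h t = g \<bullet> h + g $ k * (t - h $ k)"
  by (simp add: set_coord_eq inner_add_right inner_axis mult.commute)

lemma has_derivative_set_coord:
  assumes "(s has_derivative s') (at x)"
  shows "((\<lambda>y. set_coord k y (s y)) has_derivative (\<lambda>h. set_coord k h (s' h))) (at x)"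
  unfolding set_coord_eq
  by (intro has_derivative_add has_derivative_ident has_derivative_scaleR_left has_derivative_diff assms
      bounded_linear_imp_has_derivative[OF bounded_linear_vec_nth])

lemma has_derivative_comp_set_coord:
  fixes u :: "real^'n \<Rightarrow> real"
  assumes u: "C_k 1 u" and s: "(s has_derivative s') (at x)"
  shows "((\<lambda>y. u (set_coord k y (s y))) has_derivative
    (\<lambda>h. grad u (set_coord k x (s x)) \<bullet> h + grad u (set_coord k x (s x)) $ k * (s' h - h $ k))) (at x)"
  using has_derivative_compose[OF has_derivative_set_coord[OF s, of k] C1_grad(1)[OF u]]
  by (simp add: inner_set_coord)

lemma slice_has_derivative:
  fixes u :: "real^'n \<Rightarrow> real"
  assumes u: "C_k 1 u"
  shows "(slice k u x has_real_derivative grad u (set_coord k x s) $ k) (at s)"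
proof -
  have "((\<lambda>t. set_coord k x t) has_derivative (\<lambda>h. h *\<^sub>R axis k 1)) (at s)"
    unfolding set_coord_eq by (auto intro!: derivative_eq_intros)
  from has_derivative_compose[OF this C1_grad(1)[OF u]]
  have "((\<lambda>t. u (set_coord k x t)) has_derivative (\<lambda>h. grad u (set_coord k x s) $ k * h)) (at s)"
    by (simp add: inner_axis mult.commute)
  then show ?thesis by (simp add: has_field_derivative_def slice_eq_set_coord[abs_def])
qed

lemma slice_deriv_continuous:
  assumes "C_k 1 u"
  shows "continuous_on UNIV (\<lambda>s. grad u (set_coord k x s) $ k)"
  by (intro continuous_intros continuous_on_compose2[OF C1_grad(2)[OF assms]]) auto

definition admissible :: "'n \<Rightarrow> (real^'n \<Rightarrow> real) \<Rightarrow> bool" where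
  "admissible k u \<longleftrightarrow> C_k 1 u \<and> (\<forall>x. 0 < u x) \<and> (u \<longlongrightarrow> 0) at_infinity \<and> decreasing_in_abs k u"

lemma admissible_C1: "admissible k u \<Longrightarrow> C_k 1 u"
  by (simp only: admissible_def)

lemma admissible_continuous: "admissible k u \<Longrightarrow> continuous_on UNIV u"
  by (intro locally_lipschitz_continuous C1_locally_lipschitz admissible_C1)

lemma admissible_profile:
  fixes u :: "real^'n \<Rightarrow> real"
  assumes "admissible k u"
  shows "profile (slice k u x)"
  unfolding profile_def
proof (intro conjI allI impI)
  show "continuous_on UNIV (slice k u x)"
    by (intro continuous_at_imp_continuous_on ballI DERIV_isCont[OF slice_has_derivative[OF admissible_C1[OF assms]]])
  show "slice k u x t \<le> slice k u x s" if "\<bar>s\<bar> \<le> \<bar>t\<bar>" for s t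
    using assms that by (simp add: admissible_def decreasing_in_abs_def)
  show "0 < slice k u x s" for s using assms by (simp add: admissible_def slice_def)
  have "filterlim (set_coord k x) at_infinity at_infinity"
    unfolding filterlim_at_infinity[OF order_refl]
  proof (intro allI impI)
    fix r :: real assume "0 < r"
    show "\<forall>\<^sub>F s in at_infinity. r \<le> norm (set_coord k x s)"
      unfolding eventually_at_infinity
    proof (intro exI[of _ r] allI impI)
      fix s :: real assume "r \<le> norm s"
      also have "norm s = \<bar>set_coord k x s $ k\<bar>" by simp
      also have "\<dots> \<le> norm (set_coord k x s)" by (rule component_le_norm_cart)
      finally show "r \<le> norm (set_coord k x s)" .
    qed
  qed
  then show "(slice k u x \<longlongrightarrow> 0) at_infinity"
    using assms filterlim_compose[of u _ at_infinity "set_coord k x" at_infinity]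
    by (simp add: admissible_def slice_eq_set_coord[abs_def])
qed

lemma admissible_even: "admissible k u \<Longrightarrow> u (set_coord k x (- s)) = u (set_coord k x s)"
  using profileD(4)[OF admissible_profile, of k u x s] by (simp add: slice_eq_set_coord)

lemma slice_set_coord [simp]: "slice k u (set_coord k x s) = slice k u x"
  by (simp add: fun_eq_iff slice_eq_set_coord)

lemma coupled_rearrangement_eq:
  "coupled_rearrangement k u v x = star_profile (slice k u x) (slice k v x) (x $ k)"
  by (simp add: coupled_rearrangement_def star_profile_def)

lemma coupled_lower:
  assumes "admissible k u" "admissible k v" "\<bar>y $ k\<bar> \<le> \<bar>a\<bar> + \<bar>b\<bar>"
  shows "min (u (set_coord k y a)) (v (set_coord k y b)) \<le> coupled_rearrangement k u v y"
  using star_profile_lower[OF admissible_profile[OF assms(1)] admissible_profile[OF assms(2)] assms(3)]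
  by (simp add: coupled_rearrangement_eq slice_eq_set_coord)

lemma coupled_upper:
  assumes "admissible k u" "admissible k v" "\<bar>a\<bar> + \<bar>b\<bar> \<le> \<bar>y $ k\<bar>"
  shows "coupled_rearrangement k u v y \<le> max (u (set_coord k y a)) (v (set_coord k y b))"
  using star_profile_upper[OF admissible_profile[OF assms(1)] admissible_profile[OF assms(2)] assms(3)]
  by (simp add: coupled_rearrangement_eq slice_eq_set_coord)

lemma coupled_ge:
  assumes "admissible k u" "admissible k v"
  shows "u y \<le> coupled_rearrangement k u v y" "v y \<le> coupled_rearrangement k u v y"
  using star_profile_ge_left[OF admissible_profile[OF assms(1)] admissible_profile[OF assms(2)], of y "y $ k" y]
    star_profile_ge_right[OF admissible_profile[OF assms(1)] admissible_profile[OF assms(2)], of y "y $ k" y]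
  by (simp_all add: coupled_rearrangement_eq slice_eq_set_coord)

lemma coupled_even:
  "coupled_rearrangement k u v (set_coord k x (- s)) = coupled_rearrangement k u v (set_coord k x s)"
  by (simp add: coupled_rearrangement_eq star_profile_even)

text \<open>
  Expressing the split position as a fraction \<open>r\<close> of the coordinate makes it transferable to
  neighbouring points.
\<close>

lemma coupled_attained:
  assumes u: "admissible k u" and v: "admissible k v"
  shows "\<exists>r\<in>{0..1}. coupled_rearrangement k u v y \<le> min (u (set_coord k y (r * y $ k))) (v (set_coord k y ((1 - r) * y $ k)))
    \<or> coupled_rearrangement k u v y = u y \<or> coupled_rearrangement k u v y = v y"
proof -
  let ?U = "slice k u y" and ?V = "slice k v y"
  note U = admissible_profile[OF u, of y] and V = admissible_profile[OF v, of y]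
  define s where "s = \<bar>y $ k\<bar>"
  have s: "0 \<le> s" by (simp add: s_def)
  have "coupled_rearrangement k u v y = star_profile ?U ?V s"
    by (cases "0 \<le> y $ k") (simp_all add: s_def coupled_rearrangement_eq star_profile_even)
  then have w: "coupled_rearrangement k u v y = max (?U (split_point ?U ?V s)) (?V (s - split_point ?U ?V s))"
    using star_profile_split[OF U V s] by simp
  have Us: "?U s = u y" "?V s = v y"
    using profileD(5)[OF U, of "y $ k"] profileD(5)[OF V, of "y $ k"] by (simp_all add: s_def slice_eq_set_coord)
  show ?thesis
  proof (cases rule: split_point_cases[OF U V s, case_names left right balanced])
    case left
    then have "coupled_rearrangement k u v y = u y" using w Us by simp
    then show ?thesis by (intro bexI[of _ 0]) auto
  next
    case right
    then have "coupled_rearrangement k u v y = v y" using w Us by simp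
    then show ?thesis by (intro bexI[of _ 0]) auto
  next
    case balanced
    define r where "r = (if s = 0 then 0 else split_point ?U ?V s / s)"
    have p: "0 \<le> split_point ?U ?V s" "split_point ?U ?V s \<le> s" using split_point_bounds[OF s] by auto
    have r: "r \<in> {0..1}" "r * s = split_point ?U ?V s"
      using p s by (auto simp: r_def divide_le_eq)
    have "\<bar>r * y $ k\<bar> = \<bar>r * s\<bar>" "\<bar>(1 - r) * y $ k\<bar> = \<bar>(1 - r) * s\<bar>"
      by (auto simp: s_def abs_mult)
    then have "?U (r * y $ k) = ?U (r * s)" "?V ((1 - r) * y $ k) = ?V ((1 - r) * s)"
      using profileD(5)[OF U] profileD(5)[OF V] by metis+
    moreover have "(1 - r) * s = s - split_point ?U ?V s" using r(2) by (simp add: algebra_simps)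
    ultimately have "coupled_rearrangement k u v y \<le> min (?U (r * y $ k)) (?V ((1 - r) * y $ k))"
      using w balanced(3) r(2) by simp
    then show ?thesis using r(1) by (intro bexI[of _ r]) (auto simp: slice_eq_set_coord)
  qed
qed

lemma norm_set_coord_contract:
  fixes d :: "real^'n"
  assumes "r \<in> {0..1}"
  shows "norm (set_coord k d (r * d $ k)) \<le> norm d"
  using assms by (intro norm_le_componentwise_cart) (auto simp: abs_mult mult_left_le_one_le)

text \<open>
  A fraction \<open>r\<close> that is optimal at \<open>y\<close> still gives a lower bound at \<open>z\<close>, and \<open>x \<mapsto> set_coord k x (r * x $ k)\<close>
  does not increase distances.
\<close>

lemma coupled_locally_lipschitz:
  fixes u v :: "real^'n \<Rightarrow> real"
  assumes u: "admissible k u" and v: "admissible k v"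
  shows "locally_lipschitz (coupled_rearrangement k u v)"
  unfolding locally_lipschitz_def
proof
  fix R
  let ?w = "coupled_rearrangement k u v"
  obtain Lu where Lu: "0 \<le> Lu" "\<And>x y. norm x \<le> R \<Longrightarrow> norm y \<le> R \<Longrightarrow> \<bar>u x - u y\<bar> \<le> Lu * norm (x - y)"
    using C1_locally_lipschitz[OF admissible_C1[OF u]] unfolding locally_lipschitz_def by metis
  obtain Lv where Lv: "0 \<le> Lv" "\<And>x y. norm x \<le> R \<Longrightarrow> norm y \<le> R \<Longrightarrow> \<bar>v x - v y\<bar> \<le> Lv * norm (x - y)"
    using C1_locally_lipschitz[OF admissible_C1[OF v]] unfolding locally_lipschitz_def by metis
  define L where "L = max Lu Lv"
  have L: "\<bar>u x - u y\<bar> \<le> L * norm (x - y)" "\<bar>v x - v y\<bar> \<le> L * norm (x - y)"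
    if "norm x \<le> R" "norm y \<le> R" for x y
    using Lu(2)[OF that] Lv(2)[OF that] mult_right_mono[of Lu L "norm (x - y)"] mult_right_mono[of Lv L "norm (x - y)"]
    by (auto simp: L_def)
  have L0: "0 \<le> L" using Lu by (simp add: L_def)
  have "?w y \<le> ?w z + L * norm (y - z)" if y: "norm y \<le> R" and z: "norm z \<le> R" for y z
  proof -
    obtain r where r: "r \<in> {0..1}" and cases: "?w y \<le> min (u (set_coord k y (r * y $ k))) (v (set_coord k y ((1 - r) * y $ k)))
        \<or> ?w y = u y \<or> ?w y = v y"
      using coupled_attained[OF u v] by blast
    have sc: "norm (set_coord k d (q * d $ k)) \<le> R" if "norm d \<le> R" "q \<in> {0..1}" for d :: "real^'n" and q
      using norm_set_coord_contract[OF that(2), of k d] that(1) by linarith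
    have diff: "norm (set_coord k y (q * y $ k) - set_coord k z (q * z $ k)) \<le> norm (y - z)" if "q \<in> {0..1}" for q
    proof -
      have "set_coord k y (q * y $ k) - set_coord k z (q * z $ k) = set_coord k (y - z) (q * (y - z) $ k)"
        by (simp add: vec_eq_iff algebra_simps)
      then show ?thesis using norm_set_coord_contract[OF that] by metis
    qed
    have r': "1 - r \<in> {0..1}" using r by auto
    consider "?w y \<le> min (u (set_coord k y (r * y $ k))) (v (set_coord k y ((1 - r) * y $ k)))"
      | "?w y = u y" | "?w y = v y" using cases by blast
    then show ?thesis
    proof cases
      case 1
      have "\<bar>z $ k\<bar> \<le> \<bar>r * z $ k\<bar> + \<bar>(1 - r) * z $ k\<bar>"
        using abs_triangle_ineq[of "r * z $ k" "(1 - r) * z $ k"] by (simp add: algebra_simps)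
      from coupled_lower[OF u v this]
      have low: "min (u (set_coord k z (r * z $ k))) (v (set_coord k z ((1 - r) * z $ k))) \<le> ?w z" .
      have "u (set_coord k y (r * y $ k)) \<le> u (set_coord k z (r * z $ k)) + L * norm (y - z)"
        using L(1)[OF sc[OF y r] sc[OF z r]] mult_left_mono[OF diff[OF r] L0] by linarith
      moreover have "v (set_coord k y ((1 - r) * y $ k)) \<le> v (set_coord k z ((1 - r) * z $ k)) + L * norm (y - z)"
        using L(2)[OF sc[OF y r'] sc[OF z r']] mult_left_mono[OF diff[OF r'] L0] by linarith
      ultimately show ?thesis using 1 low by linarith
    next
      case 2
      then show ?thesis using L(1)[OF y z] coupled_ge(1)[OF u v, of z] by linarith
    next
      case 3
      then show ?thesis using L(2)[OF y z] coupled_ge(2)[OF u v, of z] by linarith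
    qed
  qed
  then have "\<bar>?w x - ?w y\<bar> \<le> L * norm (x - y)" if "norm x \<le> R" "norm y \<le> R" for x y
    using that by (smt (verit) norm_minus_commute)
  then show "\<exists>L\<ge>0. \<forall>x y. norm x \<le> R \<longrightarrow> norm y \<le> R \<longrightarrow> \<bar>?w x - ?w y\<bar> \<le> L * norm (x - y)"
    using L0 by blast
qed

lemma has_derivative_sandwich:
  fixes f g w :: "'a::real_normed_vector \<Rightarrow> real"
  assumes f: "(f has_derivative D) (at x)" and g: "(g has_derivative D) (at x)" and eq: "f x = g x"
    and S: "open S" "x \<in> S"
    and low: "\<And>y. y \<in> S \<Longrightarrow> min (f y) (g y) \<le> w y" and up: "\<And>y. y \<in> S \<Longrightarrow> w y \<le> max (f y) (g y)"
  shows "(w has_derivative D) (at x)"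
  unfolding has_derivative_at_alt
proof (intro conjI allI impI)
  show "bounded_linear D" using f by (rule has_derivative_bounded_linear)
  have wx: "w x = f x" "w x = g x" using low[OF S(2)] up[OF S(2)] eq by auto
  fix e :: real assume e: "0 < e"
  obtain d1 where d1: "0 < d1" "\<And>y. norm (y - x) < d1 \<Longrightarrow> norm (f y - f x - D (y - x)) \<le> e * norm (y - x)"
    using f e unfolding has_derivative_at_alt by blast
  obtain d2 where d2: "0 < d2" "\<And>y. norm (y - x) < d2 \<Longrightarrow> norm (g y - g x - D (y - x)) \<le> e * norm (y - x)"
    using g e unfolding has_derivative_at_alt by blast
  obtain d3 where d3: "0 < d3" "ball x d3 \<subseteq> S" using S openE by blast
  show "\<exists>d>0. \<forall>y. norm (y - x) < d \<longrightarrow> norm (w y - w x - D (y - x)) \<le> e * norm (y - x)"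
  proof (intro exI[of _ "min d1 (min d2 d3)"] conjI allI impI)
    fix y assume y: "norm (y - x) < min d1 (min d2 d3)"
    then have "y \<in> S" using d3 by (auto simp: dist_norm norm_minus_commute)
    then show "norm (w y - w x - D (y - x)) \<le> e * norm (y - x)"
      using low[of y] up[of y] d1(2)[of y] d2(2)[of y] y wx
      by (auto simp: abs_le_iff min_le_iff_disj le_max_iff_disj)
  qed (use d1 d2 d3 in auto)
qed

text \<open>
  The functions \<open>y \<mapsto> u\<close> and \<open>y \<mapsto> v\<close>, evaluated at a splitting of \<open>y $ k\<close> that depends on \<open>y\<close> through the
  affine function \<open>a + m \<bullet> (y - x)\<close>, sandwich \<open>w\<close> and have the same derivative at \<open>x\<close>.
\<close>

lemma coupled_derivative_balanced:
  fixes u v :: "real^'n \<Rightarrow> real" and m :: "real^'n"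
  assumes u: "admissible k u" and v: "admissible k v"
    and a: "0 \<le> a" and b: "0 \<le> b" and ab: "a + b = x $ k" "0 < x $ k"
    and eq: "u (set_coord k x a) = v (set_coord k x b)"
    and S: "open S" "x \<in> S"
      "\<And>y. y \<in> S \<Longrightarrow> 0 \<le> a + m \<bullet> (y - x) \<and> 0 \<le> y $ k - (a + m \<bullet> (y - x))"
    and G: "\<And>h. grad u (set_coord k x a) \<bullet> h + grad u (set_coord k x a) $ k * (m \<bullet> h - h $ k) = G \<bullet> h"
      "\<And>h. grad v (set_coord k x b) \<bullet> h + grad v (set_coord k x b) $ k * (- (m \<bullet> h)) = G \<bullet> h"
  shows "(coupled_rearrangement k u v has_derivative (\<lambda>h. G \<bullet> h)) (at x)"
proof (rule has_derivative_sandwich[OF _ _ _ S(1,2)])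
  let ?s = "\<lambda>y. a + m \<bullet> (y - x)"
  have s: "(?s has_derivative (\<lambda>h. m \<bullet> h)) (at x)"
    by (auto intro!: derivative_eq_intros)
  have nth: "((\<lambda>y. y $ k) has_derivative (\<lambda>h. h $ k)) (at x)"
    by (rule bounded_linear_imp_has_derivative[OF bounded_linear_vec_nth])
  have bx: "x $ k - ?s x = b" using ab by simp
  show "((\<lambda>y. u (set_coord k y (?s y))) has_derivative (\<lambda>h. G \<bullet> h)) (at x)"
    using has_derivative_comp_set_coord[OF admissible_C1[OF u] s, of k] by (simp add: G(1))
  have "((\<lambda>y. v (set_coord k y (y $ k - ?s y))) has_derivative
      (\<lambda>h. grad v (set_coord k x (x $ k - ?s x)) \<bullet> h +
        grad v (set_coord k x (x $ k - ?s x)) $ k * ((h $ k - m \<bullet> h) - h $ k))) (at x)"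
    by (intro has_derivative_comp_set_coord[OF admissible_C1[OF v]] has_derivative_diff nth s)
  then show "((\<lambda>y. v (set_coord k y (y $ k - ?s y))) has_derivative (\<lambda>h. G \<bullet> h)) (at x)"
    unfolding bx using G(2) by simp
  show "u (set_coord k x (?s x)) = v (set_coord k x (x $ k - ?s x))"
    unfolding bx using eq by simp
  fix y assume "y \<in> S"
  then have y: "0 \<le> ?s y" "0 \<le> y $ k - ?s y" using S(3) by auto
  show "min (u (set_coord k y (?s y))) (v (set_coord k y (y $ k - ?s y))) \<le> coupled_rearrangement k u v y"
    using y by (intro coupled_lower[OF u v]) auto
  show "coupled_rearrangement k u v y \<le> max (u (set_coord k y (?s y))) (v (set_coord k y (y $ k - ?s y)))"
    using y by (intro coupled_upper[OF u v]) auto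
qed

text \<open>
  As \<open>P\<^sub>k + Q\<^sub>k \<noteq> 0\<close>, there is exactly one slope \<open>m\<close> of the split position for which both bounds have
  the same derivative.
\<close>

lemma coupled_derivative_regular:
  fixes u v :: "real^'n \<Rightarrow> real"
  assumes u: "admissible k u" and v: "admissible k v"
    and a: "0 < a" and b: "0 < b" and ab: "a + b = x $ k"
    and eq: "u (set_coord k x a) = v (set_coord k x b)"
  defines "p \<equiv> grad u (set_coord k x a)" and "q \<equiv> grad v (set_coord k x b)"
  assumes ne: "p $ k + q $ k \<noteq> 0"
  defines "l \<equiv> q $ k / (p $ k + q $ k)"
  shows "(coupled_rearrangement k u v has_derivative
    (\<lambda>h. (l *\<^sub>R p + (1 - l) *\<^sub>R q - (l * p $ k) *\<^sub>R axis k 1) \<bullet> h)) (at x)"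
proof -
  \<comment> \<open>The solution of \<open>p \<bullet> h + p $ k * (m \<bullet> h - h $ k) = q \<bullet> h - q $ k * (m \<bullet> h)\<close> for all \<open>h\<close>.\<close>
  define m where "m = (1 / (p $ k + q $ k)) *\<^sub>R (q - p + (p $ k) *\<^sub>R axis k 1)"
  define S where "S = {y. 0 < a + m \<bullet> (y - x) \<and> 0 < y $ k - (a + m \<bullet> (y - x))}"
  let ?D = "p $ k + q $ k"
  have m: "?D * (m \<bullet> h) = q \<bullet> h - p \<bullet> h + p $ k * h $ k" for h
  proof -
    have "m \<bullet> h = (q \<bullet> h - p \<bullet> h + p $ k * h $ k) / ?D"
      by (simp add: m_def inner_add_left inner_diff_left inner_axis')
    moreover have "d * y = z" if "d \<noteq> 0" "y = z / d" for d y z :: real using that by simp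
    ultimately show ?thesis using ne by blast
  qed
  have l: "?D * l = q $ k" using ne by (simp add: l_def)
  show ?thesis
  proof (rule coupled_derivative_balanced[OF u v _ _ ab _ eq, where m=m and S=S])
    show "open S" unfolding S_def by (intro open_Collect_conj open_Collect_less continuous_intros)
    show "x \<in> S" using a b ab by (simp add: S_def)
    show "0 \<le> a + m \<bullet> (y - x) \<and> 0 \<le> y $ k - (a + m \<bullet> (y - x))" if "y \<in> S" for y
      using that by (simp add: S_def)
    fix h
    let ?G = "l *\<^sub>R p + (1 - l) *\<^sub>R q - (l * p $ k) *\<^sub>R axis k 1"
    have Gh: "?G \<bullet> h = l * (p \<bullet> h) + (1 - l) * (q \<bullet> h) - l * p $ k * h $ k"
      by (simp add: inner_add_left inner_diff_left inner_axis' algebra_simps)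
    have "?D * (p \<bullet> h + p $ k * (m \<bullet> h - h $ k)) = ?D * (?G \<bullet> h)"
      "?D * (q \<bullet> h + q $ k * (- (m \<bullet> h))) = ?D * (?G \<bullet> h)"
    proof -
      have "?D * (?G \<bullet> h) = (?D * l) * (p \<bullet> h) + (?D - ?D * l) * (q \<bullet> h) - (?D * l) * p $ k * h $ k"
        unfolding Gh by (simp add: algebra_simps)
      then have G: "?D * (?G \<bullet> h) = q $ k * (p \<bullet> h) + p $ k * (q \<bullet> h) - q $ k * p $ k * h $ k"
        unfolding l by (simp add: algebra_simps)
      have "?D * (p \<bullet> h + p $ k * (m \<bullet> h - h $ k)) = ?D * (p \<bullet> h) + p $ k * (?D * (m \<bullet> h)) - ?D * (p $ k * h $ k)"
        by (simp add: algebra_simps)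
      then show "?D * (p \<bullet> h + p $ k * (m \<bullet> h - h $ k)) = ?D * (?G \<bullet> h)"
        unfolding m G by (simp add: algebra_simps)
      have "?D * (q \<bullet> h + q $ k * (- (m \<bullet> h))) = ?D * (q \<bullet> h) - q $ k * (?D * (m \<bullet> h))"
        by (simp add: algebra_simps)
      then show "?D * (q \<bullet> h + q $ k * (- (m \<bullet> h))) = ?D * (?G \<bullet> h)"
        unfolding m G by (simp add: algebra_simps)
    qed
    then show "grad u (set_coord k x a) \<bullet> h + grad u (set_coord k x a) $ k * (m \<bullet> h - h $ k) = ?G \<bullet> h"
      "grad v (set_coord k x b) \<bullet> h + grad v (set_coord k x b) $ k * (- (m \<bullet> h)) = ?G \<bullet> h"
      using ne unfolding p_def[symmetric] q_def[symmetric] by simp_all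
  qed (use a b ab in auto)
qed

text \<open>
  At a critical pair with equal gradients every slope of the split position is possible to first order.
  The proportional one keeps both parts nonnegative even if one of them is \<open>0\<close>.
\<close>

lemma coupled_derivative_degenerate:
  fixes u v :: "real^'n \<Rightarrow> real"
  assumes u: "admissible k u" and v: "admissible k v"
    and a: "0 \<le> a" and b: "0 \<le> b" and ab: "a + b = x $ k" "0 < x $ k"
    and eq: "u (set_coord k x a) = v (set_coord k x b)"
    and grad_eq: "grad u (set_coord k x a) = grad v (set_coord k x b)"
    and crit: "grad u (set_coord k x a) $ k = 0"
  shows "(coupled_rearrangement k u v has_derivative (\<lambda>h. grad u (set_coord k x a) \<bullet> h)) (at x)"
proof (rule coupled_derivative_balanced[OF u v a b ab eq, where m="(a / x $ k) *\<^sub>R axis k 1" and S="{y. 0 < y $ k}"])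
  show "open {y::real^'n. 0 < y $ k}" by (intro open_Collect_less continuous_intros)
  fix y :: "real^'n" assume y: "y \<in> {y. 0 < y $ k}"
  have "a + ((a / x $ k) *\<^sub>R axis k 1) \<bullet> (y - x) = (a / x $ k) * y $ k"
    using ab by (simp add: inner_axis' field_simps)
  moreover have "0 \<le> (a / x $ k) * y $ k" using a ab y by simp
  moreover have "(a / x $ k) * y $ k \<le> 1 * y $ k" using a b ab y by (intro mult_right_mono) auto
  ultimately show "0 \<le> a + ((a / x $ k) *\<^sub>R axis k 1) \<bullet> (y - x) \<and>
      0 \<le> y $ k - (a + ((a / x $ k) *\<^sub>R axis k 1) \<bullet> (y - x))"
    by simp
qed (use ab crit grad_eq in auto)

text \<open>
  Near such points \<open>w\<close> coincides with \<open>u\<close>.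
\<close>

lemma coupled_derivative_left:
  fixes u v :: "real^'n \<Rightarrow> real"
  assumes u: "admissible k u" and v: "admissible k v" and lt: "v (set_coord k x 0) < u x"
  shows "(coupled_rearrangement k u v has_derivative (\<lambda>h. grad u x \<bullet> h)) (at x)"
proof (rule has_derivative_transform_within_open[OF C1_grad(1)[OF admissible_C1[OF u]]])
  note cont = admissible_continuous[OF u] admissible_continuous[OF v]
  show "open {y. v (set_coord k y 0) < u y}"
    by (intro open_Collect_less continuous_intros cont continuous_on_compose2[OF cont(2)]) auto
  show "x \<in> {y. v (set_coord k y 0) < u y}" using lt by simp
  show "u y = coupled_rearrangement k u v y" if "y \<in> {y. v (set_coord k y 0) < u y}" for y
    using that coupled_ge(1)[OF u v, of y] coupled_upper[OF u v, of "y $ k" 0 y] by auto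
qed

lemma coupled_commute: "coupled_rearrangement k u v = coupled_rearrangement k v u"
  by (simp add: fun_eq_iff coupled_rearrangement_eq star_profile_commute)

lemma coupled_derivative_right:
  fixes u v :: "real^'n \<Rightarrow> real"
  assumes "admissible k u" "admissible k v" "u (set_coord k x 0) < v x"
  shows "(coupled_rearrangement k u v has_derivative (\<lambda>h. grad v x \<bullet> h)) (at x)"
  using coupled_derivative_left[OF assms(2,1,3)] by (simp only: coupled_commute)

section \<open>Reflection, slicing and the exceptional set\<close>

abbreviation (input) reflect :: "'n \<Rightarrow> real^'n \<Rightarrow> real^'n" where
  "reflect k x \<equiv> set_coord k x (- (x $ k))"

lemma linear_reflect: "linear (\<lambda>x. reflect k x)"
  by (intro linearI) (simp_all add: vec_eq_iff)

lemma reflect_reflect: "reflect k (reflect k x) = x"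
  by (simp add: vec_eq_iff)

lemma norm_reflect: "norm (reflect k x) = norm x"
  by (simp add: norm_vec_def L2_set_def) (rule sum.cong, auto)

lemma inner_reflect: "reflect k x \<bullet> y = x \<bullet> reflect k y"
  unfolding inner_vec_def by (rule sum.cong) auto

lemma has_derivative_reflect:
  fixes f :: "real^'n \<Rightarrow> real"
  assumes f: "(f has_derivative (\<lambda>h. g \<bullet> h)) (at x)" and even: "\<And>y. f (reflect k y) = f y"
  shows "(f has_derivative (\<lambda>h. reflect k g \<bullet> h)) (at (reflect k x))"
proof -
  have "(f has_derivative (\<lambda>h. g \<bullet> h)) (at (reflect k (reflect k x)))" using f by (simp add: reflect_reflect)
  from has_derivative_compose[OF linear_imp_has_derivative[OF linear_reflect[of k]] this]
  show ?thesis unfolding even inner_reflect .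
qed

lemma norm_grad_reflect:
  fixes f :: "real^'n \<Rightarrow> real"
  assumes f: "(f has_derivative (\<lambda>h. g \<bullet> h)) (at x)" and even: "\<And>y. f (reflect k y) = f y"
  shows "norm (grad f (reflect k x)) = norm (grad f x)"
proof -
  have "(f has_derivative (\<lambda>h. reflect k g \<bullet> h)) (at (reflect k x))"
    using f even by (rule has_derivative_reflect)
  then have "grad f (reflect k x) = reflect k g" by (rule has_derivative_imp_grad)
  moreover have "grad f x = g" using f by (rule has_derivative_imp_grad)
  ultimately show ?thesis by (simp only: norm_reflect)
qed

lemma admissible_reflect: "admissible k u \<Longrightarrow> u (reflect k y) = u y"
  using admissible_even[of k u y "y $ k"] by simp

lemma coupled_reflect: "coupled_rearrangement k u v (reflect k y) = coupled_rearrangement k u v y"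
  by (rule coupled_even[of k u v y "y $ k", unfolded set_coord_same])

lemma grad_at_center:
  fixes u :: "real^'n \<Rightarrow> real"
  assumes "admissible k u"
  shows "grad u (set_coord k x 0) $ k = 0"
proof (rule DERIV_local_max[OF slice_has_derivative[OF admissible_C1[OF assms], of k x 0], of 1])
  show "\<forall>y. \<bar>0 - y\<bar> < 1 \<longrightarrow> slice k u x y \<le> slice k u x 0"
    using profileD(2)[OF admissible_profile[OF assms]] by simp
qed simp

lemma grad_nonpos:
  fixes u :: "real^'n \<Rightarrow> real"
  assumes u: "admissible k u" and s: "0 \<le> s"
  shows "grad u (set_coord k x s) $ k \<le> 0"
  by (rule profile_deriv_nonpos[OF admissible_profile[OF u] slice_has_derivative[OF admissible_C1[OF u]] s])

abbreviation other_coords :: "'n \<Rightarrow> (real^'n \<Rightarrow> real) measure" where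
  "other_coords k \<equiv> \<Pi>\<^sub>M b\<in>Basis - {axis k 1}. lborel"

definition embed_others :: "'n \<Rightarrow> (real^'n \<Rightarrow> real) \<Rightarrow> real^'n" where
  "embed_others k y = (\<Sum>b\<in>Basis - {axis k 1}. y b *\<^sub>R b)"

lemma embed_others_measurable [measurable]:
  "embed_others k \<in> borel_measurable (other_coords k)"
proof -
  have "(\<lambda>y. y b) \<in> borel_measurable (other_coords k)" if "b \<in> Basis - {axis k 1}" for b
    using measurable_component_singleton[OF that, of "\<lambda>_. lborel"] by simp
  then show ?thesis
    unfolding embed_others_def[abs_def] by (intro borel_measurable_sum borel_measurable_scaleR) auto
qed

lemma set_coord_measurable [measurable]:
  assumes [measurable]: "f \<in> borel_measurable M" "g \<in> borel_measurable M"
  shows "(\<lambda>x. set_coord k (f x) (g x)) \<in> borel_measurable M"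
proof -
  have "(\<lambda>x. f x \<bullet> axis k 1) \<in> borel_measurable M" by measurable
  then have [measurable]: "(\<lambda>x. f x $ k) \<in> borel_measurable M" by (simp add: inner_axis)
  show ?thesis unfolding set_coord_eq by measurable
qed

text \<open>
  Lebesgue measure on the whole space is the product, over the basis vectors, of the measures on the
  coordinates; the factor that belongs to \<open>k\<close> is split off.
\<close>

lemma nn_integral_coord:
  fixes f :: "real^'n \<Rightarrow> ennreal"
  assumes f [measurable]: "f \<in> borel_measurable borel"
  shows "(\<integral>\<^sup>+x. f x \<partial>lborel) = (\<integral>\<^sup>+y. (\<integral>\<^sup>+s. f (set_coord k (embed_others k y) s) \<partial>lborel) \<partial>other_coords k)"
proof -
  let ?e = "axis k 1 :: real^'n"
  interpret product_sigma_finite "\<lambda>b :: real^'n. lborel :: real measure" by standard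
  have e: "?e \<in> Basis" by simp
  then have ins: "insert ?e (Basis - {?e}) = Basis" by auto
  have m: "(\<lambda>y. \<Sum>b\<in>Basis. y b *\<^sub>R b) \<in> (\<Pi>\<^sub>M b\<in>(Basis :: (real^'n) set). lborel) \<rightarrow>\<^sub>M borel"
  proof -
    have "(\<lambda>y. y b) \<in> borel_measurable (\<Pi>\<^sub>M b\<in>(Basis :: (real^'n) set). lborel)" if "b \<in> Basis" for b
      using measurable_component_singleton[OF that, of "\<lambda>_. lborel"] by simp
    then show ?thesis by (intro borel_measurable_sum borel_measurable_scaleR) auto
  qed
  have "(\<integral>\<^sup>+x. f x \<partial>lborel) = (\<integral>\<^sup>+y. f (\<Sum>b\<in>Basis. y b *\<^sub>R b) \<partial>(\<Pi>\<^sub>M b\<in>Basis. lborel))"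
    by (subst lborel_eq) (simp add: nn_integral_distr m)
  also have "\<dots> = (\<integral>\<^sup>+y. (\<integral>\<^sup>+s. f (\<Sum>b\<in>Basis. (y(?e := s)) b *\<^sub>R b) \<partial>lborel) \<partial>other_coords k)"
    using product_nn_integral_insert[of "Basis - {?e}" ?e "\<lambda>y. f (\<Sum>b\<in>Basis. y b *\<^sub>R b)"] m
    unfolding ins by simp
  also have "\<dots> = (\<integral>\<^sup>+y. (\<integral>\<^sup>+s. f (set_coord k (embed_others k y) s) \<partial>lborel) \<partial>other_coords k)"
  proof (intro nn_integral_cong arg_cong[where f=f])
    fix y :: "real^'n \<Rightarrow> real" and s
    have "(\<Sum>b\<in>Basis. (y(?e := s)) b *\<^sub>R b) = s *\<^sub>R ?e + embed_others k y"
      unfolding embed_others_def by (subst sum.remove[OF finite_Basis e]) (auto intro!: sum.cong)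
    moreover have "embed_others k y $ k = 0"
    proof -
      have "embed_others k y \<bullet> ?e = (\<Sum>b\<in>Basis - {?e}. y b * (b \<bullet> ?e))"
        by (simp add: embed_others_def inner_sum_left)
      also have "\<dots> = 0" by (intro sum.neutral ballI) (use e in \<open>auto simp: inner_Basis\<close>)
      finally show ?thesis by (simp add: inner_axis)
    qed
    ultimately show "(\<Sum>b\<in>Basis. (y(?e := s)) b *\<^sub>R b) = set_coord k (embed_others k y) s"
      by (simp add: set_coord_eq)
  qed
  finally show ?thesis .
qed

lemma negligible_of_countable_slices:
  fixes A :: "(real^'n) set"
  assumes A [measurable]: "A \<in> sets borel" and slices: "\<And>x. countable {s. set_coord k x s \<in> A}"
  shows "negligible A"
proof -
  have "emeasure lborel A = (\<integral>\<^sup>+x. indicator A x \<partial>lborel)" by simp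
  also have "\<dots> = (\<integral>\<^sup>+y. (\<integral>\<^sup>+s. indicator A (set_coord k (embed_others k y) s) \<partial>lborel) \<partial>other_coords k)"
    by (rule nn_integral_coord) measurable
  also have "\<dots> = (\<integral>\<^sup>+y. 0 \<partial>other_coords k)"
  proof (rule nn_integral_cong)
    fix y
    have "{s. set_coord k (embed_others k y) s \<in> A} \<in> null_sets lborel"
      by (rule countable_imp_null_set_lborel[OF slices])
    then have "AE s in lborel. set_coord k (embed_others k y) s \<notin> A"
      using AE_not_in by fastforce
    then have "AE s in lborel. indicator A (set_coord k (embed_others k y) s) = (0 :: ennreal)"
      by (rule eventually_mono) simp
    then show "(\<integral>\<^sup>+s. indicator A (set_coord k (embed_others k y) s) \<partial>lborel) = 0"
      by (subst nn_integral_0_iff_AE) auto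
  qed
  finally have "A \<in> null_sets lborel" using A by (auto simp: null_sets_def)
  then show ?thesis by (simp add: negligible_iff_null_sets null_sets_completionI)
qed

lemma nn_integral_even:
  fixes g :: "real \<Rightarrow> ennreal"
  assumes [measurable]: "g \<in> borel_measurable borel" and even: "\<And>s. g (- s) = g s"
  shows "(\<integral>\<^sup>+s. g s \<partial>lborel) = 2 * (\<integral>\<^sup>+s\<in>{0<..}. g s \<partial>lborel)"
proof -
  have "(\<integral>\<^sup>+s. g s \<partial>lborel) = (\<integral>\<^sup>+s. g s * indicator {0<..} s + g s * indicator {..<0} s \<partial>lborel)"
    using AE_lborel_singleton[of "0::real"] by (intro nn_integral_cong_AE) (auto simp: indicator_def)
  also have "\<dots> = (\<integral>\<^sup>+s\<in>{0<..}. g s \<partial>lborel) + (\<integral>\<^sup>+s\<in>{..<0}. g s \<partial>lborel)"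
    by (rule nn_integral_add) measurable
  also have "(\<integral>\<^sup>+s\<in>{..<0}. g s \<partial>lborel) = (\<integral>\<^sup>+s. g (- s) * indicator {..<0} (- s) \<partial>lborel)"
    by (subst nn_integral_real_affine[where c="-1" and t=0]) auto
  also have "\<dots> = (\<integral>\<^sup>+s\<in>{0<..}. g s \<partial>lborel)"
    by (intro nn_integral_cong) (auto simp: even indicator_def)
  finally show ?thesis by (simp add: mult_2)
qed

text \<open>
  The points at which the sandwich argument may fail: the hyperplane of symmetry, the kinks, where the
  graph of one profile crosses the maximum of the other transversally, and the degenerate pairs with
  different gradients.
\<close>

definition exceptional :: "'n \<Rightarrow> (real^'n \<Rightarrow> real) \<Rightarrow> (real^'n \<Rightarrow> real) \<Rightarrow> (real^'n) set" where
  "exceptional k u v = {x. x $ k = 0} \<union>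
    {x. v x = u (set_coord k x 0) \<and> grad v x $ k \<noteq> 0} \<union>
    {x. u x = v (set_coord k x 0) \<and> grad u x $ k \<noteq> 0} \<union>
    {x. \<exists>a. u (set_coord k x a) = v (set_coord k x (x $ k - a)) \<and>
      grad u (set_coord k x a) $ k = 0 \<and> grad v (set_coord k x (x $ k - a)) $ k = 0 \<and>
      grad u (set_coord k x a) \<noteq> grad v (set_coord k x (x $ k - a))}"

text \<open>
  On each line, two crossing points must have the same distance from the centre: otherwise the profile
  would be constant between them, and the outer one would be a local maximum, hence critical.
\<close>

lemma negligible_kinks:
  fixes u v :: "real^'n \<Rightarrow> real"
  assumes u: "admissible k u" and v: "admissible k v"
  shows "negligible {x. v x = u (set_coord k x 0) \<and> grad v x $ k \<noteq> 0}" (is "negligible ?K")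
proof (rule negligible_of_countable_slices)
  note cont = admissible_continuous[OF u] admissible_continuous[OF v]
  have "closed {x. v x = u (set_coord k x 0)}"
    by (intro closed_Collect_eq continuous_intros cont continuous_on_compose2[OF cont(1)]) auto
  moreover have "open {x. grad v x $ k \<noteq> 0}"
    by (intro open_Collect_neq continuous_intros C1_grad(2)[OF admissible_C1[OF v]])
  moreover have "?K = {x. v x = u (set_coord k x 0)} \<inter> {x. grad v x $ k \<noteq> 0}" by auto
  ultimately show "?K \<in> sets borel" by (simp add: borel_closed borel_open sets.Int)
  fix x
  let ?V = "slice k v x" and ?S = "{s. set_coord k x s \<in> ?K}"
  note V = admissible_profile[OF v, of x]
  have lt: "\<not> \<bar>a\<bar> < \<bar>b\<bar>" if a: "a \<in> ?S" and b: "b \<in> ?S" for a b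
  proof
    assume lt: "\<bar>a\<bar> < \<bar>b\<bar>"
    have Vab: "?V a = ?V b" using a b by (simp add: slice_eq_set_coord)
    have "grad v (set_coord k x b) $ k = 0"
    proof (rule DERIV_local_max[OF slice_has_derivative[OF admissible_C1[OF v]], of "\<bar>b\<bar> - \<bar>a\<bar>"])
      show "\<forall>y. \<bar>b - y\<bar> < \<bar>b\<bar> - \<bar>a\<bar> \<longrightarrow> ?V y \<le> ?V b"
      proof (intro allI impI)
        fix y assume "\<bar>b - y\<bar> < \<bar>b\<bar> - \<bar>a\<bar>"
        then show "?V y \<le> ?V b" unfolding Vab[symmetric] by (intro profileD(2)[OF V]) linarith
      qed
    qed (use lt in simp)
    then show False using b by simp
  qed
  have eq: "\<bar>s\<bar> = \<bar>r\<bar>" if "s \<in> ?S" "r \<in> ?S" for s r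
    using lt[OF that] lt[OF that(2,1)] by linarith
  show "countable ?S"
  proof (cases "?S = {}")
    case True
    then show ?thesis by (simp only: countable_empty)
  next
    case False
    then obtain r where "r \<in> ?S" by blast
    then have "?S \<subseteq> {r, - r}" using eq by (force simp: abs_eq_iff)
    then show ?thesis by (meson countable_finite finite.emptyI finite.insertI finite_subset)
  qed
qed

lemma negligible_exceptional:
  fixes u v :: "real^'n \<Rightarrow> real"
  assumes u: "admissible k u" and v: "admissible k v"
  shows "negligible (exceptional k u v)"
proof -
  let ?Z = "\<lambda>j. {x. \<exists>a. u (set_coord k x a) = v (set_coord k x (x $ k - a)) \<and>
      grad u (set_coord k x a) $ k = 0 \<and> grad v (set_coord k x (x $ k - a)) $ k = 0 \<and>
      grad u (set_coord k x a) $ j \<noteq> grad v (set_coord k x (x $ k - a)) $ j}"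
  have hyper: "negligible {x :: real^'n. x $ k = 0}"
    using negligible_standard_hyperplane[of "axis k 1 :: real^'n" 0] by (simp add: inner_axis)
  have "negligible (\<Union>j\<in>- {k}. ?Z j)"
    by (intro negligible_countable_Union) (auto intro!: negligible_degenerate_pairs admissible_C1[OF u] admissible_C1[OF v] countable_finite)
  moreover have "{x. \<exists>a. u (set_coord k x a) = v (set_coord k x (x $ k - a)) \<and>
      grad u (set_coord k x a) $ k = 0 \<and> grad v (set_coord k x (x $ k - a)) $ k = 0 \<and>
      grad u (set_coord k x a) \<noteq> grad v (set_coord k x (x $ k - a))} \<subseteq> (\<Union>j\<in>- {k}. ?Z j)"
  proof safe
    fix x a
    assume *: "u (set_coord k x a) = v (set_coord k x (x $ k - a))"
      "grad u (set_coord k x a) $ k = 0" "grad v (set_coord k x (x $ k - a)) $ k = 0"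
      and ne: "grad u (set_coord k x a) \<noteq> grad v (set_coord k x (x $ k - a))"
    obtain j where j: "grad u (set_coord k x a) $ j \<noteq> grad v (set_coord k x (x $ k - a)) $ j"
      using ne by (auto simp: vec_eq_iff)
    then have "j \<noteq> k" using * by auto
    then show "x \<in> (\<Union>j\<in>- {k}. ?Z j)" using * j by blast
  qed
  ultimately have degenerate: "negligible {x. \<exists>a. u (set_coord k x a) = v (set_coord k x (x $ k - a)) \<and>
      grad u (set_coord k x a) $ k = 0 \<and> grad v (set_coord k x (x $ k - a)) $ k = 0 \<and>
      grad u (set_coord k x a) \<noteq> grad v (set_coord k x (x $ k - a))}"
    by (rule negligible_subset)
  show ?thesis
    unfolding exceptional_def
    by (intro negligible_Un hyper negligible_kinks[OF u v] negligible_kinks[OF v u] degenerate)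
qed

text \<open>
  If a part of the splitting is \<open>0\<close>, then the corresponding profile is critical by symmetry and the other
  one is so since \<open>x\<close> is not a kink; so in all cases both derivatives vanish, and the gradients agree since
  \<open>x\<close> is not a degenerate point.
\<close>

lemma coupled_derivative_singular:
  fixes u v :: "real^'n \<Rightarrow> real"
  assumes u: "admissible k u" and v: "admissible k v"
    and a: "0 \<le> a" and b: "0 \<le> b" and ab: "a + b = x $ k" "0 < x $ k"
    and eq: "u (set_coord k x a) = v (set_coord k x b)"
    and sing: "\<not> (0 < a \<and> 0 < b \<and> grad u (set_coord k x a) $ k + grad v (set_coord k x b) $ k < 0)"
    and x: "x \<notin> exceptional k u v"
  shows "grad u (set_coord k x a) = grad v (set_coord k x b)"
    and "(coupled_rearrangement k u v has_derivative (\<lambda>h. grad u (set_coord k x a) \<bullet> h)) (at x)"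
proof -
  have np: "grad u (set_coord k x a) $ k \<le> 0" "grad v (set_coord k x b) $ k \<le> 0"
    using grad_nonpos[OF u a] grad_nonpos[OF v b] by auto
  have xb: "set_coord k x b = set_coord k x (x $ k - a)" using ab by (metis add_diff_cancel_left')
  have crit: "grad u (set_coord k x a) $ k = 0 \<and> grad v (set_coord k x b) $ k = 0"
  proof -
    consider "a = 0" | "b = 0" | "0 < a" "0 < b" using a b by linarith
    then show ?thesis
    proof cases
      case 1
      then have "set_coord k x b = x" using ab by simp
      then show ?thesis using 1 eq x grad_at_center[OF u, of x] by (auto simp: exceptional_def)
    next
      case 2
      then have "set_coord k x a = x" using ab by simp
      then show ?thesis using 2 eq x grad_at_center[OF v, of x] by (auto simp: exceptional_def)
    next
      case 3
      then show ?thesis using sing np by linarith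
    qed
  qed
  show g: "grad u (set_coord k x a) = grad v (set_coord k x b)"
    using x crit eq unfolding exceptional_def xb by blast
  show "(coupled_rearrangement k u v has_derivative (\<lambda>h. grad u (set_coord k x a) \<bullet> h)) (at x)"
    using coupled_derivative_degenerate[OF u v a b ab eq g] crit by simp
qed

lemma coupled_differentiable:
  fixes u v :: "real^'n \<Rightarrow> real"
  assumes u: "admissible k u" and v: "admissible k v" and x: "x \<notin> exceptional k u v" "0 < x $ k"
  shows "\<exists>G. (coupled_rearrangement k u v has_derivative (\<lambda>h. G \<bullet> h)) (at x)"
proof -
  let ?U = "slice k u x" and ?V = "slice k v x"
  note U = admissible_profile[OF u, of x] and V = admissible_profile[OF v, of x]
  have s: "0 \<le> x $ k" using x by simp
  show ?thesis
  proof (cases rule: split_point_cases[OF U V s, case_names left right balanced])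
    case left
    then have "v (set_coord k x 0) < u x" by (simp add: slice_eq_set_coord)
    from coupled_derivative_left[OF u v this] show ?thesis by blast
  next
    case right
    then have "u (set_coord k x 0) < v x" by (simp add: slice_eq_set_coord)
    from coupled_derivative_right[OF u v this] show ?thesis by blast
  next
    case balanced
    define a where "a = split_point ?U ?V (x $ k)"
    define b where "b = x $ k - a"
    have ab: "0 \<le> a" "0 \<le> b" "a + b = x $ k" using split_point_bounds[OF s] by (auto simp: a_def b_def)
    have eq: "u (set_coord k x a) = v (set_coord k x b)"
      using balanced(3) by (simp add: a_def b_def slice_eq_set_coord)
    show ?thesis
    proof (cases "0 < a \<and> 0 < b \<and> grad u (set_coord k x a) $ k + grad v (set_coord k x b) $ k < 0")
      case True
      then have "0 < a" "0 < b" "grad u (set_coord k x a) $ k + grad v (set_coord k x b) $ k \<noteq> 0" by auto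
      from coupled_derivative_regular[OF u v this(1,2) ab(3) eq this(3)] show ?thesis by blast
    next
      case False
      then show ?thesis using coupled_derivative_singular(2)[OF u v ab x(2) eq False x(1)] by blast
    qed
  qed
qed

section \<open>Integrating over the lines\<close>

lemma powr_convex_combination:
  fixes a b l p :: real
  assumes p: "1 \<le> p" and a: "0 \<le> a" and b: "0 \<le> b" and l: "0 \<le> l" "l \<le> 1"
  shows "(l * a + (1 - l) * b) powr p \<le> l * a powr p + (1 - l) * b powr p"
proof -
  have le: "m powr p \<le> m" if "0 \<le> m" "m \<le> 1" for m :: real
    using powr_mono'[OF p that] that by simp
  consider "a = 0" | "b = 0" | "0 < a" "0 < b" using a b by linarith
  then show ?thesis
  proof cases
    case 1
    then show ?thesis using le[of "1 - l"] l b by (simp add: powr_mult mult_right_mono)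
  next
    case 2
    then show ?thesis using le[of l] l a by (simp add: powr_mult mult_right_mono)
  next
    case 3
    then show ?thesis using convex_onD[OF powr_convex[OF p], of "1 - l" a b] l by simp
  qed
qed

text \<open>
  The vector \<open>V = l P + (1 - l) Q\<close> satisfies \<open>V $ k = 2 * (l * P $ k)\<close>, because \<open>l * P $ k = (1 - l) * Q $ k\<close>.
  So \<open>G\<close> arises from \<open>V\<close> by halving one component, which makes the norm smaller, strictly so if that
  component is not \<open>0\<close>.
\<close>

lemma
  fixes P Q :: "real^'n" and p :: real
  assumes p: "1 \<le> p" and le: "P $ k \<le> 0" "Q $ k \<le> 0" and ne: "P $ k + Q $ k < 0"
  defines "l \<equiv> Q $ k / (P $ k + Q $ k)"
  defines "G \<equiv> l *\<^sub>R P + (1 - l) *\<^sub>R Q - (l * P $ k) *\<^sub>R axis k 1"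
  shows regular_gradient_le: "norm G powr p \<le> l * norm P powr p + (1 - l) * norm Q powr p"
    and regular_gradient_less: "P $ k < 0 \<Longrightarrow> Q $ k < 0 \<Longrightarrow>
      norm G powr p < l * norm P powr p + (1 - l) * norm Q powr p"
    and regular_weight: "0 \<le> l" "l \<le> 1"
proof -
  show l: "0 \<le> l" "l \<le> 1" using le ne by (auto simp: l_def divide_nonpos_nonpos divide_le_eq)
  let ?V = "l *\<^sub>R P + (1 - l) *\<^sub>R Q" and ?c = "l * P $ k"
  have "(1 - l) * Q $ k = ?c" using ne by (simp add: l_def field_simps)
  then have Vk: "?V $ k = 2 * ?c" by simp
  have V: "?V = G + ?c *\<^sub>R axis k 1" by (simp add: G_def)
  have "(norm ?V)\<^sup>2 = (norm G)\<^sup>2 + 2 * ?c * (G $ k) + ?c\<^sup>2"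
    unfolding V power2_norm_eq_inner
    by (simp add: inner_add_left inner_add_right inner_axis inner_axis' power2_eq_square algebra_simps)
  moreover have "G $ k = ?c" using Vk unfolding V by simp
  ultimately have sq: "(norm ?V)\<^sup>2 = (norm G)\<^sup>2 + 3 * ?c\<^sup>2" by (simp add: power2_eq_square)
  have GV: "norm G \<le> norm ?V" by (rule power2_le_imp_le) (simp_all add: sq)
  have "norm ?V \<le> l * norm P + (1 - l) * norm Q"
    using norm_triangle_ineq[of "l *\<^sub>R P" "(1 - l) *\<^sub>R Q"] l by simp
  then have "norm ?V powr p \<le> (l * norm P + (1 - l) * norm Q) powr p"
    using p by (intro powr_mono2) auto
  also have "\<dots> \<le> l * norm P powr p + (1 - l) * norm Q powr p"
    using l by (intro powr_convex_combination p) auto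
  finally have V_le: "norm ?V powr p \<le> l * norm P powr p + (1 - l) * norm Q powr p" .
  then show "norm G powr p \<le> l * norm P powr p + (1 - l) * norm Q powr p"
    using powr_mono2[of p "norm G" "norm ?V"] GV p by simp
  show "norm G powr p < l * norm P powr p + (1 - l) * norm Q powr p" if "P $ k < 0" "Q $ k < 0"
  proof -
    have "l \<noteq> 0" using that by (simp add: l_def)
    then have "0 < ?c\<^sup>2" using that by simp
    then have "(norm G)\<^sup>2 < (norm ?V)\<^sup>2" using sq by linarith
    then have "norm G < norm ?V" by (rule power2_less_imp_less) simp
    then have "norm G powr p < norm ?V powr p" using p by (intro powr_less_mono2) auto
    then show ?thesis using V_le by simp
  qed
qed

lemma weak_gradient_integral:
  fixes f :: "real^'n \<Rightarrow> real"
  assumes "has_weak_gradient f G"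
  shows "(\<integral>\<^sup>+x. ennreal (norm (weak_gradient f x) powr p) \<partial>lebesgue) =
    (\<integral>\<^sup>+x. ennreal (norm (G x) powr p) \<partial>lebesgue)"
proof -
  have "has_weak_gradient f (weak_gradient f)" unfolding weak_gradient_def using assms by (rule someI[of "has_weak_gradient f"])
  then have "AE x in lebesgue. weak_gradient f x = G x" using assms by (rule weak_gradient_unique)
  then show ?thesis by (intro nn_integral_cong_AE) (auto elim!: eventually_mono)
qed

lemma C1_has_weak_gradient:
  fixes u :: "real^'n \<Rightarrow> real"
  assumes "C_k 1 u"
  shows "has_weak_gradient u (grad u)"
proof (rule locally_lipschitz_has_weak_gradient[OF C1_locally_lipschitz[OF assms]])
  show "grad u \<in> borel_measurable lebesgue"
    by (rule continuous_measurable_lebesgue[OF C1_grad(2)[OF assms]])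
qed (use C1_grad(1)[OF assms] in simp)

lemma W1p_gradient_finite:
  fixes u :: "real^'n \<Rightarrow> real"
  assumes "in_W1p p u" "C_k 1 u"
  shows "(\<integral>\<^sup>+x. ennreal (norm (grad u x) powr p) \<partial>lborel) < \<infinity>"
proof -
  obtain G where G: "has_weak_gradient u G" "in_Lp p G" using assms(1) by (auto simp: in_W1p_def)
  have "(\<integral>\<^sup>+x. ennreal (norm (grad u x) powr p) \<partial>lebesgue) = (\<integral>\<^sup>+x. ennreal (norm (G x) powr p) \<partial>lebesgue)"
    using weak_gradient_integral[OF C1_has_weak_gradient[OF assms(2)]] weak_gradient_integral[OF G(1)] by metis
  also have "\<dots> < \<infinity>" using G(2) by (auto simp: in_Lp_def integrable_iff_bounded)
  finally show ?thesis by (simp add: nn_integral_completion)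
qed

text \<open>
  The gradient is obtained as a limit of difference quotients, which makes it Borel measurable, and put to
  \<open>0\<close> on a Borel null set that contains the exceptional points and their reflections, so that its norm is
  even in the \<open>k\<close>-th coordinate.
\<close>

lemma coupled_gradient_representative:
  fixes u v :: "real^'n \<Rightarrow> real"
  assumes u: "admissible k u" and v: "admissible k v"
  obtains N :: "(real^'n) set" and G :: "real^'n \<Rightarrow> real^'n"
  where "exceptional k u v \<subseteq> N" "G \<in> borel_measurable borel"
    "\<And>x. x \<in> N \<Longrightarrow> G x = 0"
    "\<And>x g. x \<notin> N \<Longrightarrow> (coupled_rearrangement k u v has_derivative (\<lambda>h. g \<bullet> h)) (at x) \<Longrightarrow> G x = g"
    "\<And>x. norm (G (reflect k x)) = norm (G x)"
    "has_weak_gradient (coupled_rearrangement k u v) G"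
proof -
  let ?w = "coupled_rearrangement k u v"
  have "AE x in lebesgue. x \<notin> exceptional k u v"
    using negligible_exceptional[OF u v] by (simp add: negligible_iff_null_sets AE_not_in)
  then have "AE x in lborel. x \<notin> exceptional k u v" by (simp add: AE_completion_iff)
  then obtain N1 where N1: "exceptional k u v \<subseteq> N1" "emeasure lborel N1 = 0" "N1 \<in> sets borel"
    by (auto elim!: AE_E)
  have negN1: "negligible N1"
    using N1 by (auto simp: negligible_iff_null_sets null_sets_def intro!: null_sets_completionI)
  define N where "N = N1 \<union> {x. reflect k x \<in> N1}"
  have refl_img: "{x. reflect k x \<in> N1} = (\<lambda>x. reflect k x) ` N1"
    using reflect_reflect[of k] by (auto simp: image_iff) (metis reflect_reflect)
  have "negligible N" unfolding N_def refl_img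
    by (intro negligible_Un negN1 negligible_differentiable_image_negligible order_refl
        linear_imp_differentiable_on linear_reflect)
  have cont_refl: "continuous_on UNIV (\<lambda>x::real^'n. reflect k x)" by (intro continuous_intros)
  have "(\<lambda>x::real^'n. reflect k x) \<in> borel_measurable borel"
    using cont_refl by (rule borel_measurable_continuous_onI)
  from measurable_sets[OF this N1(3)] have N_borel [measurable]: "N \<in> sets borel"
    using N1(3) by (simp add: N_def vimage_def)
  have N_sym: "reflect k x \<in> N \<longleftrightarrow> x \<in> N" for x
    unfolding N_def using reflect_reflect[of k x] by auto
  have N_exc: "exceptional k u v \<subseteq> N" using N1(1) by (auto simp: N_def)
  define h where "h m = 1 / real (Suc m)" for m
  have h: "0 < h m" for m by (simp add: h_def)
  have h0: "h \<longlonglongrightarrow> 0" unfolding h_def using LIMSEQ_inverse_real_of_nat by (simp add: inverse_eq_divide)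
  define G where "G x = indicat_real (- N) x *\<^sub>R (\<chi> i. lim (\<lambda>m. (?w (x + (1 * h m) *\<^sub>R axis i 1) - ?w x) / h m))" for x
  have wc: "continuous_on UNIV ?w" using locally_lipschitz_continuous[OF coupled_locally_lipschitz[OF u v]] .
  have G_eq: "G x = g" if "x \<notin> N" "(?w has_derivative (\<lambda>h. g \<bullet> h)) (at x)" for x g
  proof -
    have "lim (\<lambda>m. (?w (x + (1 * h m) *\<^sub>R axis i 1) - ?w x) / h m) = g $ i" for i
      using difference_quotient_tendsto[OF that(2) h0 h, of 1 i] by (simp add: limI)
    then show ?thesis using that(1) by (simp add: G_def vec_eq_iff)
  qed
  have diff: "\<exists>g. (?w has_derivative (\<lambda>h. g \<bullet> h)) (at x)" if x: "x \<notin> N" for x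
  proof (cases "0 < x $ k")
    case True
    then show ?thesis using coupled_differentiable[OF u v] x N_exc by blast
  next
    case False
    have x': "reflect k x \<notin> N" using x N_sym by blast
    have "x \<notin> exceptional k u v" using x N_exc by blast
    then have "0 < reflect k x $ k" using False by (auto simp: exceptional_def)
    then obtain g where g: "(?w has_derivative (\<lambda>h. g \<bullet> h)) (at (reflect k x))"
      using coupled_differentiable[OF u v] x' N_exc by blast
    have "(?w has_derivative (\<lambda>h. reflect k g \<bullet> h)) (at (reflect k (reflect k x)))"
      using g coupled_reflect by (rule has_derivative_reflect)
    then show ?thesis by (simp only: reflect_reflect) blast
  qed
  have Gm: "G \<in> borel_measurable borel"
  proof (subst borel_measurable_euclidean_space, intro ballI)
    fix b :: "real^'n" assume "b \<in> Basis"
    then obtain i where b: "b = axis i 1" by (auto simp: Basis_vec_def)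
    have "(\<lambda>x. (?w (x + (1 * h m) *\<^sub>R axis i 1) - ?w x) / h m) \<in> borel_measurable borel" for m
      using h[of m] by (intro borel_measurable_continuous_onI continuous_intros wc continuous_on_compose2[OF wc]) auto
    then have "(\<lambda>x. lim (\<lambda>m. (?w (x + (1 * h m) *\<^sub>R axis i 1) - ?w x) / h m)) \<in> borel_measurable borel"
      by (rule borel_measurable_lim_metric)
    then have "(\<lambda>x. indicat_real (- N) x * lim (\<lambda>m. (?w (x + (1 * h m) *\<^sub>R axis i 1) - ?w x) / h m)) \<in> borel_measurable borel"
      using N_borel by (intro borel_measurable_times borel_measurable_indicator) auto
    then show "(\<lambda>x. G x \<bullet> b) \<in> borel_measurable borel" by (simp add: G_def b inner_axis)
  qed
  show ?thesis
  proof (rule that[OF N_exc Gm])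
    show "G x = 0" if "x \<in> N" for x using that by (simp add: G_def)
    show "G x = g" if "x \<notin> N" "(?w has_derivative (\<lambda>h. g \<bullet> h)) (at x)" for x g using G_eq that .
    show "norm (G (reflect k x)) = norm (G x)" for x
    proof (cases "x \<in> N")
      case True
      then show ?thesis using N_sym[of x] by (simp add: G_def)
    next
      case False
      then obtain g where g: "(?w has_derivative (\<lambda>h. g \<bullet> h)) (at x)" using diff by blast
      have "reflect k x \<notin> N" using False N_sym by blast
      moreover have "(?w has_derivative (\<lambda>h. reflect k g \<bullet> h)) (at (reflect k x))"
        using g coupled_reflect by (rule has_derivative_reflect)
      ultimately have "G (reflect k x) = reflect k g" by (rule G_eq)
      then show ?thesis using G_eq[OF False g] by (simp only: norm_reflect)
    qed
    show "has_weak_gradient ?w G"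
    proof (rule locally_lipschitz_has_weak_gradient[OF coupled_locally_lipschitz[OF u v]])
      show "G \<in> borel_measurable lebesgue" using Gm by (intro measurable_completion) simp
      have "AE x in lebesgue. x \<notin> N"
        using \<open>negligible N\<close> by (simp add: negligible_iff_null_sets AE_not_in)
      then show "AE x in lebesgue. (?w has_derivative (\<lambda>h. G x \<bullet> h)) (at x)"
      proof eventually_elim
        case (elim x)
        then obtain g where "(?w has_derivative (\<lambda>h. g \<bullet> h)) (at x)" using diff by blast
        then show ?case using G_eq[OF elim] by simp
      qed
    qed
  qed
qed

lemma ennreal_convex_combination:
  assumes "0 \<le> l" "l \<le> 1" "0 \<le> a" "0 \<le> b"
  shows "ennreal l * ennreal a + ennreal (1 - l) * ennreal b = ennreal (l * a + (1 - l) * b)"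
proof -
  have "ennreal (l * a) = ennreal l * ennreal a" "ennreal ((1 - l) * b) = ennreal (1 - l) * ennreal b"
    using assms by (simp_all only: ennreal_mult diff_ge_0_iff_ge)
  moreover have "ennreal (l * a + (1 - l) * b) = ennreal (l * a) + ennreal ((1 - l) * b)"
    using assms by (intro ennreal_plus) auto
  ultimately show ?thesis by (simp only:)
qed

text \<open>
  On the null set \<open>N\<close> the pointwise bounds hold trivially because \<open>G\<close> vanishes there, so no line has to be
  excluded.
\<close>

lemma coupled_slice_integral:
  fixes u v :: "real^'n \<Rightarrow> real" and G :: "real^'n \<Rightarrow> real^'n"
  assumes u: "admissible k u" and v: "admissible k v" and p: "1 \<le> p"
    and N: "exceptional k u v \<subseteq> N" and Gm: "G \<in> borel_measurable borel"
    and G0: "\<And>x. x \<in> N \<Longrightarrow> G x = 0"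
    and G: "\<And>x g. x \<notin> N \<Longrightarrow> (coupled_rearrangement k u v has_derivative (\<lambda>h. g \<bullet> h)) (at x) \<Longrightarrow> G x = g"
    and fin: "half_integral (\<lambda>s. ennreal (norm (grad u (set_coord k x s)) powr p)) < \<infinity>"
      "half_integral (\<lambda>s. ennreal (norm (grad v (set_coord k x s)) powr p)) < \<infinity>"
  shows "half_integral (\<lambda>s. ennreal (norm (G (set_coord k x s)) powr p)) <
      half_integral (\<lambda>s. ennreal (norm (grad u (set_coord k x s)) powr p)) +
      half_integral (\<lambda>s. ennreal (norm (grad v (set_coord k x s)) powr p))"
proof (rule coupled_profile_integral[OF admissible_profile[OF u, of x] admissible_profile[OF v, of x]
      slice_has_derivative[OF admissible_C1[OF u]] slice_deriv_continuous[OF admissible_C1[OF u]]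
      slice_has_derivative[OF admissible_C1[OF v]] slice_deriv_continuous[OF admissible_C1[OF v]] _ _ _ fin])
  have [measurable]: "grad u \<in> borel_measurable borel" "grad v \<in> borel_measurable borel"
    using C1_grad(2)[OF admissible_C1[OF u]] C1_grad(2)[OF admissible_C1[OF v]] by (auto intro: borel_measurable_continuous_onI)
  note [measurable] = Gm
  show "(\<lambda>s. ennreal (norm (grad u (set_coord k x s)) powr p)) \<in> borel_measurable borel"
    "(\<lambda>s. ennreal (norm (grad v (set_coord k x s)) powr p)) \<in> borel_measurable borel"
    "(\<lambda>s. ennreal (norm (G (set_coord k x s)) powr p)) \<in> borel_measurable borel"
    by measurable
  show "ennreal (norm (G (set_coord k x s)) powr p) \<le> ennreal (norm (grad u (set_coord k x s)) powr p)"
    if "0 < s" "slice k v x 0 < slice k u x s" for s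
  proof (cases "set_coord k x s \<in> N")
    case False
    have "G (set_coord k x s) = grad u (set_coord k x s)"
      using that(2) by (intro G[OF False] coupled_derivative_left[OF u v]) (simp add: slice_eq_set_coord)
    then show ?thesis by simp
  qed (simp add: G0)
  show "ennreal (norm (G (set_coord k x s)) powr p) \<le> ennreal (norm (grad v (set_coord k x s)) powr p)"
    if "0 < s" "slice k u x 0 < slice k v x s" for s
  proof (cases "set_coord k x s \<in> N")
    case False
    have "G (set_coord k x s) = grad v (set_coord k x s)"
      using that(2) by (intro G[OF False] coupled_derivative_right[OF u v]) (simp add: slice_eq_set_coord)
    then show ?thesis by simp
  qed (simp add: G0)
  fix a b :: real
  let ?P = "grad u (set_coord k x a)" and ?Q = "grad v (set_coord k x b)" and ?X = "set_coord k x (a + b)"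
  let ?l = "?Q $ k / (?P $ k + ?Q $ k)"
  have reg: "G ?X = ?l *\<^sub>R ?P + (1 - ?l) *\<^sub>R ?Q - (?l * ?P $ k) *\<^sub>R axis k 1"
    if "0 < a" "0 < b" "slice k u x a = slice k v x b" "?P $ k + ?Q $ k < 0" "?X \<notin> N"
  proof (rule G[OF that(5)])
    show "(coupled_rearrangement k u v has_derivative
        (\<lambda>h. (?l *\<^sub>R ?P + (1 - ?l) *\<^sub>R ?Q - (?l * ?P $ k) *\<^sub>R axis k 1) \<bullet> h)) (at ?X)"
      using coupled_derivative_regular[OF u v that(1,2), of ?X] that(3,4) by (simp add: slice_eq_set_coord)
  qed
  show "ennreal (norm (G ?X) powr p) \<le>
      ennreal ?l * ennreal (norm ?P powr p) + ennreal (1 - ?l) * ennreal (norm ?Q powr p)"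
    if h: "0 < a" "0 < b" "slice k u x a = slice k v x b" "?P $ k + ?Q $ k < 0"
  proof (cases "?X \<in> N")
    case False
    have np: "?P $ k \<le> 0" "?Q $ k \<le> 0" using h grad_nonpos[OF u] grad_nonpos[OF v] by auto
    show ?thesis
      using regular_gradient_le[OF p np h(4)] regular_weight[OF p np h(4)] unfolding reg[OF h False]
      by (simp add: ennreal_convex_combination ennreal_leI)
  qed (simp add: G0)
  show "ennreal (norm (G ?X) powr p) <
      ennreal ?l * ennreal (norm ?P powr p) + ennreal (1 - ?l) * ennreal (norm ?Q powr p)"
    if h: "0 < a" "0 < b" "slice k u x a = slice k v x b" "?P $ k < 0" "?Q $ k < 0"
  proof -
    have h4: "?P $ k + ?Q $ k < 0" and np: "?P $ k \<le> 0" "?Q $ k \<le> 0" using h by auto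
    note less = regular_gradient_less[OF p np h4 h(4,5)] and w = regular_weight[OF p np h4]
    have "norm (G ?X) powr p < ?l * norm ?P powr p + (1 - ?l) * norm ?Q powr p"
    proof (cases "?X \<in> N")
      case True
      then have zero: "norm (G ?X) powr p = 0" by (simp add: G0)
      show ?thesis unfolding zero by (rule le_less_trans[OF powr_ge_zero less])
    next
      case False
      then show ?thesis using less reg[OF h(1-3) h4 False] by simp
    qed
    then show ?thesis
      unfolding ennreal_convex_combination[OF w powr_ge_zero powr_ge_zero]
      by (simp only: ennreal_less_iff powr_ge_zero)
  qed
  show "ennreal (norm (G ?X) powr p) \<le> min (ennreal (norm ?P powr p)) (ennreal (norm ?Q powr p))"
    if h: "0 \<le> a" "0 \<le> b" "0 < a + b" "slice k u x a = slice k v x b"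
      "\<not> (0 < a \<and> 0 < b \<and> ?P $ k + ?Q $ k < 0)"
  proof (cases "?X \<in> N")
    case False
    then have exc: "?X \<notin> exceptional k u v" using N by blast
    have "u (set_coord k ?X a) = v (set_coord k ?X b)" using h(4) by (simp add: slice_eq_set_coord)
    from coupled_derivative_singular[OF u v h(1,2) _ _ this _ exc] h(3,5)
    have "?P = ?Q" "(coupled_rearrangement k u v has_derivative (\<lambda>h. ?P \<bullet> h)) (at ?X)" by auto
    then show ?thesis using G[OF False] by simp
  qed (simp add: G0)
qed

theorem theorem2p4:
  fixes k :: "'n::finite" and p :: real and u v :: "real^'n \<Rightarrow> real"
  assumes "1 \<le> p"
    and "in_W1p p u" and "in_W1p p v"
    and "C_k 1 u" and "C_k 1 v"
    and "\<And>x. u x > 0" and "\<And>x. v x > 0"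
    and "(u \<longlongrightarrow> 0) at_infinity" and "(v \<longlongrightarrow> 0) at_infinity"
    and "decreasing_in_abs k u" and "decreasing_in_abs k v"
  shows "weakly_differentiable (coupled_rearrangement k u v) \<and>
    (\<integral>\<^sup>+ x. ennreal (norm (weak_gradient (coupled_rearrangement k u v) x) powr p) \<partial>lebesgue)
      < (\<integral>\<^sup>+ x. ennreal (norm (weak_gradient u x) powr p) \<partial>lebesgue)
        + (\<integral>\<^sup>+ x. ennreal (norm (weak_gradient v x) powr p) \<partial>lebesgue)"
proof -
  have u: "admissible k u" and v: "admissible k v" unfolding admissible_def using assms by blast+
  obtain N G where N: "exceptional k u v \<subseteq> N" and G [measurable]: "G \<in> borel_measurable borel"
    and G0: "\<And>x. x \<in> N \<Longrightarrow> G x = 0"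
    and G_eq: "\<And>x g. x \<notin> N \<Longrightarrow> (coupled_rearrangement k u v has_derivative (\<lambda>h. g \<bullet> h)) (at x) \<Longrightarrow> G x = g"
    and G_sym: "\<And>x. norm (G (reflect k x)) = norm (G x)"
    and weak: "has_weak_gradient (coupled_rearrangement k u v) G"
    by (rule coupled_gradient_representative[OF u v]) blast
  have grad_m [measurable]: "grad u \<in> borel_measurable borel" "grad v \<in> borel_measurable borel"
    using C1_grad(2)[OF admissible_C1[OF u]] C1_grad(2)[OF admissible_C1[OF v]] by (auto intro: borel_measurable_continuous_onI)
  let ?M = "other_coords k"
  define half where "half H y = half_integral (\<lambda>s. ennreal (norm (H (set_coord k (embed_others k y) s)) powr p))"
    for H :: "real^'n \<Rightarrow> real^'n" and y
  have half_m [measurable]: "half H \<in> borel_measurable ?M" if [measurable]: "H \<in> borel_measurable borel" for H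
    unfolding half_def[abs_def] by (intro lborel.borel_measurable_nn_integral) measurable
  have fubini: "(\<integral>\<^sup>+x. ennreal (norm (H x) powr p) \<partial>lborel) = 2 * (\<integral>\<^sup>+y. half H y \<partial>?M)"
    if [measurable]: "H \<in> borel_measurable borel" and sym: "\<And>x. norm (H (reflect k x)) = norm (H x)" for H
  proof -
    have "(\<integral>\<^sup>+x. ennreal (norm (H x) powr p) \<partial>lborel) =
        (\<integral>\<^sup>+y. (\<integral>\<^sup>+s. ennreal (norm (H (set_coord k (embed_others k y) s)) powr p) \<partial>lborel) \<partial>?M)"
      by (rule nn_integral_coord) measurable
    also have "\<dots> = (\<integral>\<^sup>+y. 2 * half H y \<partial>?M)"
    proof (rule nn_integral_cong)
      fix y
      have "norm (H (set_coord k (embed_others k y) (- s))) = norm (H (set_coord k (embed_others k y) s))" for s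
        using sym[of "set_coord k (embed_others k y) s"] by simp
      then show "(\<integral>\<^sup>+s. ennreal (norm (H (set_coord k (embed_others k y) s)) powr p) \<partial>lborel) = 2 * half H y"
        unfolding half_def by (intro nn_integral_even) simp_all
    qed
    finally show ?thesis by (simp add: nn_integral_cmult)
  qed
  have grad_sym: "norm (grad f (reflect k x)) = norm (grad f x)" if "admissible k f" for f :: "real^'n \<Rightarrow> real" and x
    using C1_grad(1)[OF admissible_C1[OF that], of x] admissible_reflect[OF that] by (rule norm_grad_reflect)
  have split_u: "(\<integral>\<^sup>+x. ennreal (norm (grad u x) powr p) \<partial>lborel) = 2 * (\<integral>\<^sup>+y. half (grad u) y \<partial>?M)"
  proof (rule fubini)
    show "grad u \<in> borel_measurable borel" by measurable
    show "norm (grad u (reflect k x)) = norm (grad u x)" for x by (rule grad_sym[OF u])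
  qed
  have split_v: "(\<integral>\<^sup>+x. ennreal (norm (grad v x) powr p) \<partial>lborel) = 2 * (\<integral>\<^sup>+y. half (grad v) y \<partial>?M)"
  proof (rule fubini)
    show "grad v \<in> borel_measurable borel" by measurable
    show "norm (grad v (reflect k x)) = norm (grad v x)" for x by (rule grad_sym[OF v])
  qed
  have split_G: "(\<integral>\<^sup>+x. ennreal (norm (G x) powr p) \<partial>lborel) = 2 * (\<integral>\<^sup>+y. half G y \<partial>?M)"
    using G G_sym by (rule fubini)
  have fin: "(\<integral>\<^sup>+y. half (grad u) y \<partial>?M) < \<infinity>" "(\<integral>\<^sup>+y. half (grad v) y \<partial>?M) < \<infinity>"
    using W1p_gradient_finite[OF assms(2,4)] W1p_gradient_finite[OF assms(3,5)]
    unfolding split_u split_v by (auto simp: ennreal_mult_less_top)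
  have "AE y in ?M. half (grad u) y \<noteq> \<infinity>" "AE y in ?M. half (grad v) y \<noteq> \<infinity>"
    using nn_integral_PInf_AE[OF half_m[OF grad_m(1)]] nn_integral_PInf_AE[OF half_m[OF grad_m(2)]] fin
    by simp_all
  then have less: "AE y in ?M. half G y < half (grad u) y + half (grad v) y"
  proof eventually_elim
    case (elim y)
    then show ?case
      unfolding half_def by (intro coupled_slice_integral[OF u v assms(1) N G G0 G_eq]) (auto simp: less_top)
  qed
  have "(\<integral>\<^sup>+y. half G y \<partial>?M) < (\<integral>\<^sup>+y. half (grad u) y + half (grad v) y \<partial>?M)"
  proof (rule nn_integral_less)
    show le: "AE y in ?M. half G y \<le> half (grad u) y + half (grad v) y"
      using less by eventually_elim simp
    have "(\<integral>\<^sup>+y. half G y \<partial>?M) \<le> (\<integral>\<^sup>+y. half (grad u) y + half (grad v) y \<partial>?M)"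
      using le by (rule nn_integral_mono_AE)
    also have "\<dots> < \<infinity>" using fin by (simp add: nn_integral_add)
    finally show "(\<integral>\<^sup>+y. half G y \<partial>?M) \<noteq> \<infinity>" by simp
    show "\<not> (AE y in ?M. half (grad u) y + half (grad v) y \<le> half G y)"
    proof
      assume "AE y in ?M. half (grad u) y + half (grad v) y \<le> half G y"
      with less have "AE y in ?M. False" by eventually_elim auto
      then have "(\<integral>\<^sup>+y. (\<integral>\<^sup>+s. 1 \<partial>(lborel :: real measure)) \<partial>?M) = (\<integral>\<^sup>+y. 0 \<partial>?M)"
        by (intro nn_integral_cong_AE) (auto elim: eventually_mono)
      then have "(\<integral>\<^sup>+x. 1 \<partial>(lborel :: (real^'n) measure)) = 0"
        using nn_integral_coord[of "\<lambda>_. 1" k] by simp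
      then show False by simp
    qed
  qed measurable
  also have "\<dots> = (\<integral>\<^sup>+y. half (grad u) y \<partial>?M) + (\<integral>\<^sup>+y. half (grad v) y \<partial>?M)"
    by (simp add: nn_integral_add)
  finally have "(\<integral>\<^sup>+x. ennreal (norm (G x) powr p) \<partial>lborel) <
      (\<integral>\<^sup>+x. ennreal (norm (grad u x) powr p) \<partial>lborel) + (\<integral>\<^sup>+x. ennreal (norm (grad v x) powr p) \<partial>lborel)"
    unfolding split_u split_v split_G distrib_left[symmetric] by (intro ennreal_mult_strict_left_mono) auto
  then have "(\<integral>\<^sup>+ x. ennreal (norm (weak_gradient (coupled_rearrangement k u v) x) powr p) \<partial>lebesgue)
      < (\<integral>\<^sup>+ x. ennreal (norm (weak_gradient u x) powr p) \<partial>lebesgue)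
        + (\<integral>\<^sup>+ x. ennreal (norm (weak_gradient v x) powr p) \<partial>lebesgue)"
    unfolding weak_gradient_integral[OF weak] weak_gradient_integral[OF C1_has_weak_gradient[OF assms(4)]]
      weak_gradient_integral[OF C1_has_weak_gradient[OF assms(5)]]
    by (simp only: nn_integral_completion)
  then show ?thesis using weak by (auto simp: weakly_differentiable_def)
qed

end
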